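(* There exist $T>0$, $w\in W^{1,2}(0,T)$, and a continuous Lagrangian $L\colon[0,T]\times\mathbb{R}\times\mathbb{R}\to[0,\infty)$, $L=L(t,y,p)$, superlinear in $p$ and with $L_{pp}\ge2>0$, such that $w$ is a minimizer of $\mathscr{L}$ over $\mathscr{A}_{w(0),w(T)}$ and $0\le\mathscr{L}(w)<\infty$, but $\mathscr{L}(w+u)=\infty$ for all non-zero $u\in W^{1,\infty}_0(0,T)$. Moreover, the Lavrentiev phenomenon occurs.
   Context: $\mathscr{L}(u)=\int_0^TL(t,u(t),u'(t))\,dt\in[0,\infty]$ for $u\in W^{1,1}(0,T)$ (real-valued functions, identified with their absolutely continuous representatives on $[0,T]$). $\mathscr{A}_{A,B}=\{u\in W^{1,1}(0,T):u(0)=A,\ u(T)=B\}$. A minimizer of $\mathscr{L}$ over $\mathscr{A}_{A,B}$ is $v\in\mathscr{A}_{A,B}$ with $\mathscr{L}(v)\le\mathscr{L}(u)$ for all $u\in\mathscr{A}_{A,B}$. $L$ is superlinear if there is $\omega\colon\mathbb{R}\to\mathbb{R}$ with $\omega(|p|)/|p|\to\infty$ as $|p|\to\infty$ and $L(t,y,p)\ge\omega(|p|)$ for all $(t,y,p)$. $L_{pp}$ denotes the second partial derivative of $L$ in $p$. $W_0^{1,\infty}(0,T)$ is the space of Lipschitz functions on $[0,T]$ vanishing at $0$ and $T$. For a minimizer $w$ of $\mathscr{L}$ over $\mathscr{A}_{w(0),w(T)}$, the Lavrentiev phenomenon is said to occur if there is no sequence $u_j\in W^{1,\infty}(0,T)\cap\mathscr{A}_{w(0),w(T)}$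 with $\mathscr{L}(u_j)\to\mathscr{L}(w)$, i.e. $\inf\{\mathscr{L}(u):u\in W^{1,\infty}(0,T)\cap\mathscr{A}_{w(0),w(T)}\}>\mathscr{L}(w)$. *)

theory Defs
  imports "HOL-Analysis.Analysis"
begin

section \<open>Sobolev functions on an interval\<close>

text \<open>A finite family of non-overlapping compact subintervals is a
  division of its union.\<close>

definition abs_continuous_on :: "real set \<Rightarrow> (real \<Rightarrow> real) \<Rightarrow> bool" where
  "abs_continuous_on I u \<longleftrightarrow>
     (\<forall>\<epsilon>>0. \<exists>\<delta>>0. \<forall>\<D> S. \<D> division_of S \<and> S \<subseteq> I \<and> (\<Sum>K\<in>\<D>. Sup K - Inf K) < \<delta> \<longrightarrow>
        (\<Sum>K\<in>\<D>. \<bar>u (Sup K) - u (Inf K)\<bar>) < \<epsilon>)"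

text \<open>Functions on \<open>[0,T]\<close> are total functions of which only the values on \<open>{0..T}\<close>
  are ever used. The exponent \<open>q\<close> is meant to satisfy \<open>1 \<le> q < \<infinity>\<close>.\<close>

definition Lebesgue_space :: "real \<Rightarrow> real \<Rightarrow> (real \<Rightarrow> real) set" where
  "Lebesgue_space T q =
     {f. f \<in> borel_measurable (lebesgue_on {0..T}) \<and>
         integrable (lebesgue_on {0..T}) (\<lambda>t. \<bar>f t\<bar> powr q)}"

text \<open>Test functions are the \<open>C\<^sup>1\<close> functions with compact support in \<open>(0,T)\<close>.\<close>

definition has_weak_derivative :: "real \<Rightarrow> (real \<Rightarrow> real) \<Rightarrow> (real \<Rightarrow> real) \<Rightarrow> bool" where
  "has_weak_derivative T u g \<longleftrightarrow>
     (\<forall>\<phi>::real \<Rightarrow> real.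
        \<phi> C1_differentiable_on UNIV \<and> closure {t. \<phi> t \<noteq> 0} \<subseteq> {0<..<T} \<longrightarrow>
        (\<integral>t. u t * deriv \<phi> t \<partial>lebesgue_on {0..T}) =
        - (\<integral>t. g t * \<phi> t \<partial>lebesgue_on {0..T}))"

text \<open>\<open>W\<^sup>1\<^sup>,\<^sup>q(0,T)\<close> for \<open>1 \<le> q < \<infinity>\<close>; each class is identified with its absolutely
  continuous representative, so that pointwise values are meaningful.\<close>

definition Sobolev_space :: "real \<Rightarrow> real \<Rightarrow> (real \<Rightarrow> real) set" where
  "Sobolev_space T q =
     {u. abs_continuous_on {0..T} u \<and> u \<in> Lebesgue_space T q \<and>
         (\<exists>g \<in> Lebesgue_space T q. has_weak_derivative T u g)}"

text \<open>\<open>W\<^sup>1\<^sup>,\<^sup>\<infinity>(0,T)\<close> is the space of Lipschitz functions on \<open>[0,T]\<close>.\<close>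

definition Sobolev_inf :: "real \<Rightarrow> (real \<Rightarrow> real) set" where
  "Sobolev_inf T = {u. \<exists>C. C-lipschitz_on {0..T} u}"

definition Sobolev_inf_0 :: "real \<Rightarrow> (real \<Rightarrow> real) set" where
  "Sobolev_inf_0 T = {u \<in> Sobolev_inf T. u 0 = 0 \<and> u T = 0}"

text \<open>The weak derivative is unique up to a null set, so the choice of a
  representative does not influence the integral functional below.\<close>

definition weak_deriv :: "real \<Rightarrow> (real \<Rightarrow> real) \<Rightarrow> real \<Rightarrow> real" where
  "weak_deriv T u = (SOME g. g \<in> Lebesgue_space T 1 \<and> has_weak_derivative T u g)"


section \<open>The variational problem\<close>

definition functional ::
  "(real \<Rightarrow> real \<Rightarrow> real \<Rightarrow> real) \<Rightarrow> real \<Rightarrow> (real \<Rightarrow> real) \<Rightarrow> ennreal" where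
  "functional L T u = (\<integral>\<^sup>+t. ennreal (L t (u t) (weak_deriv T u t)) \<partial>lebesgue_on {0..T})"

definition admissible :: "real \<Rightarrow> real \<Rightarrow> real \<Rightarrow> (real \<Rightarrow> real) set" where
  "admissible T A B = {u \<in> Sobolev_space T 1. u 0 = A \<and> u T = B}"

definition is_minimizer ::
  "(real \<Rightarrow> real \<Rightarrow> real \<Rightarrow> real) \<Rightarrow> real \<Rightarrow> real \<Rightarrow> real \<Rightarrow> (real \<Rightarrow> real) \<Rightarrow> bool" where
  "is_minimizer L T A B v \<longleftrightarrow>
     v \<in> admissible T A B \<and> (\<forall>u \<in> admissible T A B. functional L T v \<le> functional L T u)"

definition continuous_lagrangian ::
  "real \<Rightarrow> (real \<Rightarrow> real \<Rightarrow> real \<Rightarrow> real) \<Rightarrow> bool" where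
  "continuous_lagrangian T L \<longleftrightarrow>
     continuous_on ({0..T} \<times> UNIV \<times> UNIV) (\<lambda>(t, y, p). L t y p) \<and>
     (\<forall>t\<in>{0..T}. \<forall>y p. 0 \<le> L t y p)"

definition superlinear :: "real \<Rightarrow> (real \<Rightarrow> real \<Rightarrow> real \<Rightarrow> real) \<Rightarrow> bool" where
  "superlinear T L \<longleftrightarrow>
     (\<exists>\<omega>::real \<Rightarrow> real. filterlim (\<lambda>p::real. \<omega> \<bar>p\<bar> / \<bar>p\<bar>) at_top at_infinity \<and>
        (\<forall>t\<in>{0..T}. \<forall>y p. \<omega> \<bar>p\<bar> \<le> L t y p))"

text \<open>The bound includes the existence of \<open>L\<^sub>p\<^sub>p\<close> at every point.\<close>

definition L_pp_ge :: "real \<Rightarrow> (real \<Rightarrow> real \<Rightarrow> real \<Rightarrow> real) \<Rightarrow> real \<Rightarrow> bool" where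
  "L_pp_ge T L c \<longleftrightarrow>
     (\<forall>t\<in>{0..T}. \<forall>y p. L t y differentiable at p \<and> deriv (L t y) differentiable at p \<and>
        c \<le> deriv (deriv (L t y)) p)"

definition lavrentiev_phenomenon ::
  "(real \<Rightarrow> real \<Rightarrow> real \<Rightarrow> real) \<Rightarrow> real \<Rightarrow> (real \<Rightarrow> real) \<Rightarrow> bool" where
  "lavrentiev_phenomenon L T w \<longleftrightarrow>
     \<not> (\<exists>v :: nat \<Rightarrow> real \<Rightarrow> real.
          (\<forall>j. v j \<in> Sobolev_inf T \<inter> admissible T (w 0) (w T)) \<and>
          (\<lambda>j. functional L T (v j)) \<longlonglongrightarrow> functional L T w)"

lemma lavrentiev_phenomenon_iff_INF:
  assumes min: "is_minimizer L T (w 0) (w T) w" and fin: "functional L T w < \<infinity>"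
  shows "lavrentiev_phenomenon L T w \<longleftrightarrow>
     functional L T w < (INF u \<in> Sobolev_inf T \<inter> admissible T (w 0) (w T). functional L T u)"
    (is "_ \<longleftrightarrow> ?m < (INF u\<in>?S. ?F u)")
proof
  assume lav: "lavrentiev_phenomenon L T w"
  show "?m < (INF u\<in>?S. ?F u)"
  proof (rule ccontr)
    assume "\<not> ?thesis"
    then have le: "(INF u\<in>?S. ?F u) \<le> ?m" by simp
    have "\<exists>u\<in>?S. ?F u < ?m + ennreal (1 / real (Suc j))" for j
    proof -
      have "?m < ?m + ennreal (1 / real (Suc j))"
        using fin by simp
      with le have "(INF u\<in>?S. ?F u) < ?m + ennreal (1 / real (Suc j))"
        by (rule le_less_trans)
      then show ?thesis by (simp only: INF_less_iff)
    qed
    then have "\<forall>j. \<exists>u. u \<in> ?S \<and> ?F u < ?m + ennreal (1 / real (Suc j))" by blast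
    from choice[OF this] obtain v
      where v: "\<And>j. v j \<in> ?S" "\<And>j. ?F (v j) < ?m + ennreal (1 / real (Suc j))" by blast
    have lower: "?m \<le> ?F (v j)" for j
      using min v(1)[of j] unfolding is_minimizer_def by blast
    have "(\<lambda>j. ?m + ennreal (1 / real (Suc j))) \<longlonglongrightarrow> ?m + ennreal 0"
      by (rule tendsto_add[OF tendsto_const tendsto_ennrealI[OF LIMSEQ_Suc[OF lim_1_over_n]]])
    then have upper: "(\<lambda>j. ?m + ennreal (1 / real (Suc j))) \<longlonglongrightarrow> ?m" by simp
    have "(\<lambda>j. ?F (v j)) \<longlonglongrightarrow> ?m"
      by (rule tendsto_sandwich[OF _ _ tendsto_const upper])
        (auto intro: always_eventually lower less_imp_le[OF v(2)] simp del: of_nat_Suc)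
    with v(1) lav show False unfolding lavrentiev_phenomenon_def by blast
  qed
next
  assume less: "?m < (INF u\<in>?S. ?F u)"
  show "lavrentiev_phenomenon L T w"
    unfolding lavrentiev_phenomenon_def
  proof (intro notI, elim exE conjE)
    fix v :: "nat \<Rightarrow> real \<Rightarrow> real"
    assume v: "\<forall>j. v j \<in> ?S" and lim: "(\<lambda>j. ?F (v j)) \<longlonglongrightarrow> ?m"
    have "(INF u\<in>?S. ?F u) \<le> ?m"
      by (rule LIMSEQ_le_const[OF lim]) (use v in \<open>blast intro: INF_lower\<close>)
    with less show False by simp
  qed
qed

end

theory Submission
  imports Defs
begin

text \<open>Write \<open>\<L>\<close> for the functional, \<open>w\<close> for the function \<open>curve\<close>, \<open>f\<close> for its derivative \<open>slope\<close> and \<open>u = v - w\<close> for the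
deviation of a competitor \<open>v\<close>. On \<open>[0,1]\<close> the Lagrangian is
\<open>L(t,y,p) = p\<^sup>2 + weight \<bar>y - w(t)\<bar> * growth p\<close>, where \<open>weight\<close> is positive except at \<open>0\<close> and \<open>growth\<close>
is convex and as fast as needed. The second term, the penalty, is zero along \<open>w\<close>, so
\<open>\<L>(w) = \<integral> f\<^sup>2\<close>.

\<^bold>\<open>The singular function.\<close> \<open>f\<close> is a sum of \<open>C\<^sup>1\<close> spikes of height \<open>1/(n+1)\<close> and width of order
\<open>4\<^sup>-\<^sup>n\<close>. The widths make \<open>f\<close> square integrable with very small tails, while the divergence of the
harmonic series allows every rational point of \<open>(0,1)\<close> to receive infinitely many spikes whose
heights sum to infinity. Hence \<open>f\<close> tends to infinity, extremely slowly, at a dense set of points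
(\<open>node_divergence\<close>).

\<^bold>\<open>Minimality.\<close> Let \<open>F\<^sub>n\<close> be the sum of the first \<open>n\<close> spikes. It is a test function, so
\<open>\<integral> F\<^sub>n (v' - f) = - \<integral> F\<^sub>n' u\<close>, and completing squares gives
\<open>\<integral> v'\<^sup>2 - \<integral> f\<^sup>2 \<ge> - 2 \<integral> \<bar>F\<^sub>n'\<bar> \<bar>u\<bar> - \<integral> (f - F\<^sub>n)\<^sup>2\<close> (\<open>integral_square_comparison\<close>). The penalty pays
for both errors if \<open>n\<close> is chosen such that \<open>max \<bar>u\<bar>\<close> is comparable with \<open>4\<^sup>-\<^sup>n\<close>. The first one is
bounded pointwise, because \<open>\<bar>F\<^sub>n'\<bar> \<bar>u\<bar>\<close> is at most a multiple of \<open>1/(n+1)\<close>, which is the size of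
\<open>weight\<close> at \<open>4\<^sup>-\<^sup>n\<close>, and for smaller \<open>\<bar>u\<bar>\<close> it decreases faster than \<open>weight \<bar>u\<bar>\<close>. For the second one, \<open>u\<close> has to grow from half its maximum to its maximum,
which costs at least a multiple of \<open>weight(4\<^sup>-\<^sup>n) * 4\<^sup>-\<^sup>n / (n+2)\<close>, while \<open>\<integral> (f - F\<^sub>n)\<^sup>2\<close> is of the order
\<open>4\<^sup>-\<^sup>n / (n+1)\<^sup>2\<close>. The result is \<open>\<L>(v) \<ge> \<L>(w) + penalty / 4\<close> (\<open>functional_gap\<close>). This balance dictates the
logarithmic weight and the heights \<open>1/(n+1)\<close>: spikes of fixed height would have tails
that a weight vanishing at \<open>0\<close> cannot pay for in this way.

\<^bold>\<open>Lipschitz perturbations.\<close> If \<open>u\<close> is Lipschitz and not zero, then \<open>\<bar>u\<bar>\<close> is bounded below on an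
interval, in which \<open>v' = f + u'\<close> is as large as \<open>f\<close> up to a constant near some rational point. The
coefficients of \<open>growth\<close> are chosen after \<open>f\<close> such that the penalty diverges there
(\<open>penalty_infinite\<close>).

\<^bold>\<open>The Lavrentiev phenomenon.\<close> Near one node \<open>q\<close>, let \<open>\<rho> m\<close> be radii within which \<open>w\<close> has slope at least
\<open>m\<close>. A Lipschitz \<open>v\<close> cannot follow \<open>w\<close> near \<open>q\<close>, so it deviates by \<open>\<rho> m / 4\<close> within distance \<open>\<rho> m\<close> for
some large \<open>m\<close>. If it deviates that much at the scale \<open>m + 1\<close> but not at the scale \<open>m\<close>, then \<open>v\<close> is
nearly as steep as \<open>w\<close> on a piece on which it stays away from \<open>w\<close>, and the penalty of this piece is at
least \<open>1\<close> by the choice of the coefficients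
(\<open>deviation_spreads\<close>). So either the penalty is at least \<open>1\<close>, or the deviation reaches a fixed
size, and then the penalty is bounded below as well.\<close>

section \<open>Weak derivatives in one dimension\<close>

text \<open>Powers of the positive part are the building block for everything that is to be \<open>C\<^sup>1\<close> with
bounded support here, and for \<open>growth\<close>.\<close>

lemma DERIV_pos_part_power:
  "((\<lambda>x::real. max 0 x ^ Suc (Suc n)) has_real_derivative real (Suc (Suc n)) * max 0 x ^ Suc n) (at x)"
proof -
  consider "x < 0" | "x = 0" | "x > 0" by linarith
  then show ?thesis
  proof cases
    case 1
    have "((\<lambda>x::real. 0) has_real_derivative 0) (at x)" by simp
    then have "((\<lambda>x::real. max 0 x ^ Suc (Suc n)) has_real_derivative 0) (at x)"
      by (rule has_field_derivative_transform_within_open[where S="{..<0}"]) (use 1 in auto)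
    then show ?thesis using 1 by simp
  next
    case 2
    have "((\<lambda>h::real. max 0 h ^ Suc n) \<longlongrightarrow> max 0 0 ^ Suc n) (at 0)"
      by (intro tendsto_intros)
    then have "((\<lambda>h::real. max 0 h ^ Suc n) \<longlongrightarrow> 0) (at 0)" by simp
    then have "((\<lambda>h::real. (max 0 (0+h) ^ Suc (Suc n) - max 0 0 ^ Suc (Suc n)) / h) \<longlongrightarrow> 0) (at 0)"
      by (rule Lim_transform_eventually) (auto simp: eventually_at_filter max_def)
    then show ?thesis using 2 by (simp add: DERIV_def)
  next
    case 3
    have "((\<lambda>x::real. x ^ Suc (Suc n)) has_real_derivative real (Suc (Suc n)) * x ^ Suc n) (at x)"
      using DERIV_pow[of "Suc (Suc n)" x UNIV] by simp
    then have "((\<lambda>x::real. max 0 x ^ Suc (Suc n)) has_real_derivative real (Suc (Suc n)) * x ^ Suc n) (at x)"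
      by (rule has_field_derivative_transform_within_open[where S="{0<..}"]) (use 3 in auto)
    then show ?thesis using 3 by simp
  qed
qed

lemma DERIV_pos_part_square [derivative_intros]:
  assumes "(f has_real_derivative D) (at x)"
  shows "((\<lambda>x. (max 0 (f x))\<^sup>2) has_real_derivative 2 * max 0 (f x) * D) (at x)"
  using DERIV_chain2[OF DERIV_pos_part_power[of 0 "f x"] assms] by (simp add: numeral_2_eq_2)

lemma has_weak_derivativeD:
  assumes weak: "has_weak_derivative T u g"
    and der: "\<And>t. (\<phi> has_real_derivative \<phi>' t) (at t)"
    and cont: "continuous_on UNIV \<phi>'"
    and supp: "\<And>t. t \<notin> {a..b} \<Longrightarrow> \<phi> t = 0" and "0 < a" "b < T"
  shows "(\<integral>t. u t * \<phi>' t \<partial>lebesgue_on {0..T}) = - (\<integral>t. g t * \<phi> t \<partial>lebesgue_on {0..T})"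
proof -
  have "\<phi> C1_differentiable_on UNIV"
    unfolding C1_differentiable_on_def using der cont
    by (auto simp: has_real_derivative_iff_has_vector_derivative)
  moreover have "closure {t. \<phi> t \<noteq> 0} \<subseteq> {a..b}"
    by (rule closure_minimal) (use supp in blast, simp)
  then have "closure {t. \<phi> t \<noteq> 0} \<subseteq> {0<..<T}"
    using assms(5,6) by fastforce
  moreover have "deriv \<phi> = \<phi>'" using der by (auto intro: DERIV_imp_deriv)
  ultimately show ?thesis using weak unfolding has_weak_derivative_def by metis
qed

lemma integral_lebesgue_on_indicator:
  fixes g :: "real \<Rightarrow> real"
  assumes "integrable (lebesgue_on {0..T}) g" "0 \<le> a" "b \<le> T"
  shows "integrable (lebesgue_on {0..T}) (\<lambda>t. indicator {a..b} t * g t)"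
    "(\<integral>t. indicator {a..b} t * g t \<partial>lebesgue_on {0..T}) = integral {a..b} g"
    "g integrable_on {a..b}"
proof -
  show 1: "integrable (lebesgue_on {0..T}) (\<lambda>t. indicator {a..b} t * g t)"
    using integrable_mult_indicator[of "{a..b}" "lebesgue_on {0..T}" g] assms
    by (auto simp: sets_restrict_space_iff)
  have "(\<integral>t. indicator {a..b} t * g t \<partial>lebesgue_on {0..T}) = integral {0..T} (\<lambda>t. indicator {a..b} t * g t)"
    by (rule lebesgue_integral_eq_integral[OF 1]) simp
  also have "\<dots> = integral {0..T} (\<lambda>t. if t \<in> {a..b} then g t else 0)"
    by (rule arg_cong[where f="integral _"]) (auto simp: indicator_def)
  also have "\<dots> = integral {a..b} g"
    by (subst Henstock_Kurzweil_Integration.integral_restrict_Int)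
      (use assms in \<open>auto intro!: arg_cong[where f="\<lambda>S. integral S g"]\<close>)
  finally show "(\<integral>t. indicator {a..b} t * g t \<partial>lebesgue_on {0..T}) = integral {a..b} g" .
  have "g integrable_on {0..T}" by (rule integrable_on_lebesgue_on[OF assms(1)]) simp
  then show "g integrable_on {a..b}" by (rule integrable_on_subinterval) (use assms in auto)
qed

text \<open>A \<open>C\<^sup>1\<close> replacement of the Heaviside function that increases from \<open>0\<close> to \<open>1\<close> on \<open>[0,1]\<close>.
Differences of its translates serve as test functions.\<close>

definition smooth_step :: "real \<Rightarrow> real" where
  "smooth_step x = 1 - (max 0 (1 - (max 0 x)\<^sup>2))\<^sup>2"

definition smooth_step' :: "real \<Rightarrow> real" where
  "smooth_step' x = 4 * max 0 x * max 0 (1 - (max 0 x)\<^sup>2)"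

lemma smooth_step_DERIV:
  assumes "(f has_real_derivative D) (at x)"
  shows "((\<lambda>x. smooth_step (f x)) has_real_derivative smooth_step' (f x) * D) (at x)"
  unfolding smooth_step_def smooth_step'_def
  by (rule derivative_eq_intros assms refl | simp)+

lemma smooth_step_props:
  "x \<le> 0 \<Longrightarrow> smooth_step x = 0" "1 \<le> x \<Longrightarrow> smooth_step x = 1"
  "0 \<le> smooth_step x" "smooth_step x \<le> 1" "0 \<le> smooth_step' x"
  "x \<le> 0 \<Longrightarrow> smooth_step' x = 0" "1 \<le> x \<Longrightarrow> smooth_step' x = 0"
  unfolding smooth_step_def smooth_step'_def
  by (auto simp: max_def power_le_one intro: power2_eq_1_iff[THEN iffD2] dest: power_le_one_iff[THEN iffD1, rotated])

lemma continuous_smooth_step': "continuous_on S smooth_step'"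
  unfolding smooth_step'_def by (intro continuous_intros)

lemma average_against_kernel:
  fixes v \<psi> :: "real \<Rightarrow> real"
  assumes v: "continuous_on {0..T} v" and \<psi>: "continuous_on {0..T} \<psi>" "\<And>t. 0 \<le> \<psi> t"
    and int: "(\<integral>t. \<psi> t \<partial>lebesgue_on {0..T}) = 1"
    and near: "\<And>t. t \<in> {0..T} \<Longrightarrow> \<psi> t \<noteq> 0 \<Longrightarrow> \<bar>v t - y\<bar> \<le> \<delta>"
  shows "\<bar>(\<integral>t. v t * \<psi> t \<partial>lebesgue_on {0..T}) - y\<bar> \<le> \<delta>"
proof -
  let ?M = "lebesgue_on {0..T}"
  have i: "integrable ?M \<psi>" "integrable ?M (\<lambda>t. v t * \<psi> t)" "integrable ?M (\<lambda>t. (v t - y) * \<psi> t)"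
    by (intro continuous_imp_integrable_real continuous_intros v \<psi>)+
  have "(\<integral>t. v t * \<psi> t \<partial>?M) - y = (\<integral>t. v t * \<psi> t \<partial>?M) - (\<integral>t. y * \<psi> t \<partial>?M)"
    using int by simp
  also have "\<dots> = (\<integral>t. (v t - y) * \<psi> t \<partial>?M)"
    using i by (subst Bochner_Integration.integral_diff[symmetric]) (auto simp: algebra_simps)
  finally have eq: "(\<integral>t. v t * \<psi> t \<partial>?M) - y = (\<integral>t. (v t - y) * \<psi> t \<partial>?M)" .
  have "\<bar>\<integral>t. (v t - y) * \<psi> t \<partial>?M\<bar> \<le> (\<integral>t. \<bar>(v t - y) * \<psi> t\<bar> \<partial>?M)"
    by (rule integral_abs_bound)
  also have "\<dots> \<le> (\<integral>t. \<delta> * \<psi> t \<partial>?M)"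
  proof (rule integral_mono)
    fix t assume "t \<in> space ?M"
    then have "t \<in> {0..T}" by simp
    then show "\<bar>(v t - y) * \<psi> t\<bar> \<le> \<delta> * \<psi> t"
      using near[of t] \<psi>(2)[of t] by (cases "\<psi> t = 0") (auto simp: abs_mult intro: mult_right_mono)
  qed (use i in auto)
  finally show ?thesis using eq int by simp
qed

text \<open>The du Bois-Reymond argument. The test functions rise from \<open>0\<close> to \<open>1\<close> in \<open>[a, a+\<epsilon>]\<close> and fall back
to \<open>0\<close> in \<open>[b-\<epsilon>, b]\<close>. As \<open>\<epsilon> \<rightarrow> 0\<close> they tend to the indicator of \<open>(a,b)\<close>, while their derivatives
are averaging kernels that concentrate at \<open>a\<close> and \<open>b\<close>.\<close>

lemma weak_derivative_FTC_inner:
  assumes weak: "has_weak_derivative T v g" and g: "integrable (lebesgue_on {0..T}) g"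
    and v: "continuous_on {0..T} v" and ab: "0 < a" "a < b" "b < T"
  shows "v b - v a = integral {a..b} g"
proof -
  let ?M = "lebesgue_on {0..T}"
  have sM: "{a<..<b} \<in> sets ?M" "{a..b} \<in> sets ?M"
    using ab by (auto simp: sets_restrict_space_iff)
  define \<epsilon> where "\<epsilon> n = (b - a) / real (Suc n)" for n
  have \<epsilon>: "0 < \<epsilon> n" "\<epsilon> n \<le> b - a" for n
  proof -
    show "0 < \<epsilon> n" using ab by (simp add: \<epsilon>_def)
    have "(b - a) / real (Suc n) \<le> (b - a) / 1" using ab by (intro divide_left_mono) auto
    then show "\<epsilon> n \<le> b - a" by (simp only: \<epsilon>_def div_by_1)
  qed
  have \<epsilon>0: "\<epsilon> \<longlonglongrightarrow> 0" unfolding \<epsilon>_def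
    by (intro LIMSEQ_Suc[OF lim_const_over_n])
  define \<Phi>1 where "\<Phi>1 n t = smooth_step ((t - a) / \<epsilon> n)" for n t
  define \<Phi>2 where "\<Phi>2 n t = smooth_step ((t - b) / \<epsilon> n + 1)" for n t
  define \<psi>1 where "\<psi>1 n t = smooth_step' ((t - a) / \<epsilon> n) * (1 / \<epsilon> n)" for n t
  define \<psi>2 where "\<psi>2 n t = smooth_step' ((t - b) / \<epsilon> n + 1) * (1 / \<epsilon> n)" for n t
  have D1: "(\<Phi>1 n has_real_derivative \<psi>1 n t) (at t)" for n t
    unfolding \<Phi>1_def[abs_def] \<psi>1_def using \<epsilon>(1)[of n]
    by (intro smooth_step_DERIV) (auto intro!: derivative_eq_intros)
  have D2: "(\<Phi>2 n has_real_derivative \<psi>2 n t) (at t)" for n t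
    unfolding \<Phi>2_def[abs_def] \<psi>2_def using \<epsilon>(1)[of n]
    by (intro smooth_step_DERIV) (auto intro!: derivative_eq_intros)
  have cont: "continuous_on UNIV (\<psi>1 n)" "continuous_on UNIV (\<psi>2 n)" for n
    unfolding \<psi>1_def[abs_def] \<psi>2_def[abs_def] using \<epsilon>(1)[of n]
    by (auto intro!: continuous_intros continuous_on_compose2[OF continuous_smooth_step'])
  have cont': "continuous_on {0..T} (\<psi>1 n)" "continuous_on {0..T} (\<psi>2 n)" for n
    using cont continuous_on_subset by blast+
  have int: "(\<integral>t. \<Psi>' t \<partial>?M) = \<Psi> T - \<Psi> 0"
    if "\<And>t. (\<Psi> has_real_derivative \<Psi>' t) (at t)" "continuous_on {0..T} \<Psi>'" for \<Psi> \<Psi>' :: "real \<Rightarrow> real"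
  proof -
    have "(\<Psi>' has_integral \<Psi> T - \<Psi> 0) {0..T}"
      by (rule fundamental_theorem_of_calculus)
        (use ab that in \<open>auto simp: has_real_derivative_iff_has_vector_derivative
            intro: has_vector_derivative_at_within\<close>)
    then show ?thesis
      by (subst lebesgue_integral_eq_integral) (auto intro: continuous_imp_integrable_real that)
  qed
  have int1: "(\<integral>t. \<psi>1 n t \<partial>?M) = 1" for n
  proof -
    have "1 \<le> (T - a) / \<epsilon> n" "(0 - a) / \<epsilon> n \<le> 0" using \<epsilon>[of n] ab by (auto simp: field_simps)
    then show ?thesis
      using int[OF D1[of n] cont'(1)[of n]] by (simp add: \<Phi>1_def smooth_step_props)
  qed
  have int2: "(\<integral>t. \<psi>2 n t \<partial>?M) = 1" for n
  proof -
    have "1 \<le> (T - b) / \<epsilon> n + 1" "(0 - b) / \<epsilon> n + 1 \<le> 0" using \<epsilon>[of n] ab by (auto simp: field_simps)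
    then show ?thesis
      using int[OF D2[of n] cont'(2)[of n]] by (simp add: \<Phi>2_def smooth_step_props)
  qed
  have nn: "0 \<le> \<psi>1 n t" "0 \<le> \<psi>2 n t" for n t
    using \<epsilon>(1)[of n] by (auto simp: \<psi>1_def \<psi>2_def smooth_step_props)
  have supp1: "t \<in> {a..a + \<epsilon> n}" if "\<psi>1 n t \<noteq> 0" for n t
  proof (rule ccontr)
    assume "\<not> ?thesis"
    then have "(t - a) / \<epsilon> n \<le> 0 \<or> 1 \<le> (t - a) / \<epsilon> n" using \<epsilon>(1)[of n] by (auto simp: field_simps)
    then show False using that by (auto simp: \<psi>1_def smooth_step_props)
  qed
  have supp2: "t \<in> {b - \<epsilon> n..b}" if "\<psi>2 n t \<noteq> 0" for n t
  proof (rule ccontr)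
    assume "\<not> ?thesis"
    then have "(t - b) / \<epsilon> n + 1 \<le> 0 \<or> 1 \<le> (t - b) / \<epsilon> n + 1" using \<epsilon>(1)[of n] by (auto simp: field_simps)
    then show False using that by (auto simp: \<psi>2_def smooth_step_props)
  qed
  have lim1: "(\<lambda>n. \<integral>t. v t * \<psi> n t \<partial>?M) \<longlonglongrightarrow> v c"
    if c: "c \<in> {0..T}" and "\<And>n. continuous_on {0..T} (\<psi> n)" "\<And>n t. 0 \<le> \<psi> n t"
      and "\<And>n. (\<integral>t. \<psi> n t \<partial>?M) = 1" and supp: "\<And>n t. \<psi> n t \<noteq> 0 \<Longrightarrow> \<bar>t - c\<bar> \<le> \<epsilon> n"
    for c and \<psi> :: "nat \<Rightarrow> real \<Rightarrow> real"
  proof (rule LIMSEQ_I)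
    fix r :: real assume r: "0 < r"
    then obtain d where d: "d > 0" "\<And>t. t \<in> {0..T} \<Longrightarrow> dist t c < d \<Longrightarrow> dist (v t) (v c) < r / 2"
      using v c unfolding continuous_on_iff by (metis half_gt_zero)
    obtain N where N: "\<And>n. n \<ge> N \<Longrightarrow> \<epsilon> n < d"
      using order_tendstoD(2)[OF \<epsilon>0 d(1)] by (auto simp: eventually_sequentially)
    have "norm ((\<integral>t. v t * \<psi> n t \<partial>?M) - v c) < r" if "n \<ge> N" for n
    proof -
      have "\<bar>(\<integral>t. v t * \<psi> n t \<partial>?M) - v c\<bar> \<le> r / 2"
      proof (rule average_against_kernel)
        fix t assume t: "t \<in> {0..T}" "\<psi> n t \<noteq> 0"
        then have "dist t c < d" using supp[of n t] N[OF that] by (simp add: dist_real_def)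
        then show "\<bar>v t - v c\<bar> \<le> r / 2" using d(2)[of t] t by (simp add: dist_real_def)
      qed (use that assms \<open>\<And>n. continuous_on {0..T} (\<psi> n)\<close> \<open>\<And>n t. 0 \<le> \<psi> n t\<close> \<open>\<And>n. (\<integral>t. \<psi> n t \<partial>?M) = 1\<close> in auto)
      then show ?thesis using r by simp
    qed
    then show "\<exists>no. \<forall>n\<ge>no. norm ((\<integral>t. v t * \<psi> n t \<partial>?M) - v c) < r" by blast
  qed
  have "(\<lambda>n. \<integral>t. v t * \<psi>1 n t \<partial>?M) \<longlonglongrightarrow> v a"
    by (rule lim1) (use ab cont' nn int1 in \<open>auto dest!: supp1\<close>)
  moreover have "(\<lambda>n. \<integral>t. v t * \<psi>2 n t \<partial>?M) \<longlonglongrightarrow> v b"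
    by (rule lim1) (use ab cont' nn int2 in \<open>auto dest!: supp2\<close>)
  ultimately have "(\<lambda>n. (\<integral>t. v t * \<psi>1 n t \<partial>?M) - (\<integral>t. v t * \<psi>2 n t \<partial>?M)) \<longlonglongrightarrow> v a - v b"
    by (rule tendsto_diff)
  moreover have "(\<integral>t. v t * \<psi>1 n t \<partial>?M) - (\<integral>t. v t * \<psi>2 n t \<partial>?M)
      = - (\<integral>t. g t * (\<Phi>1 n t - \<Phi>2 n t) \<partial>?M)" for n
  proof -
    have "(\<integral>t. v t * \<psi>1 n t \<partial>?M) - (\<integral>t. v t * \<psi>2 n t \<partial>?M) = (\<integral>t. v t * (\<psi>1 n t - \<psi>2 n t) \<partial>?M)"
      by (subst Bochner_Integration.integral_diff[symmetric])
        (auto intro!: continuous_imp_integrable_real continuous_intros v cont' simp: algebra_simps)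
    also have "\<dots> = - (\<integral>t. g t * (\<Phi>1 n t - \<Phi>2 n t) \<partial>?M)"
    proof (rule has_weak_derivativeD[OF weak])
      show "((\<lambda>t. \<Phi>1 n t - \<Phi>2 n t) has_real_derivative \<psi>1 n t - \<psi>2 n t) (at t)" for t
        by (intro derivative_intros D1 D2)
      show "continuous_on UNIV (\<lambda>t. \<psi>1 n t - \<psi>2 n t)" by (intro continuous_intros cont)
      show "\<Phi>1 n t - \<Phi>2 n t = 0" if tn: "t \<notin> {a..b}" for t
      proof -
        consider "t < a" | "t > b" using tn by fastforce
        then show ?thesis
        proof cases
          case 1
          then have "(t - a) / \<epsilon> n \<le> 0" "(t - b) / \<epsilon> n + 1 \<le> 0" using \<epsilon>[of n] by (auto simp: field_simps)
          then show ?thesis by (simp add: \<Phi>1_def \<Phi>2_def smooth_step_props)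
        next
          case 2
          then have "(t - a) / \<epsilon> n \<ge> 1" "(t - b) / \<epsilon> n + 1 \<ge> 1" using \<epsilon>[of n] by (auto simp: field_simps)
          then show ?thesis by (simp add: \<Phi>1_def \<Phi>2_def smooth_step_props)
        qed
      qed
    qed (use ab in auto)
    finally show ?thesis .
  qed
  ultimately have L1: "(\<lambda>n. - (\<integral>t. g t * (\<Phi>1 n t - \<Phi>2 n t) \<partial>?M)) \<longlonglongrightarrow> v a - v b" by simp
  have "(\<lambda>n. \<integral>t. g t * (\<Phi>1 n t - \<Phi>2 n t) \<partial>?M) \<longlonglongrightarrow> (\<integral>t. g t * indicator {a<..<b} t \<partial>?M)"
  proof (rule integral_dominated_convergence[where w="\<lambda>t. \<bar>g t\<bar>"])
    have [measurable]: "g \<in> borel_measurable ?M" using g by auto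
    show "(\<lambda>t. g t * indicator {a<..<b} t) \<in> borel_measurable ?M"
      by (intro borel_measurable_times borel_measurable_indicator sM) (use g in auto)
    have "continuous_on {0..T} (\<lambda>t. \<Phi>1 n t - \<Phi>2 n t)" for n
      by (intro continuous_intros) (meson D1 D2 DERIV_isCont continuous_at_imp_continuous_on)+
    then have "(\<lambda>t. \<Phi>1 n t - \<Phi>2 n t) \<in> borel_measurable ?M" for n
      using continuous_imp_integrable_real by blast
    then show "(\<lambda>t. g t * (\<Phi>1 n t - \<Phi>2 n t)) \<in> borel_measurable ?M" for n
      by (intro borel_measurable_times) auto
    show "integrable ?M (\<lambda>t. \<bar>g t\<bar>)" using g by simp
    show "AE t in ?M. norm (g t * (\<Phi>1 n t - \<Phi>2 n t)) \<le> \<bar>g t\<bar>" for n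
    proof (intro AE_I2)
      fix t
      have "\<bar>\<Phi>1 n t - \<Phi>2 n t\<bar> \<le> 1"
        using smooth_step_props(3,4)[of "(t - a) / \<epsilon> n"] smooth_step_props(3,4)[of "(t - b) / \<epsilon> n + 1"]
        unfolding \<Phi>1_def \<Phi>2_def by (simp add: abs_le_iff)
      then show "norm (g t * (\<Phi>1 n t - \<Phi>2 n t)) \<le> \<bar>g t\<bar>"
        by (simp add: abs_mult mult_left_le)
    qed
    show "AE t in ?M. (\<lambda>n. g t * (\<Phi>1 n t - \<Phi>2 n t)) \<longlonglongrightarrow> g t * indicator {a<..<b} t"
    proof (intro AE_I2)
      fix t
      show "(\<lambda>n. g t * (\<Phi>1 n t - \<Phi>2 n t)) \<longlonglongrightarrow> g t * indicator {a<..<b} t"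
      proof (cases "t \<in> {a<..<b}")
        case True
        then have "\<forall>\<^sub>F n in sequentially. \<epsilon> n < t - a" "\<forall>\<^sub>F n in sequentially. \<epsilon> n < b - t"
          using \<epsilon>0 by (auto intro: order_tendstoD)
        then have "\<forall>\<^sub>F n in sequentially. g t * (\<Phi>1 n t - \<Phi>2 n t) = g t * indicator {a<..<b} t"
        proof eventually_elim
          case (elim n)
          then have "(t - a) / \<epsilon> n \<ge> 1" "(t - b) / \<epsilon> n + 1 \<le> 0" using \<epsilon>(1)[of n] by (auto simp: field_simps)
          then show ?case using True by (simp add: \<Phi>1_def \<Phi>2_def smooth_step_props)
        qed
        then show ?thesis by (rule tendsto_eventually)
      next
        case False
        then consider "t \<le> a" | "t \<ge> b" by (cases "t \<le> a") auto
        then have "\<Phi>1 n t - \<Phi>2 n t = 0" for n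
        proof cases
          case 1
          then have "(t - a) / \<epsilon> n \<le> 0" "(t - b) / \<epsilon> n + 1 \<le> 0" using \<epsilon>[of n] by (auto simp: field_simps)
          then show ?thesis by (simp add: \<Phi>1_def \<Phi>2_def smooth_step_props)
        next
          case 2
          then have "(t - a) / \<epsilon> n \<ge> 1" "(t - b) / \<epsilon> n + 1 \<ge> 1" using \<epsilon>[of n] by (auto simp: field_simps)
          then show ?thesis by (simp add: \<Phi>1_def \<Phi>2_def smooth_step_props)
        qed
        then show ?thesis using False by simp
      qed
    qed
  qed
  from tendsto_minus[OF this] have "v a - v b = - (\<integral>t. g t * indicator {a<..<b} t \<partial>?M)"
    using L1 LIMSEQ_unique by blast
  also have "(\<integral>t. g t * indicator {a<..<b} t \<partial>?M) = (\<integral>t. indicator {a..b} t * g t \<partial>?M)"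
  proof (rule integral_cong_AE)
    have [measurable]: "g \<in> borel_measurable ?M" using g by auto
    show "(\<lambda>t. g t * indicator {a<..<b} t) \<in> borel_measurable ?M"
      by (intro borel_measurable_times borel_measurable_indicator sM) (use g in auto)
    show "(\<lambda>t. indicator {a..b} t * g t) \<in> borel_measurable ?M"
      by (intro borel_measurable_times borel_measurable_indicator sM) (use g in auto)
    have "{a, b} \<in> null_sets lebesgue" by (simp add: negligible_iff_null_sets[symmetric])
    then have "AE t in lebesgue. t \<notin> {a, b}" by (rule AE_not_in)
    then have "AE t in ?M. t \<notin> {a, b}" by (subst AE_restrict_space_iff) auto
    then show "AE t in ?M. g t * indicator {a<..<b} t = indicator {a..b} t * g t"
      by eventually_elim (auto simp: indicator_def)
  qed
  also have "\<dots> = integral {a..b} g" using integral_lebesgue_on_indicator(2)[OF g] ab by simp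
  finally show ?thesis by simp
qed

text \<open>Both sides are continuous in \<open>a\<close> and \<open>b\<close>, so the formula extends to the end points.\<close>

lemma weak_derivative_FTC:
  assumes weak: "has_weak_derivative T v g" and g: "integrable (lebesgue_on {0..T}) g"
    and v: "continuous_on {0..T} v" and ab: "0 \<le> a" "a \<le> b" "b \<le> T"
  shows "v b - v a = integral {a..b} g"
proof (cases "a < b")
  case True
  have gi: "g integrable_on {a..b}" using integral_lebesgue_on_indicator(3)[OF g] ab by blast
  have vc: "continuous_on {a..b} v" using v ab by (auto intro: continuous_on_subset)
  define m where "m = (a + b) / 2"
  define R where "R x = v x - v m - integral {m..x} g" for x
  define Q where "Q x = v m - v x - integral {x..m} g" for x
  have m: "a < m" "m < b" "0 < m" "m < T" using True ab by (auto simp: m_def)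
  have gm: "g integrable_on {m..b}" "g integrable_on {a..m}"
    using gi m by (auto elim!: integrable_on_subinterval)
  have "continuous_on {m..b} R" unfolding R_def
    by (intro continuous_intros indefinite_integral_continuous_1 gm continuous_on_subset[OF vc]) (use m in auto)
  moreover have "R x = 0" if "x \<in> {m<..<b}" for x
    unfolding R_def using weak_derivative_FTC_inner[OF weak g v, of m x] that m ab by auto
  moreover have "closure {m<..<b} = {m..b}" using m by simp
  ultimately have "R b = 0"
    using continuous_constant_on_closure[of "{m<..<b}" R 0 b] m by auto
  moreover have "continuous_on {a..m} Q" unfolding Q_def
    by (intro continuous_intros indefinite_integral_continuous_1' gm continuous_on_subset[OF vc]) (use m in auto)
  moreover have "Q x = 0" if "x \<in> {a<..<m}" for x
    unfolding Q_def using weak_derivative_FTC_inner[OF weak g v, of x m] that m ab by auto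
  moreover have "closure {a<..<m} = {a..m}" using m by simp
  ultimately have "Q a = 0"
    using continuous_constant_on_closure[of "{a<..<m}" Q 0 a] m by auto
  then show ?thesis using \<open>R b = 0\<close>
      Henstock_Kurzweil_Integration.integral_combine[of a m b g] gi m
    unfolding R_def Q_def by auto
qed (use ab in auto)

text \<open>A single interval is a division of itself.\<close>

lemma continuous_on_of_abs_continuous:
  assumes "abs_continuous_on {a..b} u"
  shows "continuous_on {a..b} u"
  unfolding continuous_on_iff
proof (intro ballI allI impI)
  fix x \<epsilon> :: real assume x: "x \<in> {a..b}" and "0 < \<epsilon>"
  then obtain \<delta> where \<delta>: "0 < \<delta>" "\<forall>\<D> S. \<D> division_of S \<and> S \<subseteq> {a..b} \<and> (\<Sum>K\<in>\<D>. Sup K - Inf K) < \<delta> \<longrightarrow>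
        (\<Sum>K\<in>\<D>. \<bar>u (Sup K) - u (Inf K)\<bar>) < \<epsilon>"
    using assms[unfolded abs_continuous_on_def, rule_format, OF \<open>0 < \<epsilon>\<close>] by (elim exE conjE)
  have pq: "\<bar>u q - u p\<bar> < \<epsilon>" if "p \<in> {a..b}" "q \<in> {a..b}" "p \<le> q" "q - p < \<delta>" for p q
  proof -
    have "{{p..q}} division_of {p..q}" using division_of_self[of p q] that by simp
    then show ?thesis using \<delta>(2)[rule_format, of "{{p..q}}" "{p..q}"] that by simp
  qed
  then have "dist (u y) (u x) < \<epsilon>" if "y \<in> {a..b}" "dist y x < \<delta>" for y
    using x that pq[of x y] pq[of y x] by (cases "x \<le> y") (auto simp: dist_real_def abs_less_iff)
  then show "\<exists>d>0. \<forall>x'\<in>{a..b}. dist x' x < d \<longrightarrow> dist (u x') (u x) < \<epsilon>" using \<delta>(1) by blast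
qed

text \<open>By Lebesgue's differentiation theorem, an integrable function is almost everywhere the limit of
its averages over short intervals.\<close>

lemma AE_eq_of_interval_integrals:
  fixes g1 g2 :: "real \<Rightarrow> real"
  assumes g: "integrable (lebesgue_on {0..T}) g1" "integrable (lebesgue_on {0..T}) g2"
    and eq: "\<And>a b. 0 \<le> a \<Longrightarrow> a \<le> b \<Longrightarrow> b \<le> T \<Longrightarrow> integral {a..b} g1 = integral {a..b} g2"
  shows "AE t in lebesgue_on {0..T}. g1 t = g2 t"
proof -
  define k where "k t = (if t \<in> {0..T} then g1 t - g2 t else 0)" for t
  have k: "(k has_integral 0) {a..b}" for a b
  proof -
    define a' b' where "a' = max a 0" and "b' = min b T"
    have a'b': "0 \<le> a'" "b' \<le> T" by (auto simp: a'_def b'_def)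
    have "g1 integrable_on {a'..b'}" "g2 integrable_on {a'..b'}"
      by (rule integral_lebesgue_on_indicator(3)[OF g(1) a'b'] integral_lebesgue_on_indicator(3)[OF g(2) a'b'])+
    then have "((\<lambda>t. g1 t - g2 t) has_integral integral {a'..b'} g1 - integral {a'..b'} g2) {a'..b'}"
      by (intro has_integral_diff integrable_integral)
    moreover have "integral {a'..b'} g1 = integral {a'..b'} g2"
      using eq[of a' b'] a'b' by (cases "a' \<le> b'") auto
    moreover have "{a'..b'} = {0..T} \<inter> {a..b}" by (auto simp: a'_def b'_def)
    ultimately have "((\<lambda>t. g1 t - g2 t) has_integral 0) ({0..T} \<inter> {a..b})" by simp
    then show ?thesis unfolding k_def by (subst has_integral_restrict_Int)
  qed
  obtain N where N: "negligible N" "\<And>x e. \<lbrakk>x \<notin> N; 0 < e\<rbrakk> \<Longrightarrow>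
     \<exists>d>0. \<forall>h. 0 < h \<and> h < d \<longrightarrow> norm (integral (cbox x (x + h *\<^sub>R One)) k /\<^sub>R h ^ DIM(real) - k x) < e"
    using integrable_ccontinuous_explicit[of k] k by (metis cbox_interval has_integral_integrable)
  have kz: "k x = 0" if xN: "x \<notin> N" for x
  proof (rule ccontr)
    assume "k x \<noteq> 0"
    then obtain d where "d > 0" "\<forall>h. 0 < h \<and> h < d \<longrightarrow>
        norm (integral (cbox x (x + h *\<^sub>R One)) k /\<^sub>R h ^ DIM(real) - k x) < \<bar>k x\<bar>"
      using N(2)[OF xN, of "\<bar>k x\<bar>"] by auto
    then have "norm (integral {x..x + d/2} k /\<^sub>R (d/2) - k x) < \<bar>k x\<bar>"
      by (auto dest!: spec[of _ "d/2"])
    then show False using integral_unique[OF k] by simp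
  qed
  have "AE t in lebesgue. t \<notin> N"
    using N(1) by (intro AE_not_in) (simp add: negligible_iff_null_sets)
  then have "AE t in lebesgue_on {0..T}. t \<notin> N"
    by (subst AE_restrict_space_iff) auto
  moreover have "AE t in lebesgue_on {0..T}. t \<in> {0..T}"
    by (intro AE_I2) simp
  ultimately show ?thesis
  proof eventually_elim
    case (elim t)
    then show ?case using kz[of t] by (simp add: k_def)
  qed
qed

text \<open>The converse of the du Bois-Reymond lemma, by Fubini: the double integral of
\<open>g(s) \<phi>'(t)\<close> over the triangle \<open>s \<le> t\<close> is evaluated in both orders.\<close>

lemma has_weak_derivative_of_FTC:
  assumes g[measurable]: "g \<in> borel_measurable borel" and gi: "set_integrable lborel {0..T} g"
    and T: "0 < T" and v: "\<And>t. t \<in> {0..T} \<Longrightarrow> v t = v 0 + (LBINT s:{0..t}. g s)"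
  shows "has_weak_derivative T v g"
  unfolding has_weak_derivative_def
proof (intro allI impI, elim conjE)
  fix \<phi> :: "real \<Rightarrow> real"
  assume C1: "\<phi> C1_differentiable_on UNIV" and supp: "closure {t. \<phi> t \<noteq> 0} \<subseteq> {0<..<T}"
  then obtain D where D: "\<And>t. (\<phi> has_vector_derivative D t) (at t)" and Dc: "continuous_on UNIV D"
    unfolding C1_differentiable_on_def by auto
  have [measurable]: "D \<in> borel_measurable borel" using Dc by (rule borel_measurable_continuous_onI)
  have \<phi>c: "continuous_on UNIV \<phi>"
    using D by (meson continuous_at_imp_continuous_on has_vector_derivative_continuous)
  have [measurable]: "\<phi> \<in> borel_measurable borel" using \<phi>c by (rule borel_measurable_continuous_onI)
  have deriv: "deriv \<phi> = D"
    using D by (auto simp: has_real_derivative_iff_has_vector_derivative[symmetric] intro: DERIV_imp_deriv)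
  have "0 \<notin> closure {t. \<phi> t \<noteq> 0}" "T \<notin> closure {t. \<phi> t \<noteq> 0}" using supp by auto
  then have \<phi>0: "\<phi> 0 = 0" "\<phi> T = 0" using closure_subset[of "{t. \<phi> t \<noteq> 0}"] by auto
  have FTC: "(LBINT t:{s..T}. D t) = - \<phi> s" if "s \<in> {0..T}" for s
  proof -
    have "(LBINT t:{s..T}. D t) = \<phi> T - \<phi> s"
      unfolding set_lebesgue_integral_def
      by (rule integral_FTC_atLeastAtMost)
        (use that D Dc in \<open>auto intro: has_vector_derivative_at_within continuous_on_subset\<close>)
    then show ?thesis using \<phi>0 by simp
  qed
  have Dint: "set_integrable lborel {0..T} D"
    using Dc by (intro borel_integrable_atLeastAtMost') (auto intro: continuous_on_subset)
  define F where "F s t = (indicator {0..T} s * g s) * (indicator {0..T} t * D t) * (if s \<le> t then 1 else 0)" for s t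
  have Gi: "integrable lborel (\<lambda>s. indicator {0..T} s * g s)"
    and Di: "integrable lborel (\<lambda>t. indicator {0..T} t * D t)"
    using gi Dint by (auto simp: set_integrable_def)
  have Fm[measurable]: "case_prod F \<in> borel_measurable (lborel \<Otimes>\<^sub>M lborel)"
    unfolding F_def by measurable
  have Fi: "integrable (lborel \<Otimes>\<^sub>M lborel) (case_prod F)"
  proof (rule Bochner_Integration.integrable_bound)
    show "integrable (lborel \<Otimes>\<^sub>M lborel) (\<lambda>(s, t). (indicator {0..T} s * g s) * (indicator {0..T} t * D t))"
    proof (rule lborel_pair.Fubini_integrable)
      show "(\<lambda>(s, t). (indicator {0..T} s * g s) * (indicator {0..T} t * D t)) \<in> borel_measurable (lborel \<Otimes>\<^sub>M lborel)"
        by measurable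
      show "AE s in lborel. integrable lborel (\<lambda>t. case (s, t) of (s, t) \<Rightarrow> indicator {0..T} s * g s * (indicator {0..T} t * D t))"
        using Di by simp
      have "(\<lambda>s. LINT t|lborel. norm (case (s, t) of (s, t) \<Rightarrow> indicator {0..T} s * g s * (indicator {0..T} t * D t)))
        = (\<lambda>s. norm (indicator {0..T} s * g s) * (LINT t|lborel. norm (indicator {0..T} t * D t)))"
        by (simp only: prod.case norm_mult Bochner_Integration.integral_mult_right_zero)
      then show "integrable lborel (\<lambda>s. LINT t|lborel. norm (case (s, t) of (s, t) \<Rightarrow> indicator {0..T} s * g s * (indicator {0..T} t * D t)))"
        using Gi by (simp only: Bochner_Integration.integrable_mult_left integrable_norm)
    qed
    show "AE x in lborel \<Otimes>\<^sub>M lborel. norm (case_prod F x)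
      \<le> norm (case x of (s, t) \<Rightarrow> (indicator {0..T} s * g s) * (indicator {0..T} t * D t))"
      by (intro AE_I2) (auto simp: F_def)
  qed (rule Fm)
  have inner1: "(LBINT s. F s t) = indicator {0..T} t * ((v t - v 0) * D t)" for t
  proof (cases "t \<in> {0..T}")
    case True
    have "F s t = D t * (indicator {0..t} s * g s)" for s
      using True by (auto simp: F_def indicator_def)
    then have "(LBINT s. F s t) = D t * (LBINT s:{0..t}. g s)"
      by (simp add: set_lebesgue_integral_def)
    then show ?thesis using v[OF True] True by simp
  qed (simp add: F_def)
  have inner2: "(LBINT t. F s t) = - (indicator {0..T} s * (g s * \<phi> s))" for s
  proof (cases "s \<in> {0..T}")
    case True
    have "F s t = g s * (indicator {s..T} t * D t)" for t
      using True by (auto simp: F_def indicator_def)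
    then have "(LBINT t. F s t) = g s * (LBINT t:{s..T}. D t)"
      by (simp add: set_lebesgue_integral_def)
    then show ?thesis using FTC[OF True] True by simp
  qed (simp add: F_def)
  have swap: "(LBINT t. indicator {0..T} t * ((v t - v 0) * D t)) = - (LBINT s. indicator {0..T} s * (g s * \<phi> s))"
    using lborel_pair.Fubini_integral[OF Fi] unfolding inner1 inner2 by simp
  have i1: "integrable lborel (\<lambda>t. indicator {0..T} t * ((v t - v 0) * D t))"
    using lborel_pair.integrable_snd[OF Fi] unfolding inner1 .
  let ?M = "lebesgue_on {0..T}"
  have conv: "(\<integral>t. k t \<partial>?M) = (LBINT t. indicator {0..T} t * k t)"
    if "(\<lambda>t. indicator {0..T} t * k t) \<in> borel_measurable lborel" for k :: "real \<Rightarrow> real"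
    using that by (subst integral_restrict_space) (auto simp: integral_completion)
  have "(\<integral>t. v t * deriv \<phi> t \<partial>?M) = (LBINT t. indicator {0..T} t * (v t * D t))"
  proof (subst deriv, rule conv)
    have "(\<lambda>t. indicator {0..T} t * (v t * D t))
      = (\<lambda>t. indicator {0..T} t * ((v t - v 0) * D t) + v 0 * (indicator {0..T} t * D t))"
      by (auto simp: algebra_simps)
    then show "(\<lambda>t. indicator {0..T} t * (v t * D t)) \<in> borel_measurable lborel"
      using Bochner_Integration.integrable_add[OF i1 integrable_mult_right[OF Di, of "v 0"]]
      by (simp only: borel_measurable_integrable)
  qed
  also have "\<dots> = (LBINT t. indicator {0..T} t * ((v t - v 0) * D t) + v 0 * (indicator {0..T} t * D t))"
    by (rule arg_cong[where f="integral\<^sup>L lborel"]) (auto simp: algebra_simps)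
  also have "\<dots> = (LBINT t. indicator {0..T} t * ((v t - v 0) * D t)) + v 0 * (LBINT t. indicator {0..T} t * D t)"
    using i1 Di by (subst Bochner_Integration.integral_add) auto
  also have "(LBINT t. indicator {0..T} t * D t) = 0"
    using FTC[of 0] T \<phi>0 by (simp add: set_lebesgue_integral_def)
  also have "(LBINT t. indicator {0..T} t * ((v t - v 0) * D t)) = - (\<integral>t. g t * \<phi> t \<partial>?M)"
    unfolding swap by (subst conv) auto
  finally show "(\<integral>t. v t * deriv \<phi> t \<partial>?M) = - (\<integral>t. g t * \<phi> t \<partial>?M)" by simp
qed


text \<open>For a constant \<open>c\<close> above
the Lipschitz constant, \<open>c t + u(t)\<close> and \<open>c t - u(t)\<close> are both nondecreasing. Their Stieltjes
measures add up to \<open>2 c\<close> times Lebesgue measure, so each of them is absolutely continuous, and the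
Radon-Nikodym theorem provides the density.\<close>

lemma lipschitz_has_density:
  fixes u :: "real \<Rightarrow> real"
  assumes lip: "C-lipschitz_on {0..T} u" and T: "0 < T"
  obtains g where "g \<in> borel_measurable borel" "set_integrable lborel {0..T} g"
    "\<And>t. t \<in> {0..T} \<Longrightarrow> u t = u 0 + (LBINT s:{0..t}. g s)"
proof -
  define c where "c = C + 1"
  have "0 \<le> C" using lip by (rule lipschitz_on_nonneg)
  then have c: "0 < c" by (simp add: c_def)
  define U where "U t = u (max 0 (min T t))" for t
  have U: "\<bar>U x - U y\<bar> \<le> c * \<bar>x - y\<bar>" for x y
  proof -
    have "\<bar>U x - U y\<bar> \<le> C * \<bar>max 0 (min T x) - max 0 (min T y)\<bar>"
      using lipschitz_onD[OF lip, of "max 0 (min T x)" "max 0 (min T y)"] T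
      by (simp add: U_def dist_real_def)
    also have "\<dots> \<le> c * \<bar>x - y\<bar>" using \<open>0 \<le> C\<close> by (intro mult_mono) (auto simp: c_def)
    finally show ?thesis .
  qed
  have Uc: "continuous_on UNIV U"
  proof -
    have "c-lipschitz_on UNIV U" using U c by (intro lipschitz_onI) (auto simp: dist_real_def)
    then show ?thesis by (rule lipschitz_on_continuous_on)
  qed
  define F1 where "F1 t = c * t + U t" for t
  define F2 where "F2 t = c * t - U t" for t
  have mono: "F1 x \<le> F1 y" "F2 x \<le> F2 y" if "x \<le> y" for x y
    using U[of x y] that by (auto simp: F1_def F2_def abs_le_iff algebra_simps)
  have cont: "continuous_on UNIV F1" "continuous_on UNIV F2"
    unfolding F1_def[abs_def] F2_def[abs_def] by (intro continuous_intros Uc)+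
  define N1 where "N1 = interval_measure F1"
  define N2 where "N2 = interval_measure F2"
  have Icc: "emeasure N1 {a..b} = ennreal (F1 b - F1 a)" "emeasure N2 {a..b} = ennreal (F2 b - F2 a)"
    if "a \<le> b" for a b
    unfolding N1_def N2_def using that mono cont by (auto intro!: emeasure_interval_measure_Icc)
  have [simp]: "sets N1 = sets borel" "sets N2 = sets borel" by (auto simp: N1_def N2_def)
  have Ioo: "emeasure N1 {a<..<b} = ennreal (F1 b - F1 a)" "emeasure N2 {a<..<b} = ennreal (F2 b - F2 a)"
    if "a \<le> b" for a b
  proof -
    have e: "{a<..<b} = {a..b} - ({a} \<union> {b})" by auto
    have n: "{x} \<in> null_sets N1" "{x} \<in> null_sets N2" for x
      using Icc[of x x] by (intro null_setsI; simp)+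
    have nn: "{a} \<union> {b} \<in> null_sets N1" "{a} \<union> {b} \<in> null_sets N2"
      by (rule null_sets.Un[OF n(1) n(1)], rule null_sets.Un[OF n(2) n(2)])
    have "emeasure N1 ({a..b} - ({a} \<union> {b})) = emeasure N1 {a..b}"
      "emeasure N2 ({a..b} - ({a} \<union> {b})) = emeasure N2 {a..b}"
      by (rule emeasure_Diff_null_set[OF nn(1)], simp, rule emeasure_Diff_null_set[OF nn(2)], simp)
    then show "emeasure N1 {a<..<b} = ennreal (F1 b - F1 a)" "emeasure N2 {a<..<b} = ennreal (F2 b - F2 a)"
      using e Icc[OF that] by metis+
  qed
  \<comment> \<open>the sum of the two Stieltjes measures, which is \<open>2 c\<close> times Lebesgue measure\<close>
  define K where "K = measure_of UNIV (sets borel) (\<lambda>A. emeasure N1 A + emeasure N2 A)"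
  have [simp]: "sets K = sets borel" unfolding K_def
    by (metis sets.sigma_sets_eq sets_measure_of space_borel subset_UNIV Pow_UNIV)
  have K: "emeasure K A = emeasure N1 A + emeasure N2 A" if "A \<in> sets borel" for A
    unfolding K_def
  proof (rule emeasure_measure_of_sigma)
    show "sigma_algebra UNIV (sets (borel :: real measure))"
      using sets.sigma_algebra_axioms[of "borel :: real measure"] by simp
    show "positive (sets borel) (\<lambda>A. emeasure N1 A + emeasure N2 A)" by (simp add: positive_def)
    show "countably_additive (sets borel) (\<lambda>A. emeasure N1 A + emeasure N2 A)"
    proof (rule countably_additiveI)
      fix A :: "nat \<Rightarrow> real set" assume A: "range A \<subseteq> sets borel" "disjoint_family A"
      have "(\<Sum>i. emeasure N1 (A i) + emeasure N2 (A i)) = (\<Sum>i. emeasure N1 (A i)) + (\<Sum>i. emeasure N2 (A i))"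
        by (intro suminf_add[symmetric] summableI)
      also have "\<dots> = emeasure N1 (\<Union>(range A)) + emeasure N2 (\<Union>(range A))"
        using A by (intro arg_cong2[where f="(+)"] suminf_emeasure) simp_all
      finally show "(\<Sum>i. emeasure N1 (A i) + emeasure N2 (A i)) = emeasure N1 (\<Union>(range A)) + emeasure N2 (\<Union>(range A))" .
    qed
  qed (use that in auto)
  have lb: "lborel = scale_measure (ennreal (1 / (2 * c))) K"
  proof (rule lborel_eqI)
    fix l u :: real assume "\<And>b. b \<in> Basis \<Longrightarrow> l \<bullet> b \<le> u \<bullet> b"
    then have "l \<le> u" by simp
    then have "emeasure K {l<..<u} = ennreal ((F1 u - F1 l) + (F2 u - F2 l))"
      using mono[of l u] by (simp add: K Ioo)
    also have "(F1 u - F1 l) + (F2 u - F2 l) = 2 * c * (u - l)"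
      by (simp add: F1_def F2_def algebra_simps)
    finally have "emeasure (scale_measure (ennreal (1 / (2 * c))) K) {l<..<u}
        = ennreal (1 / (2 * c) * (2 * c * (u - l)))"
      using c \<open>l \<le> u\<close> by (simp add: ennreal_mult[symmetric])
    then show "emeasure (scale_measure (ennreal (1 / (2 * c))) K) (box l u)
        = ennreal (\<Prod>b\<in>Basis. (u - l) \<bullet> b)" using c by simp
  qed simp
  have ac: "absolutely_continuous lborel N1"
    unfolding absolutely_continuous_def
  proof
    fix A :: "real set" assume A: "A \<in> null_sets lborel"
    then have "A \<in> sets borel" "emeasure lborel A = 0"
      using null_setsD1[OF A] null_setsD2[OF A] by simp_all
    then have "emeasure (scale_measure (ennreal (1 / (2 * c))) K) A = 0"
      by (simp only: lb[symmetric])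
    then have "emeasure K A = 0" using c by simp
    then show "A \<in> null_sets N1" using K[OF \<open>A \<in> sets borel\<close>] \<open>A \<in> sets borel\<close>
      by (intro null_setsI) simp_all
  qed
  define D where "D = RN_deriv lborel N1"
  have Dm[measurable]: "D \<in> borel_measurable borel" unfolding D_def by simp
  have N1_eq: "density lborel D = N1"
    unfolding D_def by (rule sigma_finite_measure.density_RN_deriv[OF sigma_finite_lborel ac]) simp
  have DIcc: "(\<integral>\<^sup>+x. D x * indicator {a..b} x \<partial>lborel) = ennreal (F1 b - F1 a)" if "a \<le> b" for a b
    using Icc(1)[OF that] unfolding N1_eq[symmetric] by (subst (asm) emeasure_density) auto
  have fin: "AE x in lborel. D x * indicator {0..T} x \<noteq> \<infinity>"
    using T by (intro nn_integral_PInf_AE) (auto simp: DIcc)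
  have hb: "has_bochner_integral lborel (\<lambda>x. indicator {0..t} x *\<^sub>R enn2real (D x)) (F1 t - F1 0)"
    if "t \<in> {0..T}" for t
  proof (rule has_bochner_integral_nn_integral)
    have "(\<integral>\<^sup>+x. ennreal (indicator {0..t} x *\<^sub>R enn2real (D x)) \<partial>lborel) = (\<integral>\<^sup>+x. D x * indicator {0..t} x \<partial>lborel)"
      by (rule nn_integral_cong_AE, use fin in eventually_elim)
        (use that in \<open>auto simp: indicator_def top.not_eq_extremum split: if_splits\<close>)
    then show "(\<integral>\<^sup>+x. ennreal (indicator {0..t} x *\<^sub>R enn2real (D x)) \<partial>lborel) = ennreal (F1 t - F1 0)"
      using that by (simp add: DIcc)
  qed (use that mono[of 0 t] in auto)
  show thesis
  proof (rule that[of "\<lambda>x. enn2real (D x) - c"])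
    have i: "set_integrable lborel {0..t} (\<lambda>x. enn2real (D x))" if "t \<in> {0..T}" for t
      unfolding set_integrable_def using hb[OF that] by (rule integrable.intros)
    have ic: "set_integrable lborel {0..t} (\<lambda>x. c)" for t :: real
      by (intro borel_integrable_atLeastAtMost') auto
    show "set_integrable lborel {0..T} (\<lambda>x. enn2real (D x) - c)"
      by (rule set_integral_diff(1)[OF i ic]) (use T in auto)
    show "u t = u 0 + (LBINT s:{0..t}. enn2real (D s) - c)" if t: "t \<in> {0..T}" for t
    proof -
      have "(LBINT s:{0..t}. enn2real (D s) - c) = (LBINT s:{0..t}. enn2real (D s)) - (LBINT s:{0..t}. c)"
        by (rule set_integral_diff(2)[OF i[OF t] ic])
      also have "(LBINT s:{0..t}. enn2real (D s)) = F1 t - F1 0"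
        unfolding set_lebesgue_integral_def using hb[OF t] by (rule has_bochner_integral_integral_eq)
      also have "(LBINT s:{0..t}. c) = c * t"
        using t by (simp add: set_lebesgue_integral_def)
      finally show ?thesis using t T by (simp add: F1_def U_def)
    qed
  qed simp
qed

lemma Lebesgue_space_1_integrable: "g \<in> Lebesgue_space T 1 \<Longrightarrow> integrable (lebesgue_on {0..T}) g"
  unfolding Lebesgue_space_def by (auto intro: integrable_abs_cancel)

text \<open>\<open>weak_deriv\<close> is a choice, which is only meaningful once some weak derivative is known to exist.\<close>

lemma weak_derivI:
  assumes "g \<in> Lebesgue_space T 1" "has_weak_derivative T u g"
  shows "integrable (lebesgue_on {0..T}) (weak_deriv T u)" "has_weak_derivative T u (weak_deriv T u)"
proof -
  have "weak_deriv T u \<in> Lebesgue_space T 1 \<and> has_weak_derivative T u (weak_deriv T u)"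
    unfolding weak_deriv_def by (rule someI[of _ g]) (use assms in simp)
  then show "integrable (lebesgue_on {0..T}) (weak_deriv T u)" "has_weak_derivative T u (weak_deriv T u)"
    using Lebesgue_space_1_integrable by auto
qed

section \<open>Series of nonnegative terms\<close>

lemma suminf_le_geometric:
  fixes f :: "nat \<Rightarrow> real"
  assumes "\<And>k. 0 \<le> f k" "\<And>k. f k \<le> c * r ^ k" "0 \<le> r" "r < 1"
  shows "(\<Sum>k. ennreal (f k)) \<le> ennreal (c / (1 - r))"
proof -
  have "0 \<le> c" using assms(1)[of 0] assms(2)[of 0] by simp
  have "(\<Sum>k. ennreal (f k)) \<le> (\<Sum>k. ennreal (c * r ^ k))"
    using assms(2) by (intro suminf_le ennreal_leI summableI) auto
  also have "\<dots> = ennreal (c * (1 / (1 - r)))"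
    using assms(3,4) \<open>0 \<le> c\<close> by (intro suminf_ennreal_eq sums_mult geometric_sums) auto
  finally show ?thesis by simp
qed

text \<open>A Cauchy-Schwarz inequality with geometric weights; it turns the sum of the spikes into a sum of
squares, which can be integrated term by term.\<close>

lemma square_sum_le_weighted:
  fixes a :: "nat \<Rightarrow> real"
  shows "(\<Sum>k<N. a k)\<^sup>2 \<le> (\<Sum>k<N. 2 ^ Suc k * (a k)\<^sup>2)"
proof (induction N arbitrary: a)
  case (Suc N)
  have "(\<Sum>k<Suc N. a k)\<^sup>2 = (a 0 + (\<Sum>k<N. a (Suc k)))\<^sup>2" by (simp only: sum.lessThan_Suc_shift)
  also have "\<dots> \<le> 2 * (a 0)\<^sup>2 + 2 * (\<Sum>k<N. a (Suc k))\<^sup>2"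
    using zero_le_power2[of "a 0 - (\<Sum>k<N. a (Suc k))"] by (simp add: power2_eq_square algebra_simps)
  also have "\<dots> \<le> 2 * (a 0)\<^sup>2 + 2 * (\<Sum>k<N. 2 ^ Suc k * (a (Suc k))\<^sup>2)"
    using Suc.IH[of "\<lambda>k. a (Suc k)"] by simp
  also have "\<dots> = (\<Sum>k<Suc N. 2 ^ Suc k * (a k)\<^sup>2)"
    by (subst sum.lessThan_Suc_shift) (simp add: sum_distrib_left mult.assoc)
  finally show ?case .
qed simp

lemma square_suminf_le_weighted:
  fixes a :: "nat \<Rightarrow> real"
  assumes "summable a"
  shows "ennreal ((\<Sum>k. a k)\<^sup>2) \<le> (\<Sum>k. ennreal (2 ^ Suc k * (a k)\<^sup>2))"
proof (rule LIMSEQ_le_const2)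
  show "(\<lambda>N. ennreal ((\<Sum>k<N. a k)\<^sup>2)) \<longlonglongrightarrow> ennreal ((\<Sum>k. a k)\<^sup>2)"
    by (intro tendsto_intros tendsto_ennrealI summable_LIMSEQ assms)
  have "ennreal ((\<Sum>k<N. a k)\<^sup>2) \<le> (\<Sum>k. ennreal (2 ^ Suc k * (a k)\<^sup>2))" for N
  proof -
    have "ennreal ((\<Sum>k<N. a k)\<^sup>2) \<le> ennreal (\<Sum>k<N. 2 ^ Suc k * (a k)\<^sup>2)"
      by (intro ennreal_leI square_sum_le_weighted)
    also have "\<dots> = (\<Sum>k<N. ennreal (2 ^ Suc k * (a k)\<^sup>2))" by (subst sum_ennreal) auto
    also have "\<dots> \<le> (\<Sum>k. ennreal (2 ^ Suc k * (a k)\<^sup>2))" by (intro sum_le_suminf summableI) auto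
    finally show ?thesis .
  qed
  then show "\<exists>N. \<forall>n\<ge>N. ennreal ((\<Sum>k<n. a k)\<^sup>2) \<le> (\<Sum>k. ennreal (2 ^ Suc k * (a k)\<^sup>2))" by blast
qed

section \<open>A square integrable slope that is infinite on a dense set\<close>

definition bump :: "real \<Rightarrow> real" where
  "bump x = (max 0 (1 - x\<^sup>2))\<^sup>2"

definition bump' :: "real \<Rightarrow> real" where
  "bump' x = - 4 * x * max 0 (1 - x\<^sup>2)"

lemma bump_DERIV:
  assumes "(f has_real_derivative D) (at x)"
  shows "((\<lambda>x. bump (f x)) has_real_derivative bump' (f x) * D) (at x)"
  unfolding bump_def bump'_def
  by (rule derivative_eq_intros assms refl | simp)+

lemma bump_nonneg: "0 \<le> bump x"
  by (simp add: bump_def)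

lemma bump_le_1: "bump x \<le> 1"
  by (auto simp: bump_def max_def power_le_one)

lemma bump_outside: "1 \<le> \<bar>x\<bar> \<Longrightarrow> bump x = 0"
  using power_mono[of 1 "\<bar>x\<bar>" 2] by (simp add: bump_def max_def)

lemma bump_inside: "\<bar>x\<bar> \<le> 1/2 \<Longrightarrow> 1/2 \<le> bump x"
proof -
  assume "\<bar>x\<bar> \<le> 1/2"
  then have "x\<^sup>2 \<le> (1/2)\<^sup>2" by (intro abs_le_square_iff[THEN iffD1]) simp
  then have "3/4 \<le> max 0 (1 - x\<^sup>2)" by (simp add: power2_eq_square)
  then have "(3/4)\<^sup>2 \<le> bump x" unfolding bump_def by (rule power_mono) simp
  then show ?thesis by (simp add: power2_eq_square)
qed

lemma abs_bump'_le: "\<bar>bump' x\<bar> \<le> 4"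
proof (cases "\<bar>x\<bar> \<le> 1")
  case True
  then have "\<bar>x\<bar> * max 0 (1 - x\<^sup>2) \<le> 1 * 1" by (intro mult_mono) (auto simp: max_def)
  then show ?thesis by (simp add: bump'_def abs_mult)
next
  case False
  then have "1 \<le> x\<^sup>2" using power_mono[of 1 "\<bar>x\<bar>" 2] by simp
  then show ?thesis by (simp add: bump'_def max_def)
qed

lemma continuous_bump': "continuous_on S bump'"
  unfolding bump'_def by (intro continuous_intros)

definition radius :: "nat \<Rightarrow> real" where
  "radius n = (1/4) ^ Suc n"

definition node :: "nat \<Rightarrow> real" where
  "node = from_nat_into (\<rat> \<inter> {0<..<1})"

text \<open>The numbers \<open>n + 1 = 2\<^sup>j (2 i + 1)\<close> with fixed \<open>j\<close> have divergent reciprocal sum, so all spikes with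
these indices are placed at the same node. The finitely many of them that would not fit into \<open>(0,1)\<close> are
moved to \<open>1/2\<close>.\<close>

definition centre :: "nat \<Rightarrow> real" where
  "centre n = (let q = node (multiplicity 2 (Suc n))
     in if radius n < q \<and> q < 1 - radius n then q else 1/2)"

lemma range_node: "range node = \<rat> \<inter> {0<..<1::real}"
proof -
  have "(1/2 :: real) \<in> \<rat> \<inter> {0<..<1}" by auto
  then show ?thesis unfolding node_def
    by (intro range_from_nat_into countable_Int1 countable_rat) blast
qed

lemma node_dense:
  assumes "0 \<le> a" "a < b" "b \<le> 1"
  obtains j where "a < node j" "node j < b"
proof -
  obtain q where "q \<in> \<rat>" "a < q" "q < b" using Rats_dense_in_real[OF assms(2)] by blast
  then have "q \<in> range node" using assms by (auto simp: range_node)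
  then show thesis using that \<open>a < q\<close> \<open>q < b\<close> by blast
qed

lemma node_bounds: "0 < node j" "node j < 1"
  using range_node by auto

lemma radius_pos: "0 < radius n"
  by (simp add: radius_def)

lemma radius_le: "radius n \<le> 1/4"
  by (simp add: radius_def power_le_one)

lemma centre_bounds: "0 < centre n - radius n" "centre n + radius n < 1"
  using radius_le[of n] by (auto simp: centre_def Let_def)

definition spike :: "nat \<Rightarrow> real \<Rightarrow> real" where
  "spike n t = 1 / real (Suc n) * bump ((t - centre n) / radius n)"

definition spike' :: "nat \<Rightarrow> real \<Rightarrow> real" where
  "spike' n t = 1 / real (Suc n) * (bump' ((t - centre n) / radius n) * (1 / radius n))"

lemma spike_DERIV: "(spike n has_real_derivative spike' n t) (at t)"
  unfolding spike_def[abs_def] spike'_def using radius_pos[of n]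
  by (intro DERIV_cmult bump_DERIV) (auto intro!: derivative_eq_intros)

lemma continuous_spike': "continuous_on S (spike' n)"
  unfolding spike'_def[abs_def] using radius_pos[of n]
  by (auto intro!: continuous_intros continuous_on_compose2[OF continuous_bump'[of UNIV]])

lemma spike_nonneg: "0 \<le> spike n t"
  by (simp add: spike_def bump_nonneg)

lemma spike_le: "spike n t \<le> 1 / real (Suc n)"
  using mult_left_mono[OF bump_le_1, of "1 / real (Suc n)"] by (simp add: spike_def)

lemma spike_outside: "t \<notin> {centre n - radius n..centre n + radius n} \<Longrightarrow> spike n t = 0"
  unfolding spike_def using radius_pos[of n]
  by (subst bump_outside) (auto simp: field_simps abs_if split: if_splits)

lemma spike_inside: "\<bar>t - centre n\<bar> \<le> radius n / 2 \<Longrightarrow> 1 / (2 * real (Suc n)) \<le> spike n t"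
proof -
  assume "\<bar>t - centre n\<bar> \<le> radius n / 2"
  then have "1/2 \<le> bump ((t - centre n) / radius n)"
    using radius_pos[of n] by (intro bump_inside) (simp add: field_simps)
  then have "1 / real (Suc n) * (1/2) \<le> spike n t" unfolding spike_def by (intro mult_left_mono) auto
  then show ?thesis by (simp add: mult.commute)
qed

lemma abs_spike'_le: "\<bar>spike' n t\<bar> \<le> 16 * 4 ^ n / real (Suc n)"
proof -
  have "\<bar>spike' n t\<bar> = 1 / real (Suc n) * (\<bar>bump' ((t - centre n) / radius n)\<bar> * (1 / radius n))"
    using radius_pos[of n] by (simp add: spike'_def abs_mult)
  also have "\<dots> \<le> 1 / real (Suc n) * (4 * (1 / radius n))"
    using radius_pos[of n] by (intro mult_left_mono mult_right_mono abs_bump'_le) auto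
  also have "\<dots> = 16 * 4 ^ n / real (Suc n)" by (simp add: radius_def power_one_over field_simps)
  finally show ?thesis .
qed

lemma continuous_spike: "continuous_on S (spike n)"
  by (meson spike_DERIV DERIV_isCont continuous_at_imp_continuous_on)

lemma spike_measurable [measurable]: "spike n \<in> borel_measurable borel"
  by (intro borel_measurable_continuous_onI continuous_spike)

definition slope_upto :: "nat \<Rightarrow> real \<Rightarrow> real" where
  "slope_upto N t = (\<Sum>n<N. spike n t)"

definition slope_upto' :: "nat \<Rightarrow> real \<Rightarrow> real" where
  "slope_upto' N t = (\<Sum>n<N. spike' n t)"

lemma slope_upto_DERIV: "(slope_upto N has_real_derivative slope_upto' N t) (at t)"
  unfolding slope_upto_def[abs_def] slope_upto'_def by (intro DERIV_sum spike_DERIV)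

lemma continuous_slope_upto': "continuous_on S (slope_upto' N)"
  unfolding slope_upto'_def[abs_def] by (intro continuous_on_sum continuous_spike')

lemma continuous_slope_upto: "continuous_on S (slope_upto N)"
  unfolding slope_upto_def[abs_def] by (intro continuous_on_sum continuous_spike)

lemma slope_upto_measurable [measurable]: "slope_upto N \<in> borel_measurable borel"
  by (intro borel_measurable_continuous_onI continuous_slope_upto)

lemma slope_upto_nonneg: "0 \<le> slope_upto N t"
  unfolding slope_upto_def by (intro sum_nonneg spike_nonneg)

lemma slope_upto_le: "slope_upto N t \<le> real N"
proof -
  have "slope_upto N t \<le> (\<Sum>n<N. 1)"
    unfolding slope_upto_def
  proof (rule sum_mono)
    fix n show "spike n t \<le> 1" using spike_le[of n t] by (rule order_trans) simp
  qed
  then show ?thesis by simp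
qed

text \<open>The partial sums are supported in a compact part of \<open>(0,1)\<close>, which makes them test functions.\<close>

lemma slope_upto_support:
  obtains a b where "0 < a" "b < 1" "\<And>t. t \<notin> {a..b} \<Longrightarrow> slope_upto N t = 0"
proof -
  have "\<exists>a b. 0 < a \<and> b < 1 \<and> (\<forall>t. t \<notin> {a..b} \<longrightarrow> slope_upto N t = 0)"
  proof (induction N)
    case 0
    show ?case by (intro exI[of _ "1/2"]) (simp add: slope_upto_def)
  next
    case (Suc N)
    then obtain a b where ab: "0 < a" "b < 1" "\<And>t. t \<notin> {a..b} \<Longrightarrow> slope_upto N t = 0" by blast
    show ?case
    proof (intro exI conjI allI impI)
      show "0 < min a (centre N - radius N)" using ab centre_bounds by simp
      show "max b (centre N + radius N) < 1" using ab centre_bounds by simp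
      fix t assume "t \<notin> {min a (centre N - radius N)..max b (centre N + radius N)}"
      then have "t \<notin> {a..b}" "t \<notin> {centre N - radius N..centre N + radius N}" by auto
      then have "slope_upto N t = 0" "spike N t = 0" using ab(3) spike_outside by blast+
      then show "slope_upto (Suc N) t = 0" by (simp add: slope_upto_def)
    qed
  qed
  then show thesis using that by blast
qed

text \<open>The derivatives of the spikes grow geometrically, so the last one dominates.\<close>

lemma abs_slope_upto'_le: "\<bar>slope_upto' N t\<bar> \<le> 16 * 4 ^ N / real (Suc N)"
proof -
  have "\<bar>slope_upto' N t\<bar> \<le> (\<Sum>n<N. 16 * 4 ^ n / real (Suc n))"
    unfolding slope_upto'_def by (rule order_trans[OF sum_abs]) (intro sum_mono abs_spike'_le)
  also have "\<dots> \<le> 16 * 4 ^ N / real (Suc N)"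
  proof (induction N)
    case (Suc N)
    have "(\<Sum>n<Suc N. 16 * 4 ^ n / real (Suc n)) \<le> 2 * (16 * 4 ^ N) / real (Suc N)"
      using Suc by simp
    also have "\<dots> \<le> 16 * 4 ^ Suc N / real (Suc (Suc N))"
      by (simp add: field_simps)
    finally show ?case .
  qed simp
  finally show ?thesis .
qed

text \<open>A finite partial sum already exceeds \<open>M\<close> in a neighbourhood of the node: the tops of finitely many
of the spikes centred there contribute a large partial sum of a harmonic series.\<close>

lemma node_divergence:
  fixes M :: real
  obtains N \<rho> where "0 < \<rho>" "\<And>t. \<bar>t - node j\<bar> \<le> \<rho> \<Longrightarrow> M \<le> slope_upto N t"
proof -
  \<comment> \<open>the indices of the spikes that belong to the node\<close>
  define ix where "ix i = 2 ^ j * (2 * i + 1) - (1::nat)" for i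
  have ix: "Suc (ix i) = 2 ^ j * (2 * i + 1)" for i by (simp add: ix_def)
  have mult: "multiplicity 2 (Suc (ix i)) = j" for i
    unfolding ix
  proof (rule multiplicity_eqI)
    show "\<not> 2 ^ Suc j dvd 2 ^ j * (2 * i + 1)"
      unfolding power_Suc2 by (subst dvd_times_left_cancel_iff) auto
  qed simp
  have inj: "inj ix"
  proof (rule injI)
    fix x y assume "ix x = ix y"
    then have "2 ^ j * (2 * x + 1) = (2 ^ j * (2 * y + 1) :: nat)" using ix by metis
    then show "x = y" by simp
  qed
  have ix_ge: "i \<le> ix i" for i
  proof -
    have "1 * (2 * i + 1) \<le> 2 ^ j * (2 * i + 1)" by (intro mult_right_mono) auto
    then have "2 * i + 1 \<le> Suc (ix i)" unfolding ix by simp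
    then show ?thesis by simp
  qed
  have "(\<lambda>n. radius n) \<longlonglongrightarrow> 0" unfolding radius_def by (intro LIMSEQ_Suc LIMSEQ_power_zero) simp
  then have "\<forall>\<^sub>F n in sequentially. radius n < min (node j) (1 - node j)"
    using node_bounds[of j] by (intro order_tendstoD) auto
  then obtain I where I: "\<And>n. n \<ge> I \<Longrightarrow> radius n < min (node j) (1 - node j)"
    by (auto simp: eventually_sequentially)
  have centre: "centre (ix (I + i)) = node j" for i
    using I[of "ix (I + i)"] ix_ge[of "I + i"] by (auto simp: centre_def Let_def mult)
  have "\<not> summable (\<lambda>i. 1 / (2 * real (Suc (ix (I + i)))))"
  proof
    assume "summable (\<lambda>i. 1 / (2 * real (Suc (ix (I + i)))))"
    then have "summable (\<lambda>i. 2 ^ Suc (Suc j) * (1 / (2 * real (Suc (ix (i + I))))))"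
      by (intro summable_mult) (simp add: add.commute)
    moreover have "norm (inverse (of_nat (Suc (i + I))) :: real) \<le> 2 ^ Suc (Suc j) * (1 / (2 * real (Suc (ix (i + I)))))" for i
    proof -
      have eq: "2 ^ Suc (Suc j) * (1 / (2 * real (Suc (ix (i + I))))) = 2 / real (2 * (i + I) + 1)"
        unfolding ix of_nat_mult by (simp add: frac_eq_eq)
      show ?thesis unfolding eq by (simp add: field_simps)
    qed
    ultimately have "summable (\<lambda>i. inverse (of_nat (Suc (i + I))) :: real)"
      by (rule summable_comparison_test'[of _ 0]) 
    then have "summable (\<lambda>i. inverse (of_nat (Suc i)) :: real)"
      using summable_iff_shift[of "\<lambda>i. inverse (of_nat (Suc i)) :: real" I] by simp
    then have "summable (\<lambda>i. inverse (of_nat i) :: real)"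
      using summable_Suc_iff[of "\<lambda>i. inverse (of_nat i) :: real"] by simp
    then show False using not_summable_harmonic[where 'a=real] by (simp add: inverse_eq_divide)
  qed
  then have "\<exists>K. M < (\<Sum>i<K. 1 / (2 * real (Suc (ix (I + i)))))"
    using summableI_nonneg_bounded[of "\<lambda>i. 1 / (2 * real (Suc (ix (I + i))))" M]
    by (auto simp: not_le[symmetric])
  then obtain K where K: "M < (\<Sum>i<K. 1 / (2 * real (Suc (ix (I + i)))))" by blast
  define N where "N = Suc (\<Sum>i<K. ix (I + i))"
  have ixN: "ix (I + i) < N" if "i < K" for i
    unfolding N_def using that member_le_sum[of i "{..<K}" "\<lambda>i. ix (I + i)"] by simp
  show thesis
  proof (rule that[of "radius N / 2" N])
    show "0 < radius N / 2" using radius_pos by simp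
    fix t assume t: "\<bar>t - node j\<bar> \<le> radius N / 2"
    have "1 / (2 * real (Suc (ix (I + i)))) \<le> spike (ix (I + i)) t" if "i < K" for i
    proof (rule spike_inside)
      have "radius N \<le> radius (ix (I + i))"
        unfolding radius_def using ixN[OF that] by (intro power_decreasing) auto
      then show "\<bar>t - centre (ix (I + i))\<bar> \<le> radius (ix (I + i)) / 2" using t centre by simp
    qed
    then have "(\<Sum>i<K. 1 / (2 * real (Suc (ix (I + i))))) \<le> (\<Sum>i<K. spike (ix (I + i)) t)"
      by (intro sum_mono) simp
    also have "\<dots> = (\<Sum>n\<in>(\<lambda>i. ix (I + i)) ` {..<K}. spike n t)"
      using injD[OF inj] by (subst sum.reindex) (fastforce simp: inj_on_def)+
    also have "\<dots> \<le> slope_upto N t"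
      unfolding slope_upto_def using ixN by (intro sum_mono2) (auto simp: spike_nonneg)
    finally show "M \<le> slope_upto N t" using K by simp
  qed
qed

lemma borel_measurable_lebesgue_onI:
  "f \<in> borel_measurable borel \<Longrightarrow> f \<in> borel_measurable (lebesgue_on S)"
  by (intro measurable_restrict_space1 measurable_completion) simp

abbreviation unit_measure :: "real measure" where
  "unit_measure \<equiv> lebesgue_on {0..1}"

text \<open>The series converges outside a null set (\<open>AE_spike_summable\<close>) and diverges at every node, where the
value is arbitrary.\<close>

definition slope :: "real \<Rightarrow> real" where
  "slope t = (\<Sum>n. spike n t)"

lemma slope_measurable [measurable]: "slope \<in> borel_measurable borel"
  unfolding slope_def[abs_def] by measurable

lemma nn_integral_spike_power_le:
  assumes p: "0 < p" and S: "S \<in> sets lebesgue"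
  shows "(\<integral>\<^sup>+t. ennreal (spike n t ^ p) \<partial>lebesgue_on S) \<le> ennreal (2 * radius n / real (Suc n) ^ p)"
proof -
  let ?I = "{centre n - radius n..centre n + radius n}"
  have le: "ennreal (spike n t ^ p) \<le> ennreal (1 / real (Suc n) ^ p) * indicator ?I t" for t
  proof (cases "t \<in> ?I")
    case True
    have "spike n t ^ p \<le> (1 / real (Suc n)) ^ p" by (intro power_mono spike_le spike_nonneg)
    then show ?thesis using True by (simp add: power_one_over inverse_eq_divide)
  qed (use p in \<open>simp add: spike_outside\<close>)
  have "(\<integral>\<^sup>+t. ennreal (spike n t ^ p) \<partial>lebesgue_on S) \<le> (\<integral>\<^sup>+t. ennreal (spike n t ^ p) \<partial>lborel)"
    by (subst nn_integral_completion[symmetric], subst nn_integral_restrict_space)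
      (use S in \<open>auto intro!: nn_integral_mono simp: indicator_def\<close>)
  also have "\<dots> \<le> (\<integral>\<^sup>+t. ennreal (1 / real (Suc n) ^ p) * indicator ?I t \<partial>lborel)"
    by (intro nn_integral_mono le)
  also have "\<dots> = ennreal (1 / real (Suc n) ^ p) * ennreal (2 * radius n)"
    using radius_pos[of n] by (subst nn_integral_cmult_indicator) auto
  also have "\<dots> = ennreal (2 * radius n / real (Suc n) ^ p)"
    using radius_pos[of n] by (subst ennreal_mult[symmetric]) auto
  finally show ?thesis .
qed


lemma nn_integral_tail_le:
  "(\<integral>\<^sup>+t. (\<Sum>k. ennreal (spike (n + k) t)) \<partial>unit_measure) \<le> ennreal ((1/4) ^ n / real (Suc n))"
proof -
  have [measurable]: "spike k \<in> borel_measurable unit_measure" for k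
    by (intro borel_measurable_lebesgue_onI) simp
  have "(\<integral>\<^sup>+t. (\<Sum>k. ennreal (spike (n + k) t)) \<partial>unit_measure)
      = (\<Sum>k. \<integral>\<^sup>+t. ennreal (spike (n + k) t) \<partial>unit_measure)"
    by (rule nn_integral_suminf) measurable
  also have "\<dots> \<le> (\<Sum>k. ennreal (2 * radius (n + k) / real (Suc (n + k))))"
  proof (intro suminf_le summableI)
    fix k show "(\<integral>\<^sup>+t. ennreal (spike (n + k) t) \<partial>unit_measure) \<le> ennreal (2 * radius (n + k) / real (Suc (n + k)))"
      using nn_integral_spike_power_le[of 1 "{0..1}" "n + k"] by simp
  qed
  also have "\<dots> \<le> ennreal ((2 * radius n / real (Suc n)) / (1 - 1/4))"
  proof (rule suminf_le_geometric)
    fix k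
    have "2 * radius (n + k) / real (Suc (n + k)) \<le> 2 * radius (n + k) / real (Suc n)"
      using radius_pos[of "n + k"] by (intro divide_left_mono) auto
    then show "2 * radius (n + k) / real (Suc (n + k)) \<le> 2 * radius n / real (Suc n) * (1/4) ^ k"
      by (simp add: radius_def power_add mult.commute)
  qed (use radius_pos in \<open>auto intro!: less_imp_le\<close>)
  also have "\<dots> \<le> ennreal ((1/4) ^ n / real (Suc n))"
  proof (intro ennreal_leI)
    have "2 * radius n / real (Suc n) / (1 - 1/4) = 2/3 * ((1/4) ^ n / real (Suc n))"
      by (simp add: radius_def frac_eq_eq add_nonneg_eq_0_iff)
    also have "\<dots> \<le> (1/4) ^ n / real (Suc n)" by (intro mult_left_le_one_le) auto
    finally show "2 * radius n / real (Suc n) / (1 - 1/4) \<le> (1/4) ^ n / real (Suc n)" .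
  qed
  finally show ?thesis .
qed

lemma AE_spike_summable: "AE t in unit_measure. summable (\<lambda>n. spike n t)"
proof -
  have [measurable]: "spike k \<in> borel_measurable unit_measure" for k
    by (intro borel_measurable_lebesgue_onI) simp
  have "(\<integral>\<^sup>+t. (\<Sum>k. ennreal (spike k t)) \<partial>unit_measure) \<le> ennreal 1"
    using nn_integral_tail_le[of 0] by simp
  then have "(\<integral>\<^sup>+t. (\<Sum>k. ennreal (spike k t)) \<partial>unit_measure) \<noteq> \<infinity>"
    by (auto simp: top_unique)
  then have "AE t in unit_measure. (\<Sum>k. ennreal (spike k t)) \<noteq> \<infinity>"
    by (intro nn_integral_PInf_AE) measurable
  then show ?thesis
    by eventually_elim (auto intro: summable_suminf_not_top spike_nonneg)
qed

lemma slope_tail: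
  assumes "summable (\<lambda>n. spike n t)"
  shows "slope t - slope_upto n t = (\<Sum>k. spike (n + k) t)" "summable (\<lambda>k. spike (n + k) t)"
    "slope_upto n t \<le> slope t"
proof -
  show *: "slope t - slope_upto n t = (\<Sum>k. spike (n + k) t)"
    using suminf_minus_initial_segment[OF assms, of n] by (simp add: slope_def slope_upto_def add.commute)
  show s: "summable (\<lambda>k. spike (n + k) t)"
    using assms summable_iff_shift[of "\<lambda>k. spike k t" n] by (simp add: add.commute)
  have "0 \<le> (\<Sum>k. spike (n + k) t)" using s by (intro suminf_nonneg spike_nonneg)
  then show "slope_upto n t \<le> slope t" using * by simp
qed

lemma nn_integral_slope_tail_le:
  "(\<integral>\<^sup>+t. ennreal (slope t - slope_upto n t) \<partial>unit_measure) \<le> ennreal ((1/4) ^ n / real (Suc n))"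
proof -
  have "(\<integral>\<^sup>+t. ennreal (slope t - slope_upto n t) \<partial>unit_measure) = (\<integral>\<^sup>+t. (\<Sum>k. ennreal (spike (n + k) t)) \<partial>unit_measure)"
    by (rule nn_integral_cong_AE, use AE_spike_summable in eventually_elim)
      (simp add: slope_tail suminf_ennreal2 spike_nonneg)
  then show ?thesis using nn_integral_tail_le by simp
qed

text \<open>This is the quantity that the penalty has to outweigh in the proof of minimality.\<close>

lemma nn_integral_slope_tail_square_le:
  "(\<integral>\<^sup>+t. ennreal ((slope t - slope_upto n t)\<^sup>2) \<partial>unit_measure) \<le> ennreal (2 * (1/4) ^ n / real (Suc n) ^ 2)"
proof -
  have [measurable]: "spike k \<in> borel_measurable unit_measure" for k
    by (intro borel_measurable_lebesgue_onI) simp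
  have "(\<integral>\<^sup>+t. ennreal ((slope t - slope_upto n t)\<^sup>2) \<partial>unit_measure)
      \<le> (\<integral>\<^sup>+t. (\<Sum>k. ennreal (2 ^ Suc k * (spike (n + k) t)\<^sup>2)) \<partial>unit_measure)"
    by (rule nn_integral_mono_AE, use AE_spike_summable in eventually_elim)
      (simp add: slope_tail square_suminf_le_weighted del: power_Suc)
  also have "\<dots> = (\<Sum>k. \<integral>\<^sup>+t. ennreal (2 ^ Suc k * (spike (n + k) t)\<^sup>2) \<partial>unit_measure)"
    by (rule nn_integral_suminf) measurable
  also have "\<dots> \<le> (\<Sum>k. ennreal (2 ^ Suc k * (2 * radius (n + k) / real (Suc (n + k)) ^ 2)))"
  proof (intro suminf_le summableI)
    fix k
    have "(\<integral>\<^sup>+t. ennreal (2 ^ Suc k * (spike (n + k) t)\<^sup>2) \<partial>unit_measure)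
      = ennreal (2 ^ Suc k) * (\<integral>\<^sup>+t. ennreal ((spike (n + k) t)\<^sup>2) \<partial>unit_measure)"
      by (subst nn_integral_cmult[symmetric]) (auto simp: ennreal_mult simp del: power_Suc)
    also have "\<dots> \<le> ennreal (2 ^ Suc k) * ennreal (2 * radius (n + k) / real (Suc (n + k)) ^ 2)"
      by (intro mult_left_mono nn_integral_spike_power_le) auto
    also have "\<dots> = ennreal (2 ^ Suc k * (2 * radius (n + k) / real (Suc (n + k)) ^ 2))"
      using radius_pos[of "n + k"] by (subst ennreal_mult) auto
    finally show "(\<integral>\<^sup>+t. ennreal (2 ^ Suc k * (spike (n + k) t)\<^sup>2) \<partial>unit_measure)
      \<le> ennreal (2 ^ Suc k * (2 * radius (n + k) / real (Suc (n + k)) ^ 2))" .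
  qed
  also have "\<dots> \<le> ennreal ((4 * radius n / real (Suc n) ^ 2) / (1 - 1/2))"
  proof (rule suminf_le_geometric)
    fix k
    have "2 ^ Suc k * (2 * radius (n + k) / real (Suc (n + k)) ^ 2) \<le> 2 ^ Suc k * (2 * radius (n + k) / real (Suc n) ^ 2)"
      using radius_pos[of "n + k"] by (intro mult_left_mono divide_left_mono power_mono) auto
    also have "\<dots> = 4 * radius n / real (Suc n) ^ 2 * (2 ^ k * (1/4) ^ k)"
      by (simp add: radius_def power_add)
    also have "2 ^ k * (1/4) ^ k = (1/2 :: real) ^ k" by (simp add: power_mult_distrib[symmetric])
    finally show "2 ^ Suc k * (2 * radius (n + k) / real (Suc (n + k)) ^ 2) \<le> 4 * radius n / real (Suc n) ^ 2 * (1/2) ^ k" .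
  qed (use radius_pos in \<open>auto intro!: less_imp_le\<close>)
  also have "\<dots> = ennreal (2 * (1/4) ^ n / real (Suc n) ^ 2)"
    by (intro arg_cong[where f=ennreal]) (simp add: radius_def)
  finally show ?thesis .
qed

lemma integrable_slope_tail:
  "integrable unit_measure (\<lambda>t. slope t - slope_upto n t)"
  "integrable unit_measure (\<lambda>t. (slope t - slope_upto n t)\<^sup>2)"
proof -
  have [measurable]: "(\<lambda>t. slope t - slope_upto n t) \<in> borel_measurable unit_measure"
    by (intro borel_measurable_lebesgue_onI) measurable
  have "(\<integral>\<^sup>+t. ennreal (norm (slope t - slope_upto n t)) \<partial>unit_measure) = (\<integral>\<^sup>+t. ennreal (slope t - slope_upto n t) \<partial>unit_measure)"
    by (rule nn_integral_cong_AE, use AE_spike_summable in eventually_elim)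
      (simp add: slope_tail suminf_nonneg spike_nonneg)
  also have "\<dots> < \<infinity>" using nn_integral_slope_tail_le[of n] by (auto simp: less_top[symmetric] top_unique)
  finally show "integrable unit_measure (\<lambda>t. slope t - slope_upto n t)"
    by (intro integrableI_bounded) auto
  have "(\<integral>\<^sup>+t. ennreal (norm ((slope t - slope_upto n t)\<^sup>2)) \<partial>unit_measure) < \<infinity>"
    using nn_integral_slope_tail_square_le[of n] by (auto simp: less_top[symmetric] top_unique)
  then show "integrable unit_measure (\<lambda>t. (slope t - slope_upto n t)\<^sup>2)"
    by (intro integrableI_bounded) auto
qed

lemma integral_slope_tail_square_le:
  "(\<integral>t. (slope t - slope_upto n t)\<^sup>2 \<partial>unit_measure) \<le> 2 * (1/4) ^ n / real (Suc n) ^ 2"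
  using nn_integral_slope_tail_square_le[of n]
  unfolding nn_integral_eq_integral[OF integrable_slope_tail(2) AE_I2[OF zero_le_power2]]
  by (subst (asm) ennreal_le_iff) simp_all

lemma integrable_slope: "integrable unit_measure slope" "integrable unit_measure (\<lambda>t. (slope t)\<^sup>2)"
  using integrable_slope_tail[of 0] by (simp_all add: slope_upto_def)

lemma integrable_slope_excess:
  "integrable unit_measure (\<lambda>t. max 0 (slope t - slope_upto n t))"
  using integrable_max[OF _ integrable_slope_tail(1)[of n], of "\<lambda>_. 0"] by simp

lemma integral_slope_excess_le:
  "integral {0..1} (\<lambda>t. max 0 (slope t - slope_upto n t)) \<le> (1/4) ^ n / real (Suc n)"
proof -
  have "(\<integral>\<^sup>+t. ennreal (max 0 (slope t - slope_upto n t)) \<partial>unit_measure) \<le> ennreal ((1/4) ^ n / real (Suc n))"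
    using nn_integral_slope_tail_le[of n] by (simp add: ennreal_max_0)
  then have "(\<integral>t. max 0 (slope t - slope_upto n t) \<partial>unit_measure) \<le> (1/4) ^ n / real (Suc n)"
    unfolding nn_integral_eq_integral[OF integrable_slope_excess AE_I2[OF max.cobounded1]]
    by (subst (asm) ennreal_le_iff) simp_all
  then show ?thesis
    using lebesgue_integral_eq_integral[OF integrable_slope_excess[of n]] by simp
qed

definition curve :: "real \<Rightarrow> real" where
  "curve t = integral {0..t} slope"

lemma curve_diff:
  assumes "0 \<le> a" "a \<le> b" "b \<le> 1"
  shows "curve b - curve a = integral {a..b} slope"
  using Henstock_Kurzweil_Integration.integral_combine[of 0 a b slope] assms
    integral_lebesgue_on_indicator(3)[OF integrable_slope(1), of 0 b]
  by (simp add: curve_def)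

text \<open>The tail is truncated at \<open>0\<close> to have a bound at every point, including those where the series
for \<open>slope\<close> diverges.\<close>

lemma curve_diff_le_excess:
  assumes "0 \<le> a" "a \<le> b" "b \<le> 1"
  shows "curve b - curve a \<le> real n * (b - a) + integral {a..b} (\<lambda>t. max 0 (slope t - slope_upto n t))"
proof -
  have i: "slope integrable_on {a..b}" "(\<lambda>t. max 0 (slope t - slope_upto n t)) integrable_on {a..b}"
    by (rule integral_lebesgue_on_indicator(3)[OF integrable_slope(1) assms(1,3)]
        integral_lebesgue_on_indicator(3)[OF integrable_slope_excess assms(1,3)])+
  have "integral {a..b} slope \<le> integral {a..b} (\<lambda>t. real n + max 0 (slope t - slope_upto n t))"
  proof (rule integral_le)
    fix t show "slope t \<le> real n + max 0 (slope t - slope_upto n t)" using slope_upto_le[of n t] by simp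
  qed (intro i integrable_add integrable_const_ivl)+
  also have "\<dots> = real n * (b - a) + integral {a..b} (\<lambda>t. max 0 (slope t - slope_upto n t))"
    using assms i by (subst Henstock_Kurzweil_Integration.integral_add) auto
  finally show ?thesis using curve_diff[OF assms] by simp
qed

text \<open>On scales larger than \<open>4\<^sup>-\<^sup>n\<close> the function is almost Lipschitz, with the slowly growing constant \<open>n\<close>.\<close>

lemma curve_diff_le:
  assumes "0 \<le> a" "a \<le> b" "b \<le> 1"
  shows "curve b - curve a \<le> real n * (b - a) + (1/4) ^ n / real (Suc n)"
proof -
  have "integral {a..b} (\<lambda>t. max 0 (slope t - slope_upto n t)) \<le> integral {0..1} (\<lambda>t. max 0 (slope t - slope_upto n t))"
    using assms integral_lebesgue_on_indicator(3)[OF integrable_slope_excess assms(1,3)]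
      integral_lebesgue_on_indicator(3)[OF integrable_slope_excess, of 0 1]
    by (intro integral_subset_le) auto
  then show ?thesis using curve_diff_le_excess[OF assms, of n] integral_slope_excess_le[of n] by simp
qed

lemma curve_diff_ge:
  assumes ab: "0 \<le> a" "a \<le> b" "b \<le> 1" and M: "\<And>t. t \<in> {a..b} \<Longrightarrow> M \<le> slope_upto N t"
  shows "M * (b - a) \<le> curve b - curve a"
proof -
  have "integrable unit_measure (\<lambda>_. M)" by (intro continuous_imp_integrable_real) simp
  note c = integral_lebesgue_on_indicator[OF this ab(1,3)]
  note s = integral_lebesgue_on_indicator[OF integrable_slope(1) ab(1,3)]
  have "(\<integral>t. indicator {a..b} t * M \<partial>unit_measure) \<le> (\<integral>t. indicator {a..b} t * slope t \<partial>unit_measure)"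
  proof (rule integral_mono_AE[OF c(1) s(1)], use AE_spike_summable in eventually_elim)
    case (elim t)
    then show ?case using M[of t] slope_tail(3)[of t N] by (auto simp: indicator_def)
  qed
  then show ?thesis unfolding c(2) s(2) curve_diff[OF ab] using ab by (simp add: mult.commute)
qed

lemma curve_mono: "0 \<le> a \<Longrightarrow> a \<le> b \<Longrightarrow> b \<le> 1 \<Longrightarrow> curve a \<le> curve b"
  using curve_diff_ge[of a b 0 0] by (simp add: slope_upto_def)

text \<open>The bounded part of the slope contributes a multiple of the total length of the intervals, and the
excess over it has small integral over the whole of \<open>[0,1]\<close>.\<close>

lemma curve_abs_continuous: "abs_continuous_on {0..1} curve"
  unfolding abs_continuous_on_def
proof (intro allI impI)
  fix \<epsilon> :: real assume \<epsilon>: "0 < \<epsilon>"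
  have "(\<lambda>n. (1/4 :: real) ^ n) \<longlonglongrightarrow> 0" by (intro LIMSEQ_power_zero) simp
  from order_tendstoD(2)[OF this, of "\<epsilon> / 2"] \<epsilon>
  obtain n where n: "(1/4 :: real) ^ n < \<epsilon> / 2" by (auto simp: eventually_sequentially)
  let ?e = "\<lambda>t. max 0 (slope t - slope_upto n t)"
  have tail: "integral {0..1} ?e < \<epsilon> / 2"
  proof -
    have "(1/4 :: real) ^ n / real (Suc n) \<le> (1/4) ^ n / 1" by (intro divide_left_mono) auto
    then show ?thesis using integral_slope_excess_le[of n] n by simp
  qed
  have ei: "?e integrable_on {0..1}" by (rule integral_lebesgue_on_indicator(3)[OF integrable_slope_excess]) auto
  show "\<exists>\<delta>>0. \<forall>\<D> S. \<D> division_of S \<and> S \<subseteq> {0..1} \<and> (\<Sum>K\<in>\<D>. Sup K - Inf K) < \<delta> \<longrightarrow>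
        (\<Sum>K\<in>\<D>. \<bar>curve (Sup K) - curve (Inf K)\<bar>) < \<epsilon>"
  proof (intro exI[of _ "\<epsilon> / (2 * real (Suc n))"] conjI allI impI)
    show "0 < \<epsilon> / (2 * real (Suc n))" using \<epsilon> by simp
    fix \<D> and S :: "real set"
    assume "\<D> division_of S \<and> S \<subseteq> {0..1} \<and> (\<Sum>K\<in>\<D>. Sup K - Inf K) < \<epsilon> / (2 * real (Suc n))"
    then have D: "\<D> division_of S" "S \<subseteq> {0..1}"
      and small: "(\<Sum>K\<in>\<D>. Sup K - Inf K) < \<epsilon> / (2 * real (Suc n))" by simp_all
    have eS: "?e integrable_on S" using integrable_on_subdivision[OF D(1) ei D(2)] .
    have "\<bar>curve (Sup K) - curve (Inf K)\<bar> \<le> real n * (Sup K - Inf K) + integral K ?e" if K: "K \<in> \<D>" for K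
    proof -
      obtain a b where ab: "K = {a..b}" using division_ofD(4)[OF D(1) K] by auto
      have "K \<noteq> {}" "K \<subseteq> {0..1}" using division_ofD(2,3)[OF D(1) K] D(2) by auto
      then have "0 \<le> a" "a \<le> b" "b \<le> 1" unfolding ab by auto
      then show ?thesis using curve_diff_le_excess[of a b n] curve_mono[of a b] by (simp add: ab)
    qed
    then have "(\<Sum>K\<in>\<D>. \<bar>curve (Sup K) - curve (Inf K)\<bar>) \<le> (\<Sum>K\<in>\<D>. real n * (Sup K - Inf K) + integral K ?e)"
      by (rule sum_mono)
    also have "\<dots> = real n * (\<Sum>K\<in>\<D>. Sup K - Inf K) + integral S ?e"
      using integral_combine_division_topdown[OF eS D(1)] by (simp add: sum.distrib sum_distrib_left)
    also have "\<dots> \<le> real n * (\<epsilon> / (2 * real (Suc n))) + integral {0..1} ?e"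
      using small by (intro add_mono mult_left_mono integral_subset_le[OF D(2) eS ei]) auto
    also have "real n * (\<epsilon> / (2 * real (Suc n))) \<le> \<epsilon> / 2" using \<epsilon> by (simp add: field_simps)
    finally show "(\<Sum>K\<in>\<D>. \<bar>curve (Sup K) - curve (Inf K)\<bar>) < \<epsilon>" using tail by simp
  qed
qed

lemma continuous_curve: "continuous_on {0..1} curve"
  by (rule continuous_on_of_abs_continuous[OF curve_abs_continuous])

lemma curve_has_weak_derivative: "has_weak_derivative 1 curve slope"
proof (rule has_weak_derivative_of_FTC)
  have set: "set_integrable lborel {0..1} slope"
  proof -
    have "integrable lebesgue (\<lambda>t. indicator {0..1} t *\<^sub>R slope t)"
      using integrable_slope(1) by (subst (asm) integrable_restrict_space) auto
    then show ?thesis unfolding set_integrable_def by (subst (asm) integrable_completion) auto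
  qed
  then show "set_integrable lborel {0..1} slope" .
  fix t :: real assume t: "t \<in> {0..1}"
  then have "set_integrable lborel {0..t} slope" by (intro set_integrable_subset[OF set]) auto
  then show "curve t = curve 0 + (LBINT s:{0..t}. slope s)"
    using t by (simp add: curve_def set_borel_integral_eq_integral(2))
qed auto

lemma slope_Lebesgue_space: "slope \<in> Lebesgue_space 1 1" "slope \<in> Lebesgue_space 1 2"
  using integrable_slope borel_measurable_lebesgue_onI[OF slope_measurable]
  by (simp_all add: Lebesgue_space_def)

lemma curve_Sobolev: "curve \<in> Sobolev_space 1 1" "curve \<in> Sobolev_space 1 2"
proof -
  have "integrable unit_measure curve" "integrable unit_measure (\<lambda>t. \<bar>curve t\<bar>)" "integrable unit_measure (\<lambda>t. (curve t)\<^sup>2)"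
    by (intro continuous_imp_integrable_real continuous_intros continuous_curve)+
  then have "curve \<in> Lebesgue_space 1 1" "curve \<in> Lebesgue_space 1 2"
    by (auto simp: Lebesgue_space_def)
  then show "curve \<in> Sobolev_space 1 1" "curve \<in> Sobolev_space 1 2"
    using curve_abs_continuous curve_has_weak_derivative slope_Lebesgue_space
    by (auto simp: Sobolev_space_def)
qed

lemma weak_deriv_curve: "AE t in unit_measure. weak_deriv 1 curve t = slope t"
proof -
  note wd = weak_derivI[OF slope_Lebesgue_space(1) curve_has_weak_derivative]
  show ?thesis
  proof (rule AE_eq_of_interval_integrals[OF wd(1) integrable_slope(1)])
    fix a b :: real assume ab: "0 \<le> a" "a \<le> b" "b \<le> 1"
    show "integral {a..b} (weak_deriv 1 curve) = integral {a..b} slope"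
      unfolding weak_derivative_FTC[OF wd(2,1) continuous_curve ab, symmetric] curve_diff[OF ab] ..
  qed
qed

section \<open>The weight and the growth function\<close>

text \<open>The weight vanishes at \<open>0\<close> as slowly as \<open>1 / ln (1/s)\<close>, so that at \<open>s = 4\<^sup>-\<^sup>n\<close> it is of the order
\<open>1/(n+1)\<close>, the height of the \<open>n\<close>-th spike. The constant is large enough for the explicit
estimates below.\<close>

definition weight :: "real \<Rightarrow> real" where
  "weight s = (if s \<le> 0 then 0 else 1024 / (1 - ln (min 1 s)))"

lemma ln_min_1_less: "0 < s \<Longrightarrow> ln (min 1 s) < (1::real)"
  by (rule le_less_trans[of _ 0]) (auto simp: min_def)

lemma weight_0 [simp]: "weight 0 = 0"
  by (simp add: weight_def)

lemma weight_pos: "0 < s \<Longrightarrow> 0 < weight s"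
  using ln_min_1_less[of s] by (simp add: weight_def)

lemma weight_nonneg: "0 \<le> weight s"
  using weight_pos[of s] by (cases "0 < s") (auto simp: weight_def)

lemma weight_mono: "s \<le> t \<Longrightarrow> weight s \<le> weight t"
proof (cases "0 < s")
  case True
  assume "s \<le> t"
  then have "ln (min 1 s) \<le> ln (min 1 t)" using True by (subst ln_le_cancel_iff) auto
  moreover have "ln (min 1 s) < 1" "ln (min 1 t) < 1" using True \<open>s \<le> t\<close> by (intro ln_min_1_less; simp)+
  ultimately have "1024 / (1 - ln (min 1 s)) \<le> 1024 / (1 - ln (min 1 t))"
    by (intro divide_left_mono) auto
  then show ?thesis using True \<open>s \<le> t\<close> by (simp add: weight_def)
qed (use weight_nonneg in \<open>simp add: weight_def\<close>)

lemma continuous_weight: "continuous_on S weight"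
proof -
  have "isCont weight x" for x
  proof -
    consider "x < 0" | "x = 0" | "0 < x" by linarith
    then show ?thesis
    proof cases
      case 1
      have "\<forall>\<^sub>F y in nhds x. weight y = 0"
        using eventually_nhds_in_open[of "{..<0}" x] 1 by (auto elim!: eventually_mono simp: weight_def)
      then show ?thesis using isCont_cong[of weight "\<lambda>_. 0" x] by simp
    next
      case 2
      have "((\<lambda>s::real. 1024 / (1 - ln s)) \<longlongrightarrow> 0) (at_right 0)"
      proof (rule real_tendsto_divide_at_top[OF tendsto_const])
        have "filterlim (\<lambda>s::real. - ln s) at_top (at_right 0)"
          using ln_at_0 by (simp add: filterlim_uminus_at_top)
        then show "filterlim (\<lambda>s::real. 1 - ln s) at_top (at_right 0)"
          using filterlim_tendsto_add_at_top[OF tendsto_const, of "\<lambda>s. - ln s" "at_right 0" 1] by simp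
      qed
      moreover have "\<forall>\<^sub>F s in at_right (0::real). 1024 / (1 - ln s) = weight s"
        using eventually_at_right_real[of 0 1] by (auto elim!: eventually_mono simp: weight_def)
      ultimately have "(weight \<longlongrightarrow> 0) (at_right 0)" by (rule Lim_transform_eventually)
      moreover have "\<forall>\<^sub>F s in at_left (0::real). 0 = weight s"
        using eventually_at_left_real[of "-1" 0] by (auto elim!: eventually_mono simp: weight_def)
      then have "(weight \<longlongrightarrow> 0) (at_left 0)" by (rule Lim_transform_eventually[OF tendsto_const])
      ultimately show ?thesis using 2 by (simp add: isCont_def filterlim_split_at)
    next
      case 3
      have "isCont (\<lambda>s. 1024 / (1 - ln (min 1 s))) x"
        using 3 ln_min_1_less[of x] by (intro continuous_intros) auto
      moreover have "\<forall>\<^sub>F y in nhds x. weight y = 1024 / (1 - ln (min 1 y))"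
        using eventually_nhds_in_open[of "{0<..}" x] 3 by (auto elim!: eventually_mono simp: weight_def)
      ultimately show ?thesis
        using isCont_cong[of weight "\<lambda>s. 1024 / (1 - ln (min 1 s))" x] by simp
    qed
  qed
  then show ?thesis by (simp add: continuous_at_imp_continuous_on)
qed

lemma ln_4_le: "ln (4::real) \<le> 3"
  using ln_le_minus_one[of "4::real"] by simp

text \<open>With \<open>s = 4 \<sigma> / 4\<^sup>n\<close> the claim reads \<open>\<sigma> (1 - ln s) \<le> 4 (n + 1)\<close>, and \<open>- \<sigma> ln \<sigma> \<le> 1\<close>.\<close>

lemma weight_ge_linear:
  assumes n: "1 \<le> n" and s: "0 \<le> s" "s \<le> 4 * (1/4) ^ n"
  shows "64 * 4 ^ n / real (Suc n) * s \<le> weight s"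
proof (cases "s = 0")
  case False
  define \<sigma> where "\<sigma> = s * 4 ^ n / 4"
  have \<sigma>: "0 < \<sigma>" "\<sigma> \<le> 1" and s_eq: "s = 4 * \<sigma> / 4 ^ n"
    using s False by (auto simp: \<sigma>_def field_simps power_one_over)
  have s1: "s \<le> 1"
  proof -
    have "(1/4 :: real) ^ n \<le> (1/4) ^ 1" using n by (intro power_decreasing) auto
    then show ?thesis using s by simp
  qed
  have "ln s = ln 4 + ln \<sigma> - real n * ln 4"
    unfolding s_eq using \<sigma> by (simp add: ln_div ln_mult ln_realpow)
  then have "1 - ln s = 1 + (real n - 1) * ln 4 - ln \<sigma>" by (simp add: algebra_simps)
  also have "\<dots> \<le> 1 + (real n - 1) * 3 - ln \<sigma>"
    using n ln_4_le by (intro diff_right_mono add_left_mono mult_left_mono) auto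
  finally have "\<sigma> * (1 - ln s) \<le> \<sigma> * (1 + (real n - 1) * 3 - ln \<sigma>)"
    using \<sigma> by (intro mult_left_mono) auto
  also have "\<dots> = \<sigma> * (1 + (real n - 1) * 3) + \<sigma> * (- ln \<sigma>)" by (simp add: algebra_simps)
  also have "\<sigma> * (1 + (real n - 1) * 3) \<le> 1 + (real n - 1) * 3"
    using \<sigma> n by (intro mult_left_le_one_le) auto
  also have "\<sigma> * (- ln \<sigma>) \<le> 1"
  proof -
    have "ln (1 / \<sigma>) \<le> 1 / \<sigma> - 1" using \<sigma> by (intro ln_le_minus_one) auto
    then have "- ln \<sigma> \<le> 1 / \<sigma> - 1" using \<sigma> by (simp add: ln_div)
    then have "\<sigma> * (- ln \<sigma>) \<le> \<sigma> * (1 / \<sigma> - 1)" using \<sigma> by (intro mult_left_mono) auto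
    then show ?thesis using \<sigma> by (simp add: algebra_simps)
  qed
  finally have key: "\<sigma> * (1 - ln s) \<le> 4 * real (Suc n)" by simp
  have d: "0 < 1 - ln s" using ln_min_1_less[of s] s False s1 by (simp add: min_def)
  have "64 * 4 ^ n / real (Suc n) * s = 256 * \<sigma> / real (Suc n)" by (simp add: s_eq)
  also have "\<dots> \<le> 1024 / (1 - ln s)" using key d by (simp add: field_simps)
  also have "\<dots> = weight s" using s s1 False by (simp add: weight_def min_def)
  finally show ?thesis .
qed simp

lemma weight_ge_const:
  assumes "(1/4) ^ n / 2 \<le> s"
  shows "64 / real (Suc n) \<le> weight s"
proof -
  define r :: real where "r = (1/4) ^ n / 2"
  have r: "0 < r" "r \<le> 1" by (auto simp: r_def power_le_one intro!: order_trans[OF power_le_one])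
  have "ln r = - real n * ln 4 - ln 2"
    by (simp add: r_def ln_div ln_mult ln_realpow power_one_over)
  moreover have "ln (2::real) \<le> 1" using ln_le_minus_one[of "2::real"] by simp
  moreover have "real n * ln 4 \<le> real n * 3" using ln_4_le by (intro mult_left_mono) auto
  ultimately have "1 - ln r \<le> 4 * real (Suc n)" by simp
  moreover have "0 < 1 - ln r" using ln_min_1_less[of r] r by (simp add: min_def)
  ultimately have "1024 / (4 * real (Suc n)) \<le> 1024 / (1 - ln r)" by (intro divide_left_mono) auto
  also have "\<dots> = weight r" using r by (auto simp: weight_def min_def)
  also have "\<dots> \<le> weight s" using assms by (intro weight_mono) (simp add: r_def)
  finally have "1024 / (4 * real (Suc n)) \<le> weight s" .
  moreover have "64 / real (Suc n) \<le> 1024 / (4 * real (Suc n))" by (simp add: field_simps)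
  ultimately show ?thesis by linarith
qed

text \<open>The sum of \<open>c m * max 0 (p - m) ^ k\<close> over all \<open>m\<close>, of which only the terms with \<open>m < p\<close> are
different from zero if \<open>k > 0\<close>. Coefficients of arbitrary size are allowed, so the sum can outgrow
any given sequence.\<close>

definition pos_part_sum :: "(nat \<Rightarrow> real) \<Rightarrow> nat \<Rightarrow> real \<Rightarrow> real" where
  "pos_part_sum c k p = (\<Sum>m<nat \<lceil>p\<rceil>. c m * max 0 (p - real m) ^ k)"

text \<open>With a fixed upper limit \<open>N\<close> the sum can be differentiated on \<open>p < N\<close>.\<close>

lemma pos_part_sum_eq:
  assumes "0 < k" "p \<le> real N"
  shows "pos_part_sum c k p = (\<Sum>m<N. c m * max 0 (p - real m) ^ k)"
  unfolding pos_part_sum_def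
proof (rule sum.mono_neutral_left)
  show "{..<nat \<lceil>p\<rceil>} \<subseteq> {..<N}" using assms(2) by (auto simp: nat_less_iff less_ceiling_iff)
  show "\<forall>m\<in>{..<N} - {..<nat \<lceil>p\<rceil>}. c m * max 0 (p - real m) ^ k = 0"
  proof
    fix m assume "m \<in> {..<N} - {..<nat \<lceil>p\<rceil>}"
    then have "p \<le> real m" by (simp add: not_less ceiling_le_iff)
    then show "c m * max 0 (p - real m) ^ k = 0" using assms(1) by (simp add: max_def)
  qed
qed simp

lemma pos_part_sum_nonneg: "(\<And>m. 0 \<le> c m) \<Longrightarrow> 0 \<le> pos_part_sum c k p"
  unfolding pos_part_sum_def by (intro sum_nonneg mult_nonneg_nonneg) auto

lemma pos_part_sum_DERIV:
  "(pos_part_sum c (Suc (Suc k)) has_real_derivative real (Suc (Suc k)) * pos_part_sum c (Suc k) p) (at p)"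
proof -
  obtain N where N: "p < real N" using reals_Archimedean2 by blast
  have "((\<lambda>p. \<Sum>m<N. c m * max 0 (p - real m) ^ Suc (Suc k)) has_real_derivative
      (\<Sum>m<N. c m * (real (Suc (Suc k)) * max 0 (p - real m) ^ Suc k))) (at p)"
  proof (intro DERIV_sum DERIV_cmult)
    fix m
    have "((\<lambda>p. p - real m) has_real_derivative 1) (at p)" by (auto intro!: derivative_eq_intros)
    from DERIV_chain2[OF DERIV_pos_part_power this]
    show "((\<lambda>p. max 0 (p - real m) ^ Suc (Suc k)) has_real_derivative
      real (Suc (Suc k)) * max 0 (p - real m) ^ Suc k) (at p)" by simp
  qed
  also have "(\<Sum>m<N. c m * (real (Suc (Suc k)) * max 0 (p - real m) ^ Suc k))
      = real (Suc (Suc k)) * pos_part_sum c (Suc k) p"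
    using N by (subst pos_part_sum_eq[of _ _ N]) (auto simp: sum_distrib_left algebra_simps)
  finally show ?thesis
    by (rule has_field_derivative_transform_within_open[where S="{..<real N}"])
      (use N in \<open>auto simp: pos_part_sum_eq[of _ _ N]\<close>)
qed

definition growth :: "(nat \<Rightarrow> real) \<Rightarrow> real \<Rightarrow> real" where
  "growth c p = 1 + p\<^sup>2 + pos_part_sum c 3 p"

lemma growth_DERIV:
  "(growth c has_real_derivative 2 * p + 3 * pos_part_sum c 2 p) (at p)"
  "((\<lambda>p. 2 * p + 3 * pos_part_sum c 2 p) has_real_derivative 2 + 6 * pos_part_sum c 1 p) (at p)"
  unfolding growth_def[abs_def]
  using pos_part_sum_DERIV[of c 1 p] pos_part_sum_DERIV[of c 0 p]
  by (auto intro!: derivative_eq_intros simp: numeral_2_eq_2 numeral_3_eq_3)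

lemma continuous_growth: "continuous_on S (growth c)"
  by (meson growth_DERIV(1) DERIV_isCont continuous_at_imp_continuous_on)

lemma growth_nonneg: "(\<And>m. 0 \<le> c m) \<Longrightarrow> 0 \<le> growth c p"
  by (simp add: growth_def pos_part_sum_nonneg)

lemma growth_ge_square: "(\<And>m. 0 \<le> c m) \<Longrightarrow> 1 + p\<^sup>2 \<le> growth c p"
  by (simp add: growth_def pos_part_sum_nonneg)

text \<open>The coefficient \<open>c k\<close> makes the growth function steep beyond \<open>k + 1\<close>. Affine lower bounds suffice
for all estimates of the penalty, because the integral of a weak derivative is known exactly.\<close>

lemma growth_ge_linear:
  assumes c: "\<And>m. 0 \<le> c m"
  shows "c k * (p - real (Suc k)) \<le> growth c p"
proof -
  obtain N where N: "max p (real (Suc k)) < real N" using reals_Archimedean2 by blast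
  have x: "x - 1 \<le> max 0 x ^ 3" for x :: real
  proof (cases "1 \<le> x")
    case True
    then have "x ^ 1 \<le> x ^ 3" by (intro power_increasing) auto
    then show ?thesis using True by simp
  qed (smt (verit) zero_le_power max.cobounded1)
  have "c k * (p - real (Suc k)) \<le> c k * max 0 (p - real k) ^ 3"
    using x[of "p - real k"] c[of k] by (intro mult_left_mono) auto
  also have "\<dots> \<le> (\<Sum>m<N. c m * max 0 (p - real m) ^ 3)"
    using N c by (intro member_le_sum) auto
  also have "\<dots> = pos_part_sum c 3 p" using N by (subst pos_part_sum_eq[of _ _ N]) auto
  also have "\<dots> \<le> growth c p" by (simp add: growth_def)
  finally show ?thesis .
qed

section \<open>The Lagrangian and lower bounds for its penalty term\<close>

definition lagrangian :: "(nat \<Rightarrow> real) \<Rightarrow> real \<Rightarrow> real \<Rightarrow> real \<Rightarrow> real" where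
  "lagrangian c t y p = p\<^sup>2 + weight \<bar>y - curve t\<bar> * growth c p"

lemma lagrangian_ge_square: "(\<And>m. 0 \<le> c m) \<Longrightarrow> p\<^sup>2 \<le> lagrangian c t y p"
  by (simp add: lagrangian_def weight_nonneg growth_nonneg)

lemma continuous_lagrangian_lagrangian:
  assumes c: "\<And>m. 0 \<le> c m"
  shows "continuous_lagrangian 1 (lagrangian c)"
  unfolding continuous_lagrangian_def
proof (intro conjI ballI allI)
  show "continuous_on ({0..1} \<times> UNIV \<times> UNIV) (\<lambda>(t, y, p). lagrangian c t y p)"
    unfolding lagrangian_def case_prod_beta
    by (intro continuous_intros continuous_on_compose2[OF continuous_weight[of UNIV]]
        continuous_on_compose2[OF continuous_growth[of UNIV]] continuous_on_compose2[OF continuous_curve]) auto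
  show "0 \<le> lagrangian c t y p" for t y p
    using lagrangian_ge_square[of c p t y, OF c] zero_le_power2[of p] by linarith
qed

lemma superlinear_lagrangian:
  assumes c: "\<And>m. 0 \<le> c m"
  shows "superlinear 1 (lagrangian c)"
  unfolding superlinear_def
proof (intro exI[of _ "\<lambda>p. p\<^sup>2"] conjI ballI allI)
  have "\<bar>p\<bar>\<^sup>2 / \<bar>p\<bar> = norm p" for p :: real
    by (cases "p = 0") (simp_all add: power2_eq_square abs_if)
  then show "filterlim (\<lambda>p::real. \<bar>p\<bar>\<^sup>2 / \<bar>p\<bar>) at_top at_infinity"
    by (simp only: filterlim_norm_at_top)
  show "\<bar>p\<bar>\<^sup>2 \<le> lagrangian c t y p" for t y p using lagrangian_ge_square[of c p t y, OF c] by simp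
qed

lemma L_pp_lagrangian:
  assumes c: "\<And>m. 0 \<le> c m"
  shows "L_pp_ge 1 (lagrangian c) 2"
  unfolding L_pp_ge_def
proof (intro ballI allI)
  fix t y p :: real
  define w where "w = weight \<bar>y - curve t\<bar>"
  have L: "lagrangian c t y = (\<lambda>p. p\<^sup>2 + w * growth c p)" by (auto simp: lagrangian_def w_def)
  have 1: "(lagrangian c t y has_real_derivative 2 * p + w * (2 * p + 3 * pos_part_sum c 2 p)) (at p)" for p
    unfolding L
    by (rule DERIV_add[OF _ DERIV_cmult[OF growth_DERIV(1)]]) (auto intro!: derivative_eq_intros)
  then have d: "deriv (lagrangian c t y) = (\<lambda>p. 2 * p + w * (2 * p + 3 * pos_part_sum c 2 p))"
    by (auto intro: DERIV_imp_deriv)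
  have 2: "(deriv (lagrangian c t y) has_real_derivative 2 + w * (2 + 6 * pos_part_sum c 1 p)) (at p)"
    unfolding d
    by (rule DERIV_add[OF _ DERIV_cmult[OF growth_DERIV(2)]]) (auto intro!: derivative_eq_intros)
  have "0 \<le> w * (2 + 6 * pos_part_sum c 1 p)"
    unfolding w_def by (intro mult_nonneg_nonneg weight_nonneg add_nonneg_nonneg pos_part_sum_nonneg c) auto
  then show "lagrangian c t y differentiable at p \<and> deriv (lagrangian c t y) differentiable at p \<and>
      2 \<le> deriv (deriv (lagrangian c t y)) p"
    using 1[of p] 2 DERIV_imp_deriv[OF 2] by (auto simp: real_differentiable_def)
qed

text \<open>The part of the energy of \<open>v\<close> that vanishes for \<open>v = curve\<close>, with \<open>g\<close> in the role of the weak derivative of \<open>v\<close>.\<close>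

definition penalty :: "(nat \<Rightarrow> real) \<Rightarrow> (real \<Rightarrow> real) \<Rightarrow> (real \<Rightarrow> real) \<Rightarrow> ennreal" where
  "penalty c v g = (\<integral>\<^sup>+t. ennreal (weight \<bar>v t - curve t\<bar> * growth c (g t)) \<partial>unit_measure)"

text \<open>What the lower bounds need to know about \<open>v\<close>. Both admissible functions and Lipschitz
perturbations of \<open>curve\<close> have these properties.\<close>

definition competitor :: "(real \<Rightarrow> real) \<Rightarrow> (real \<Rightarrow> real) \<Rightarrow> bool" where
  "competitor v g \<longleftrightarrow> continuous_on {0..1} v \<and> integrable unit_measure g \<and> has_weak_derivative 1 v g"

lemma competitor_FTC:
  "competitor v g \<Longrightarrow> 0 \<le> a \<Longrightarrow> a \<le> b \<Longrightarrow> b \<le> 1 \<Longrightarrow> integral {a..b} g = v b - v a"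
  using weak_derivative_FTC[of 1 v g a b] by (simp add: competitor_def)

lemma competitor_measurable:
  assumes "competitor v g"
  shows "g \<in> borel_measurable unit_measure"
    "(\<lambda>t. weight \<bar>v t - curve t\<bar>) \<in> borel_measurable unit_measure"
    "(\<lambda>t. growth c (g t)) \<in> borel_measurable unit_measure"
proof -
  show g: "g \<in> borel_measurable unit_measure" using assms by (auto simp: competitor_def)
  have "continuous_on {0..1} (\<lambda>t. weight \<bar>v t - curve t\<bar>)"
    using assms by (intro continuous_on_compose2[OF continuous_weight[of UNIV]] continuous_intros continuous_curve)
      (auto simp: competitor_def)
  then show "(\<lambda>t. weight \<bar>v t - curve t\<bar>) \<in> borel_measurable unit_measure"
    using continuous_imp_integrable_real by blast
  have "growth c \<in> borel_measurable borel" by (intro borel_measurable_continuous_onI continuous_growth)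
  from measurable_compose[OF g this]
  show "(\<lambda>t. growth c (g t)) \<in> borel_measurable unit_measure" .
qed

lemma functional_eq:
  assumes "competitor v (weak_deriv 1 v)" and c: "\<And>m. 0 \<le> c m"
  shows "functional (lagrangian c) 1 v
    = (\<integral>\<^sup>+t. ennreal ((weak_deriv 1 v t)\<^sup>2) \<partial>unit_measure) + penalty c v (weak_deriv 1 v)"
proof -
  note [measurable] = competitor_measurable[OF assms(1)]
  have nn: "0 \<le> weight s * growth c p" for s p
    by (intro mult_nonneg_nonneg weight_nonneg growth_nonneg c)
  have "functional (lagrangian c) 1 v = (\<integral>\<^sup>+t. ennreal ((weak_deriv 1 v t)\<^sup>2)
      + ennreal (weight \<bar>v t - curve t\<bar> * growth c (weak_deriv 1 v t)) \<partial>unit_measure)"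
    unfolding functional_def lagrangian_def using nn
    by (intro nn_integral_cong) (simp add: ennreal_plus)
  then show ?thesis unfolding penalty_def by (subst (asm) nn_integral_add) auto
qed

text \<open>A substitute for Jensen's inequality: a lower bound that is affine in the derivative can be
integrated by the fundamental theorem of calculus.\<close>

lemma affine_lower_bound:
  fixes g \<Phi> :: "real \<Rightarrow> real"
  assumes g: "integrable unit_measure g" and ab: "0 \<le> a" "a \<le> b" "b \<le> 1"
    and le: "\<And>t. t \<in> {a..b} \<Longrightarrow> \<alpha> * g t + \<beta> \<le> \<Phi> t"
  shows "ennreal (\<alpha> * integral {a..b} g + \<beta> * (b - a)) \<le> (\<integral>\<^sup>+t. ennreal (\<Phi> t) \<partial>unit_measure)"
proof -
  let ?k = "\<lambda>t. indicator {a..b} t * (\<alpha> * g t + \<beta>)"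
  have "integrable unit_measure (\<lambda>_. \<beta>)" by (intro continuous_imp_integrable_real) simp
  note g' = Bochner_Integration.integrable_add[OF integrable_mult_right[OF g, of \<alpha>] this]
  note k = integral_lebesgue_on_indicator[OF g' ab(1,3)]
  have km: "integrable unit_measure (\<lambda>t. max 0 (?k t))"
    using k(1) by (intro integrable_max) auto
  have "\<alpha> * integral {a..b} g + \<beta> * (b - a) = integral {a..b} (\<lambda>t. \<alpha> * g t + \<beta>)"
    using integral_lebesgue_on_indicator(3)[OF g ab(1,3)] ab
    by (subst Henstock_Kurzweil_Integration.integral_add) (auto intro: integrable_on_mult_right)
  also have "\<dots> = (\<integral>t. ?k t \<partial>unit_measure)" using k(2) by simp
  also have "\<dots> \<le> (\<integral>t. max 0 (?k t) \<partial>unit_measure)" by (intro integral_mono k(1) km) auto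
  finally have "ennreal (\<alpha> * integral {a..b} g + \<beta> * (b - a)) \<le> ennreal (\<integral>t. max 0 (?k t) \<partial>unit_measure)"
    by (rule ennreal_leI)
  also have "\<dots> = (\<integral>\<^sup>+t. ennreal (max 0 (?k t)) \<partial>unit_measure)"
    by (rule nn_integral_eq_integral[OF km AE_I2[OF max.cobounded1], symmetric])
  also have "\<dots> \<le> (\<integral>\<^sup>+t. ennreal (\<Phi> t) \<partial>unit_measure)"
  proof (rule nn_integral_mono)
    fix t
    show "ennreal (max 0 (?k t)) \<le> ennreal (\<Phi> t)"
      using le[of t] by (cases "t \<in> {a..b}") (simp_all add: ennreal_max_0 ennreal_leI)
  qed
  finally show ?thesis .
qed

text \<open>The witness is the last time at which the level \<open>s\<close> is attained.\<close>

lemma last_exit: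
  fixes \<phi> :: "real \<Rightarrow> real"
  assumes cont: "continuous_on {x..y} \<phi>" and "x \<le> y" "\<phi> x \<le> s" "s \<le> \<phi> y"
  obtains a where "a \<in> {x..y}" "\<phi> a = s" "\<And>t. t \<in> {a..y} \<Longrightarrow> s \<le> \<phi> t"
proof -
  define S where "S = {t \<in> {x..y}. \<phi> t = s}"
  have "\<exists>t\<ge>x. t \<le> y \<and> \<phi> t = s" using IVT'[of \<phi> x s y] assms by auto
  then have "S \<noteq> {}" by (auto simp: S_def)
  moreover have "compact S"
    unfolding S_def using continuous_closed_preimage_constant[OF cont]
    by (intro compact_Int_closed[of "{x..y}", THEN compact_eq_bounded_closed[THEN iffD1]] | simp add: compact_eq_bounded_closed bounded_subset[of "{x..y}"] subset_eq)+
  ultimately obtain a where a: "a \<in> S" "\<And>t. t \<in> S \<Longrightarrow> t \<le> a" using compact_attains_sup[of S] by blast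
  show thesis
  proof (rule that)
    show "a \<in> {x..y}" "\<phi> a = s" using a by (auto simp: S_def)
    fix t assume t: "t \<in> {a..y}"
    show "s \<le> \<phi> t"
    proof (rule ccontr)
      assume neg: "\<not> s \<le> \<phi> t"
      then have "\<exists>r\<ge>t. r \<le> y \<and> \<phi> r = s"
        using t a(1) assms by (intro IVT' continuous_on_subset[OF cont]) (auto simp: S_def)
      then obtain r where "t \<le> r" "r \<le> y" "\<phi> r = s" by blast
      then have "r \<in> S" "r \<noteq> t" using t a(1) neg by (auto simp: S_def)
      then show False using a(2)[of r] t \<open>t \<le> r\<close> by auto
    qed
  qed
qed

text \<open>Between the last time \<open>a\<close> at which the deviation equals \<open>\<eta> / 2\<close> and the time \<open>t1\<close>, the weight is
at least \<open>weight (\<eta> / 2)\<close> and the deviation changes by at least \<open>\<eta> / 2\<close>. Since \<open>curve\<close>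
increases by at most \<open>m (t1 - a)\<close> plus a small tail, either \<open>v\<close> moves a lot or much time passes.
Both are paid for, because \<open>growth p\<close> dominates \<open>\<bar>p\<bar>\<close> as well as \<open>1\<close>.\<close>

lemma penalty_ge_of_deviation:
  assumes comp: "competitor v g" and c: "\<And>m. 0 \<le> c m" and v0: "v 0 = curve 0"
    and t1: "t1 \<in> {0..1}" and \<eta>: "0 < \<eta>" "\<eta> \<le> \<bar>v t1 - curve t1\<bar>"
  shows "ennreal (weight (\<eta> / 2) * (\<eta> / 2 - (1/4) ^ m / real (Suc m)) / real (Suc m)) \<le> penalty c v g"
proof -
  define u where "u t = v t - curve t" for t
  have "continuous_on {0..1} (\<lambda>t. \<bar>u t\<bar>)" unfolding u_def
    using comp by (intro continuous_intros continuous_curve) (simp add: competitor_def)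
  then have "continuous_on {0..t1} (\<lambda>t. \<bar>u t\<bar>)" using t1 by (auto elim: continuous_on_subset)
  then obtain a where a: "a \<in> {0..t1}" "\<bar>u a\<bar> = \<eta> / 2" "\<And>t. t \<in> {a..t1} \<Longrightarrow> \<eta> / 2 \<le> \<bar>u t\<bar>"
    by (rule last_exit[of 0 t1 _ "\<eta> / 2"]) (use t1 \<eta> v0 in \<open>auto simp: u_def\<close>)
  \<comment> \<open>the sign of the change of the deviation, so that one argument covers both directions\<close>
  define \<sigma> where "\<sigma> = sgn (u t1 - u a)"
  have \<sigma>: "\<sigma> * (u t1 - u a) = \<bar>u t1 - u a\<bar>" "\<bar>\<sigma>\<bar> \<le> 1" by (auto simp: \<sigma>_def sgn_if)
  have jump: "\<eta> / 2 \<le> \<bar>u t1 - u a\<bar>" using a(2) \<eta>(2) unfolding u_def[symmetric] by linarith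
  define w where "w = weight (\<eta> / 2)"
  have w: "0 \<le> w" by (simp add: w_def weight_nonneg)
  have "ennreal ((w * \<sigma> / real (Suc m)) * integral {a..t1} g + (w * real m / real (Suc m)) * (t1 - a)) \<le> penalty c v g"
    unfolding penalty_def
  proof (rule affine_lower_bound)
    show "integrable unit_measure g" using comp by (simp add: competitor_def)
    fix t assume t: "t \<in> {a..t1}"
    \<comment> \<open>\<open>(m + 1) (1 + p\<^sup>2) \<ge> \<bar>p\<bar> + m\<close>\<close>
    have "\<sigma> * g t \<le> \<bar>g t\<bar>" 
      using abs_ge_self[of "\<sigma> * g t"] mult_right_mono[OF \<sigma>(2), of "\<bar>g t\<bar>"] by (simp add: abs_mult)
    also have "\<dots> \<le> 1 + (g t)\<^sup>2"
      using zero_le_power2[of "\<bar>g t\<bar> - 1"] zero_le_power2[of "g t"] by (simp add: power2_eq_square algebra_simps)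
    finally have "\<sigma> * g t + real m \<le> (1 + (g t)\<^sup>2) + real m * (1 + (g t)\<^sup>2)"
      by (intro add_mono) (auto simp: mult_le_cancel_left1)
    also have "\<dots> = real (Suc m) * (1 + (g t)\<^sup>2)" by (simp add: algebra_simps)
    also have "\<dots> \<le> real (Suc m) * growth c (g t)" by (intro mult_left_mono growth_ge_square c) simp
    finally have "(\<sigma> * g t + real m) / real (Suc m) \<le> growth c (g t)" by (simp add: divide_le_eq mult.commute)
    then have "w * ((\<sigma> * g t + real m) / real (Suc m)) \<le> weight \<bar>v t - curve t\<bar> * growth c (g t)"
      using a(3)[OF t] growth_nonneg[of c "g t", OF c]
      unfolding w_def u_def by (intro order_trans[OF mult_left_mono mult_right_mono] weight_mono weight_nonneg) auto
    moreover have "w * ((\<sigma> * g t + real m) / real (Suc m)) = w * \<sigma> / real (Suc m) * g t + w * real m / real (Suc m)"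
      by (simp add: add_divide_distrib distrib_left mult.assoc)
    ultimately show "w * \<sigma> / real (Suc m) * g t + w * real m / real (Suc m) \<le> weight \<bar>v t - curve t\<bar> * growth c (g t)"
      by simp
  qed (use a t1 in auto)
  moreover have "w * (\<eta> / 2 - (1/4) ^ m / real (Suc m)) / real (Suc m)
      \<le> (w * \<sigma> / real (Suc m)) * integral {a..t1} g + (w * real m / real (Suc m)) * (t1 - a)"
  proof -
    have at: "0 \<le> a" "a \<le> t1" "t1 \<le> 1" using a t1 by auto
    have "integral {a..t1} g = (u t1 - u a) + (curve t1 - curve a)"
      using competitor_FTC[OF comp at] by (simp add: u_def)
    then have "\<sigma> * integral {a..t1} g = \<bar>u t1 - u a\<bar> + \<sigma> * (curve t1 - curve a)"
      using \<sigma>(1) by (simp add: distrib_left)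
    moreover have "- (curve t1 - curve a) \<le> \<sigma> * (curve t1 - curve a)"
      using curve_mono[OF at] \<sigma>(2) mult_right_mono[of "-1" \<sigma> "curve t1 - curve a"] by (simp add: abs_le_iff)
    ultimately have "\<eta> / 2 - (1/4) ^ m / real (Suc m) \<le> \<sigma> * integral {a..t1} g + real m * (t1 - a)"
      using jump curve_diff_le[OF at, of m] by linarith
    then have "w * (\<eta> / 2 - (1/4) ^ m / real (Suc m)) / real (Suc m)
        \<le> w * (\<sigma> * integral {a..t1} g + real m * (t1 - a)) / real (Suc m)"
      using w by (intro divide_right_mono mult_left_mono) auto
    then show ?thesis by (simp add: distrib_left add_divide_distrib mult.assoc)
  qed
  ultimately show ?thesis unfolding w_def by (meson ennreal_leI order_trans)
qed

section \<open>Minimality\<close>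

text \<open>With \<open>F = slope_upto n\<close>, the difference of the two squares is
\<open>(g - F)\<^sup>2 - (slope - F)\<^sup>2 + 2 F (g - slope)\<close>. The first term is nonnegative, the second one is the
tail, and since \<open>F\<close> is a test function the third one has the integral of \<open>- 2 F' (v - curve)\<close>.\<close>

lemma integral_square_comparison:
  assumes comp: "competitor v g" and g2: "integrable unit_measure (\<lambda>t. (g t)\<^sup>2)"
  shows "(\<integral>t. (slope t)\<^sup>2 \<partial>unit_measure) \<le> (\<integral>t. (g t)\<^sup>2 \<partial>unit_measure)
    + 2 * (\<integral>t. \<bar>slope_upto' n t\<bar> * \<bar>v t - curve t\<bar> \<partial>unit_measure) + 2 * (1/4) ^ n / real (Suc n) ^ 2"
proof -
  let ?M = unit_measure
  have v: "continuous_on {0..1} v" and g: "integrable ?M g" and wd: "has_weak_derivative 1 v g"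
    using comp by (auto simp: competitor_def)
  have F_int: "integrable ?M (\<lambda>t. k t * slope_upto n t)" if "integrable ?M k" for k
  proof (rule Bochner_Integration.integrable_bound)
    show "integrable ?M (\<lambda>t. real n * k t)" using that by simp
    have [measurable]: "slope_upto n \<in> borel_measurable ?M" by (intro borel_measurable_lebesgue_onI) simp
    show "(\<lambda>t. k t * slope_upto n t) \<in> borel_measurable ?M" using that by measurable
    show "AE t in ?M. norm (k t * slope_upto n t) \<le> norm (real n * k t)"
      using slope_upto_le[of n] slope_upto_nonneg[of n]
      by (intro AE_I2) (auto simp: abs_mult mult.commute[of "real n"] intro: mult_left_mono)
  qed
  have F2: "integrable ?M (\<lambda>t. (slope_upto n t)\<^sup>2)"
    by (intro continuous_imp_integrable_real continuous_intros continuous_slope_upto)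
  have gF2: "integrable ?M (\<lambda>t. (g t - slope_upto n t)\<^sup>2)"
    unfolding power2_diff using g2 F2 F_int[OF g]
    by (intro Bochner_Integration.integrable_add Bochner_Integration.integrable_diff) (auto simp: mult.assoc)
  obtain a b where ab: "0 < a" "b < 1" "\<And>t. t \<notin> {a..b} \<Longrightarrow> slope_upto n t = 0"
    using slope_upto_support[of n] by blast
  have weak: "(\<integral>t. k t * slope_upto n t \<partial>?M) = - (\<integral>t. z t * slope_upto' n t \<partial>?M)"
    if "has_weak_derivative 1 z k" for z k
    using has_weak_derivativeD[OF that slope_upto_DERIV continuous_slope_upto' ab(3,1,2)] by simp
  have zF: "integrable ?M (\<lambda>t. z t * slope_upto' n t)" if "continuous_on {0..1} z" for z
    by (intro continuous_imp_integrable_real continuous_intros continuous_slope_upto' that)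
  have uF: "integrable ?M (\<lambda>t. \<bar>slope_upto' n t\<bar> * \<bar>v t - curve t\<bar>)"
    by (intro continuous_imp_integrable_real continuous_intros continuous_slope_upto' v continuous_curve)
  have "(\<integral>t. g t * slope_upto n t \<partial>?M) - (\<integral>t. slope t * slope_upto n t \<partial>?M)
      = - (\<integral>t. (v t - curve t) * slope_upto' n t \<partial>?M)"
    unfolding weak[OF wd] weak[OF curve_has_weak_derivative]
    using zF[OF v] zF[OF continuous_curve] by (simp add: left_diff_distrib)
  also have "\<dots> \<ge> - (\<integral>t. \<bar>slope_upto' n t\<bar> * \<bar>v t - curve t\<bar> \<partial>?M)"
  proof -
    have "(\<integral>t. (v t - curve t) * slope_upto' n t \<partial>?M) \<le> (\<integral>t. \<bar>slope_upto' n t\<bar> * \<bar>v t - curve t\<bar> \<partial>?M)"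
    proof (rule integral_mono[OF _ uF])
      show "integrable ?M (\<lambda>t. (v t - curve t) * slope_upto' n t)"
        by (rule zF) (intro continuous_intros v continuous_curve)
      fix t show "(v t - curve t) * slope_upto' n t \<le> \<bar>slope_upto' n t\<bar> * \<bar>v t - curve t\<bar>"
        by (metis abs_ge_self abs_mult mult.commute)
    qed
    then show ?thesis by simp
  qed
  finally have cross: "- (\<integral>t. \<bar>slope_upto' n t\<bar> * \<bar>v t - curve t\<bar> \<partial>?M)
    \<le> (\<integral>t. g t * slope_upto n t \<partial>?M) - (\<integral>t. slope t * slope_upto n t \<partial>?M)" .
  have "(\<integral>t. (g t)\<^sup>2 \<partial>?M) - (\<integral>t. (slope t)\<^sup>2 \<partial>?M)
      = (\<integral>t. (g t - slope_upto n t)\<^sup>2 \<partial>?M) - (\<integral>t. (slope t - slope_upto n t)\<^sup>2 \<partial>?M)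
        + 2 * ((\<integral>t. g t * slope_upto n t \<partial>?M) - (\<integral>t. slope t * slope_upto n t \<partial>?M))"
  proof -
    have sq: "(\<integral>t. (k t - slope_upto n t)\<^sup>2 \<partial>?M)
        = (\<integral>t. (k t)\<^sup>2 \<partial>?M) + (\<integral>t. (slope_upto n t)\<^sup>2 \<partial>?M) - 2 * (\<integral>t. k t * slope_upto n t \<partial>?M)"
      if "integrable ?M k" "integrable ?M (\<lambda>t. (k t)\<^sup>2)" for k
    proof -
      have "(\<integral>t. (k t - slope_upto n t)\<^sup>2 \<partial>?M)
          = (\<integral>t. ((k t)\<^sup>2 + (slope_upto n t)\<^sup>2) - 2 * (k t * slope_upto n t) \<partial>?M)"
        by (simp add: power2_diff mult.assoc)
      also have "\<dots> = (\<integral>t. (k t)\<^sup>2 + (slope_upto n t)\<^sup>2 \<partial>?M) - (\<integral>t. 2 * (k t * slope_upto n t) \<partial>?M)"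
        by (rule Bochner_Integration.integral_diff) (use that F2 F_int in auto)
      also have "(\<integral>t. (k t)\<^sup>2 + (slope_upto n t)\<^sup>2 \<partial>?M) = (\<integral>t. (k t)\<^sup>2 \<partial>?M) + (\<integral>t. (slope_upto n t)\<^sup>2 \<partial>?M)"
        by (rule Bochner_Integration.integral_add) (use that F2 in auto)
      finally show ?thesis by simp
    qed
    show ?thesis unfolding sq[OF g g2] sq[OF integrable_slope] by simp
  qed
  moreover have "0 \<le> (\<integral>t. (g t - slope_upto n t)\<^sup>2 \<partial>?M)" by (intro integral_nonneg_AE) simp
  moreover define \<tau> where "\<tau> = 2 * (1/4) ^ n / real (Suc n) ^ 2"
  ultimately show ?thesis
    using cross integral_slope_tail_square_le[of n, folded \<tau>_def] unfolding \<tau>_def[symmetric] by argo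
qed

lemma competitor_curve: "competitor curve (weak_deriv 1 curve)"
  using weak_derivI[OF slope_Lebesgue_space(1) curve_has_weak_derivative] continuous_curve
  by (simp add: competitor_def)

lemma functional_curve:
  assumes c: "\<And>m. 0 \<le> c m"
  shows "functional (lagrangian c) 1 curve = ennreal (\<integral>t. (slope t)\<^sup>2 \<partial>unit_measure)"
proof -
  have "functional (lagrangian c) 1 curve = (\<integral>\<^sup>+t. ennreal ((weak_deriv 1 curve t)\<^sup>2) \<partial>unit_measure)"
    unfolding functional_eq[OF competitor_curve c] by (simp add: penalty_def)
  also have "\<dots> = (\<integral>\<^sup>+t. ennreal ((slope t)\<^sup>2) \<partial>unit_measure)"
    by (rule nn_integral_cong_AE, use weak_deriv_curve in eventually_elim) simp
  also have "\<dots> = ennreal (\<integral>t. (slope t)\<^sup>2 \<partial>unit_measure)"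
    by (rule nn_integral_eq_integral[OF integrable_slope(2) AE_I2[OF zero_le_power2]])
  finally show ?thesis .
qed

text \<open>If the deviation \<open>s\<close> is at most of the order \<open>4\<^sup>-\<^sup>n\<close>, the weight controls the first error
term of \<open>integral_square_comparison\<close> pointwise. For \<open>n = 0\<close> there is no such error.\<close>

lemma linear_term_dominated:
  assumes n: "n = 0 \<or> s \<le> 4 * (1/4) ^ n" and s: "0 \<le> s"
  shows "4 * (\<bar>slope_upto' n t\<bar> * s) \<le> weight s"
proof (cases "n = 0")
  case True
  then show ?thesis by (simp add: slope_upto'_def weight_nonneg)
next
  case False
  have "4 * (\<bar>slope_upto' n t\<bar> * s) \<le> 4 * (16 * 4 ^ n / real (Suc n) * s)"
    using s by (intro mult_left_mono mult_right_mono abs_slope_upto'_le) auto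
  also have "\<dots> = 64 * 4 ^ n / real (Suc n) * s" by simp
  also have "\<dots> \<le> weight s" using weight_ge_linear[of n s] n s False by simp
  finally show ?thesis .
qed

text \<open>If the deviation exceeds \<open>4\<^sup>-\<^sup>n\<close> somewhere, the penalty controls the second error term. The factor \<open>8\<close>
leaves a quarter of the penalty to spare.\<close>

lemma tail_dominated:
  assumes comp: "competitor v g" and c: "\<And>m. 0 \<le> c m" and v0: "v 0 = curve 0"
    and t1: "t1 \<in> {0..1}" and dev: "(1/4) ^ n < \<bar>v t1 - curve t1\<bar>"
  shows "ennreal (8 * (1/4) ^ n / real (Suc n) ^ 2) \<le> penalty c v g"
proof -
  define \<eta> where "\<eta> = \<bar>v t1 - curve t1\<bar>"
  define x :: real where "x = (1/4) ^ n"
  have x: "0 < x" by (simp add: x_def)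
  have \<eta>: "x < \<eta>" using dev by (simp add: x_def \<eta>_def)
  have w: "64 / real (Suc n) \<le> weight (\<eta> / 2)"
    using \<eta> by (intro weight_ge_const) (simp add: x_def)
  have tl: "(1/4) ^ Suc n / real (Suc (Suc n)) \<le> x / 4"
  proof -
    have "(1/4) ^ Suc n / real (Suc (Suc n)) \<le> (1/4 :: real) ^ Suc n / 1" by (intro divide_left_mono) auto
    then show ?thesis by (simp add: x_def)
  qed
  have "8 * x / N\<^sup>2 = 64 / N * (x / 4) / (2 * N)" for N :: real
    by (simp add: power2_eq_square)
  then have "8 * x / real (Suc n) ^ 2 = 64 / real (Suc n) * (x / 4) / (2 * real (Suc n))" .
  also have "\<dots> \<le> 64 / real (Suc n) * (x / 4) / real (Suc (Suc n))"
    using x by (intro divide_left_mono mult_nonneg_nonneg) auto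
  also have "\<dots> \<le> weight (\<eta> / 2) * (\<eta> / 2 - (1/4) ^ Suc n / real (Suc (Suc n))) / real (Suc (Suc n))"
    using w tl \<eta> x by (intro divide_right_mono mult_mono weight_nonneg) auto
  finally have "ennreal (8 * x / real (Suc n) ^ 2)
      \<le> ennreal (weight (\<eta> / 2) * (\<eta> / 2 - (1/4) ^ Suc n / real (Suc (Suc n))) / real (Suc (Suc n)))"
    by (rule ennreal_leI)
  also have "\<dots> \<le> penalty c v g"
    using \<eta> x by (intro penalty_ge_of_deviation[OF comp c v0 t1]) (auto simp: \<eta>_def)
  finally show ?thesis by (simp add: x_def)
qed

text \<open>The index \<open>n\<close> is chosen as the first one for which \<open>4\<^sup>-\<^sup>n\<close> is below the maximal deviation, so that
both \<open>linear_term_dominated\<close> and \<open>tail_dominated\<close> apply.\<close>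

lemma functional_gap:
  assumes comp: "competitor v (weak_deriv 1 v)" and c: "\<And>m. 0 \<le> c m" and v0: "v 0 = curve 0"
  shows "functional (lagrangian c) 1 curve + penalty c v (weak_deriv 1 v) / 4 \<le> functional (lagrangian c) 1 v"
proof (cases "functional (lagrangian c) 1 v = \<infinity>")
  case False
  define g where "g = weak_deriv 1 v"
  let ?M = unit_measure
  note comp = comp[folded g_def]
  have fun_v: "functional (lagrangian c) 1 v = (\<integral>\<^sup>+t. ennreal ((g t)\<^sup>2) \<partial>?M) + penalty c v g"
    unfolding g_def by (rule functional_eq) (use comp c in \<open>auto simp: g_def\<close>)
  note [measurable] = competitor_measurable[OF comp]
  have g2: "integrable ?M (\<lambda>t. (g t)\<^sup>2)"
    using False unfolding fun_v by (intro integrableI_bounded) (auto simp: less_top)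
  have nn: "0 \<le> weight \<bar>v t - curve t\<bar> * growth c (g t)" for t
    by (intro mult_nonneg_nonneg weight_nonneg growth_nonneg c)
  have wg: "integrable ?M (\<lambda>t. weight \<bar>v t - curve t\<bar> * growth c (g t))"
    using False nn unfolding fun_v penalty_def by (intro integrableI_bounded) (auto simp: less_top)
  define P where "P = (\<integral>t. weight \<bar>v t - curve t\<bar> * growth c (g t) \<partial>?M)"
  have P: "penalty c v g = ennreal P" unfolding penalty_def P_def
    by (rule nn_integral_eq_integral[OF wg AE_I2[OF nn]])
  have P0: "0 \<le> P" unfolding P_def by (intro integral_nonneg_AE AE_I2 nn)
  have G: "(\<integral>\<^sup>+t. ennreal ((g t)\<^sup>2) \<partial>?M) = ennreal (\<integral>t. (g t)\<^sup>2 \<partial>?M)"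
    by (rule nn_integral_eq_integral[OF g2 AE_I2[OF zero_le_power2]])
  have vc: "continuous_on {0..1} v" using comp by (simp add: competitor_def)
  have "(\<integral>t. (slope t)\<^sup>2 \<partial>?M) + P / 4 \<le> (\<integral>t. (g t)\<^sup>2 \<partial>?M) + P"
  proof (cases "\<forall>t\<in>{0..1}. v t = curve t")
    case True
    have "AE t in ?M. g t = slope t"
    proof (rule AE_eq_of_interval_integrals)
      show "integrable ?M g" "integrable ?M slope" using comp integrable_slope by (auto simp: competitor_def)
      fix a b :: real assume "0 \<le> a" "a \<le> b" "b \<le> 1"
      then show "integral {a..b} g = integral {a..b} slope"
        using competitor_FTC[OF comp, of a b] curve_diff[of a b] True by simp
    qed
    then have "(\<integral>t. (g t)\<^sup>2 \<partial>?M) = (\<integral>t. (slope t)\<^sup>2 \<partial>?M)"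
      using g2 integrable_slope(2) by (intro integral_cong_AE) (auto elim: eventually_mono)
    then show ?thesis using P0 by simp
  next
    case False
    have dc: "continuous_on {0..1} (\<lambda>t. \<bar>v t - curve t\<bar>)" by (intro continuous_intros vc continuous_curve)
    then obtain t1 where t1: "t1 \<in> {0..1}" "\<And>t. t \<in> {0..1} \<Longrightarrow> \<bar>v t - curve t\<bar> \<le> \<bar>v t1 - curve t1\<bar>"
      using continuous_attains_sup[OF compact_Icc _ dc] by auto
    have pos: "0 < \<bar>v t1 - curve t1\<bar>" using False t1 by fastforce
    define n where "n = (LEAST n. (1/4) ^ n < \<bar>v t1 - curve t1\<bar>)"
    have "\<exists>n. (1/4) ^ n < \<bar>v t1 - curve t1\<bar>" using pos real_arch_pow_inv by fastforce
    then have n: "(1/4) ^ n < \<bar>v t1 - curve t1\<bar>" unfolding n_def by (rule LeastI_ex)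
    have n': "n = 0 \<or> \<bar>v t1 - curve t1\<bar> \<le> 4 * (1/4) ^ n"
    proof (cases n)
      case (Suc k)
      then have "k < (LEAST n. (1/4) ^ n < \<bar>v t1 - curve t1\<bar>)" by (simp add: n_def)
      from not_less_Least[OF this] have "\<not> (1/4) ^ k < \<bar>v t1 - curve t1\<bar>" .
      then show ?thesis using Suc by simp
    qed simp
    have uF: "integrable ?M (\<lambda>t. \<bar>slope_upto' n t\<bar> * \<bar>v t - curve t\<bar>)"
      by (intro continuous_imp_integrable_real continuous_intros continuous_slope_upto' vc continuous_curve)
    have "4 * (\<integral>t. \<bar>slope_upto' n t\<bar> * \<bar>v t - curve t\<bar> \<partial>?M) = (\<integral>t. 4 * (\<bar>slope_upto' n t\<bar> * \<bar>v t - curve t\<bar>) \<partial>?M)"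
      by simp
    also have "\<dots> \<le> P" unfolding P_def
    proof (rule integral_mono[OF _ wg])
      show "integrable ?M (\<lambda>t. 4 * (\<bar>slope_upto' n t\<bar> * \<bar>v t - curve t\<bar>))" using uF by simp
      fix t assume "t \<in> space ?M"
      then have "\<bar>v t - curve t\<bar> \<le> \<bar>v t1 - curve t1\<bar>" using t1 by simp
      then have "4 * (\<bar>slope_upto' n t\<bar> * \<bar>v t - curve t\<bar>) \<le> weight \<bar>v t - curve t\<bar>"
        using n' by (intro linear_term_dominated) auto
      also have "\<dots> \<le> weight \<bar>v t - curve t\<bar> * growth c (g t)"
      proof -
        have "1 \<le> growth c (g t)"
          using growth_ge_square[of c "g t", OF c] zero_le_power2[of "g t"] by linarith
        from mult_left_mono[OF this weight_nonneg] show ?thesis by simp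
      qed
      finally show "4 * (\<bar>slope_upto' n t\<bar> * \<bar>v t - curve t\<bar>) \<le> weight \<bar>v t - curve t\<bar> * growth c (g t)" .
    qed
    finally have 1: "4 * (\<integral>t. \<bar>slope_upto' n t\<bar> * \<bar>v t - curve t\<bar> \<partial>?M) \<le> P" .
    have 2: "8 * (1/4) ^ n / real (Suc n) ^ 2 \<le> P"
      using tail_dominated[where c=c, OF comp c v0 t1(1) n] P0 unfolding P by (simp add: ennreal_le_iff)
    define \<tau> where "\<tau> = (1/4) ^ n / real (Suc n) ^ 2"
    have "8 * \<tau> \<le> P" using 2 by (simp add: \<tau>_def)
    moreover have "(\<integral>t. (slope t)\<^sup>2 \<partial>?M) \<le> (\<integral>t. (g t)\<^sup>2 \<partial>?M)
        + 2 * (\<integral>t. \<bar>slope_upto' n t\<bar> * \<bar>v t - curve t\<bar> \<partial>?M) + 2 * \<tau>"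
      using integral_square_comparison[OF comp g2, of n] by (simp add: \<tau>_def)
    ultimately show ?thesis using 1 by argo
  qed
  then have "ennreal ((\<integral>t. (slope t)\<^sup>2 \<partial>?M) + P / 4) \<le> ennreal ((\<integral>t. (g t)\<^sup>2 \<partial>?M) + P)"
    by (rule ennreal_leI)
  moreover have "0 \<le> (\<integral>t. (slope t)\<^sup>2 \<partial>?M)" "0 \<le> (\<integral>t. (g t)\<^sup>2 \<partial>?M)" by (intro integral_nonneg_AE; simp)+
  moreover have "ennreal P / 4 = ennreal (P / 4)"
    using P0 by (simp add: divide_ennreal[symmetric])
  ultimately show ?thesis
    unfolding fun_v functional_curve[of c, OF c] g_def[symmetric] P G using P0 by (simp add: ennreal_plus)
qed simp

section \<open>Infinite energy of Lipschitz perturbations and the Lavrentiev phenomenon\<close>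

definition steep_near :: "real \<Rightarrow> real \<Rightarrow> real \<Rightarrow> bool" where
  "steep_near q \<rho> M \<longleftrightarrow> 0 < \<rho> \<and> 0 \<le> q - \<rho> \<and> q + \<rho> \<le> 1 \<and>
     (\<forall>a b. q - \<rho> \<le> a \<and> a \<le> b \<and> b \<le> q + \<rho> \<longrightarrow> M * (b - a) \<le> curve b - curve a)"

lemma steep_nearD:
  assumes "steep_near q \<rho> M"
  shows "M * ((q + \<rho>) - (q - \<rho>)) \<le> curve (q + \<rho>) - curve (q - \<rho>)"
proof -
  have "0 < \<rho>" and "\<forall>a b. q - \<rho> \<le> a \<and> a \<le> b \<and> b \<le> q + \<rho> \<longrightarrow> M * (b - a) \<le> curve b - curve a"
    using assms by (auto simp: steep_near_def)
  then show ?thesis by (metis diff_add_cancel diff_ge_0_iff_ge less_imp_le add_increasing2 order_refl diff_le_eq)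
qed

lemma steep_near_mono: "steep_near q \<rho> M \<Longrightarrow> 0 < r \<Longrightarrow> r \<le> \<rho> \<Longrightarrow> steep_near q r M"
  unfolding steep_near_def by auto

lemma steep_near_node: "\<exists>\<rho>. steep_near (node j) \<rho> M"
proof -
  obtain N r where r: "0 < r" "\<And>t. \<bar>t - node j\<bar> \<le> r \<Longrightarrow> M \<le> slope_upto N t"
    using node_divergence[of j M] by blast
  define \<rho> where "\<rho> = min r (min (node j) (1 - node j))"
  have \<rho>: "0 < \<rho>" "\<rho> \<le> r" "0 \<le> node j - \<rho>" "node j + \<rho> \<le> 1"
    using r(1) node_bounds[of j] by (auto simp: \<rho>_def)
  have "M * (b - a) \<le> curve b - curve a" if "node j - \<rho> \<le> a" "a \<le> b" "b \<le> node j + \<rho>" for a b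
    by (rule curve_diff_ge[where N=N]) (use that \<rho> in \<open>auto intro!: r(2) simp: abs_le_iff\<close>)
  then show ?thesis using \<rho> unfolding steep_near_def by blast
qed

lemma steep_radii:
  obtains \<rho> :: "nat \<Rightarrow> nat \<Rightarrow> real" where
    "\<And>j m. steep_near (node j) (\<rho> j m) (real m)" "\<And>j m. \<rho> j (Suc m) \<le> \<rho> j m / 2"
proof -
  have "\<exists>f. \<forall>m. steep_near (node j) (f m) (real m) \<and> f (Suc m) \<le> f m / 2" for j
  proof (rule dependent_nat_choice)
    show "\<exists>x. steep_near (node j) x (real 0)" by (rule steep_near_node)
    fix x m assume "steep_near (node j) x (real m)"
    then have "0 < x" by (simp add: steep_near_def)
    obtain r where r: "steep_near (node j) r (real (Suc m))" using steep_near_node by blast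
    then have "0 < r" by (simp add: steep_near_def)
    have "steep_near (node j) (min r (x / 2)) (real (Suc m))"
      by (rule steep_near_mono[OF r]) (use \<open>0 < x\<close> \<open>0 < r\<close> in auto)
    then show "\<exists>y. steep_near (node j) y (real (Suc m)) \<and> y \<le> x / 2"
      by (intro exI[of _ "min r (x / 2)"]) auto
  qed
  then have "\<forall>j. \<exists>f. \<forall>m. steep_near (node j) (f m) (real m) \<and> f (Suc m) \<le> f m / 2" by blast
  from choice[OF this] that show thesis by blast
qed

text \<open>The penalty of a piece on which \<open>v\<close> stays away from \<open>curve\<close> and rises by \<open>\<Delta>\<close> more than slope \<open>k + 1\<close>
accounts for.\<close>

lemma penalty_ge_steep:
  assumes comp: "competitor v g" and c: "\<And>m. 0 \<le> c m" and ab: "0 \<le> a" "a \<le> b" "b \<le> 1"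
    and s: "\<And>t. t \<in> {a..b} \<Longrightarrow> s \<le> \<bar>v t - curve t\<bar>"
    and gain: "real (Suc k) * (b - a) + \<Delta> \<le> v b - v a"
  shows "ennreal (weight s * c k * \<Delta>) \<le> penalty c v g"
proof -
  have w: "0 \<le> weight s * c k" by (intro mult_nonneg_nonneg weight_nonneg c)
  have "weight s * c k * \<Delta> \<le> weight s * c k * (integral {a..b} g - real (Suc k) * (b - a))"
    using gain competitor_FTC[OF comp ab] by (intro mult_left_mono w) linarith
  also have "\<dots> = (weight s * c k) * integral {a..b} g + (- weight s * c k * real (Suc k)) * (b - a)"
    by (simp add: algebra_simps)
  finally have "ennreal (weight s * c k * \<Delta>)
      \<le> ennreal ((weight s * c k) * integral {a..b} g + (- weight s * c k * real (Suc k)) * (b - a))"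
    by (rule ennreal_leI)
  also have "\<dots> \<le> penalty c v g"
    unfolding penalty_def
  proof (rule affine_lower_bound[OF _ ab])
    show "integrable unit_measure g" using comp by (simp add: competitor_def)
    fix t assume t: "t \<in> {a..b}"
    have "weight s * c k * g t + - weight s * c k * real (Suc k) = weight s * (c k * (g t - real (Suc k)))"
      by (simp add: algebra_simps)
    also have "\<dots> \<le> weight s * growth c (g t)"
      by (intro mult_left_mono weight_nonneg growth_ge_linear c)
    also have "\<dots> \<le> weight \<bar>v t - curve t\<bar> * growth c (g t)"
      by (intro mult_right_mono weight_mono s t growth_nonneg c)
    finally show "weight s * c k * g t + - weight s * c k * real (Suc k) \<le> weight \<bar>v t - curve t\<bar> * growth c (g t)" .
  qed
  finally show ?thesis .
qed

text \<open>In the interval of radius \<open>\<rho> j (2 k)\<close> around a node inside \<open>[a,b]\<close> the chords of \<open>v\<close> have slope at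
least \<open>2 k - C\<close>, which exceeds \<open>k + 1\<close> by \<open>1\<close> for large \<open>k\<close>. The assumption on the coefficients makes
the penalty of this piece at least a multiple of \<open>k\<close>.\<close>

lemma penalty_infinite:
  assumes comp: "competitor v g" and c: "\<And>m. 0 \<le> c m"
    and lip: "C-lipschitz_on {0..1} (\<lambda>t. v t - curve t)"
    and ab: "0 \<le> a" "a < b" "b \<le> 1" and s: "0 < s" "\<And>t. t \<in> {a..b} \<Longrightarrow> s \<le> \<bar>v t - curve t\<bar>"
    and steep: "\<And>j m. steep_near (node j) (\<rho> j m) (real m)" and half: "\<And>j m. \<rho> j (Suc m) \<le> \<rho> j m / 2"
    and big: "\<And>j k. j \<le> k \<Longrightarrow> real k \<le> c k * \<rho> j (2 * k)"
  shows "penalty c v g = \<infinity>"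
proof -
  obtain j where j: "a < node j" "node j < b" using node_dense[OF ab] by blast
  have \<rho>_pos: "0 < \<rho> j m" for m using steep[of j m] by (simp add: steep_near_def)
  have \<rho>_le: "\<rho> j m \<le> (1/2) ^ m" for m
  proof (induction m)
    case 0
    show ?case using steep[of j 0] by (simp add: steep_near_def)
  next
    case (Suc m)
    then show ?case using half[of j m] by simp
  qed
  have "(\<lambda>m. (1/2 :: real) ^ m) \<longlonglongrightarrow> 0" by (intro LIMSEQ_power_zero) simp
  from order_tendstoD(2)[OF this, of "min (node j - a) (b - node j)"] j
  obtain m0 where m0: "\<And>m. m \<ge> m0 \<Longrightarrow> (1/2 :: real) ^ m < min (node j - a) (b - node j)"
    by (auto simp: eventually_sequentially)
  \<comment> \<open>large enough for the interval to fit into \<open>[a,b]\<close>, for the node to be covered by \<open>big\<close>, and for \<open>C + 2 \<le> k\<close>\<close>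
  define k0 where "k0 = m0 + j + nat \<lceil>C\<rceil> + 2"
  have bound: "ennreal (weight s * (2 * real k)) \<le> penalty c v g" if k: "k \<ge> k0" for k
  proof -
    define r where "r = \<rho> j (2 * k)"
    have r: "0 < r" "r < node j - a" "r < b - node j"
      using \<rho>_pos[of "2 * k"] \<rho>_le[of "2 * k"] m0[of "2 * k"] k by (auto simp: r_def k0_def)
    have kC: "C + 2 \<le> real k" using k of_nat_ceiling[of C] unfolding k0_def by linarith
    let ?a = "node j - r" and ?b = "node j + r"
    have "real (2 * k) * (?b - ?a) \<le> curve ?b - curve ?a"
      using steep_nearD[OF steep[of j "2 * k"]] unfolding r_def .
    moreover have "\<bar>(v ?b - curve ?b) - (v ?a - curve ?a)\<bar> \<le> C * (?b - ?a)"
      using lipschitz_onD[OF lip, of ?b ?a] r ab by (simp add: dist_real_def)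
    moreover have "(C + 2) * r \<le> real k * r" using kC r by (intro mult_right_mono) auto
    ultimately have gain: "real (Suc k) * (?b - ?a) + 2 * r \<le> v ?b - v ?a"
      by (simp add: algebra_simps abs_le_iff)
    have "ennreal (weight s * c k * (2 * r)) \<le> penalty c v g"
      by (rule penalty_ge_steep[OF comp c _ _ _ _ gain]) (use r ab s in auto)
    moreover have "weight s * (2 * real k) \<le> weight s * c k * (2 * r)"
      using big[of j k] k weight_nonneg[of s] unfolding r_def k0_def
      by (simp add: mult.assoc mult_left_mono)
    ultimately show ?thesis by (meson ennreal_leI order_trans)
  qed
  show ?thesis
  proof (rule ccontr)
    assume "penalty c v g \<noteq> \<infinity>"
    then obtain B where B: "penalty c v g = ennreal B" "0 \<le> B" by (cases "penalty c v g") auto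
    obtain k1 where k1: "B < real k1 * (2 * weight s)"
      using reals_Archimedean3[of "2 * weight s"] weight_pos[OF s(1)] by auto
    have "B < real (max k0 k1) * (2 * weight s)"
      using k1 weight_nonneg[of s] by (rule_tac less_le_trans[OF k1]) (intro mult_right_mono, auto)
    moreover have "weight s * (2 * real (max k0 k1)) \<le> B"
      using bound[of "max k0 k1"] B by (simp add: ennreal_le_iff)
    ultimately show False by (simp add: mult.commute mult.left_commute)
  qed
qed

lemma reflected_last_exit:
  fixes \<phi> :: "real \<Rightarrow> real"
  assumes cont: "continuous_on {x..y} \<phi>" and xy: "x \<le> y" "s \<le> \<phi> x" "\<phi> y \<le> s"
  obtains b where "b \<in> {x..y}" "\<phi> b = s" "\<And>t. t \<in> {x..b} \<Longrightarrow> s \<le> \<phi> t"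
proof -
  have "continuous_on {- y..- x} (\<lambda>t. \<phi> (- t))"
    by (intro continuous_on_compose2[OF cont] continuous_intros) auto
  then obtain a where a: "a \<in> {- y..- x}" "\<phi> (- a) = s" "\<And>t. t \<in> {a..- x} \<Longrightarrow> s \<le> \<phi> (- t)"
    by (rule last_exit) (use xy in auto)
  show thesis
  proof (rule that)
    show "- a \<in> {x..y}" "\<phi> (- a) = s" using a by auto
    fix t assume "t \<in> {x..- a}"
    then show "s \<le> \<phi> t" using a(3)[of "- t"] by auto
  qed
qed

text \<open>Suppose that \<open>v\<close> is above \<open>curve\<close> at \<open>t1\<close>, and follow it to the left. Either the deviation stays
above \<open>r / 8\<close> up to the distance \<open>\<rho>\<close>; then it changes by less than half the length of the piece.
Or it has increased from \<open>r / 8\<close> to at least \<open>r / 4\<close> along the piece that ends at \<open>t1\<close>. In both cases \<open>v\<close> is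
not much less steep than \<open>curve\<close> on average. If \<open>v\<close> is below \<open>curve\<close> at \<open>t1\<close>, the same happens to
the right.\<close>

lemma deviation_spreads:
  assumes comp: "competitor v g" and c: "\<And>m. 0 \<le> c m"
    and steep: "steep_near q \<rho> (real (k + 2))" and r: "0 < r" "r \<le> \<rho> / 2"
    and t1: "\<bar>t1 - q\<bar> \<le> r" "r / 4 \<le> \<bar>v t1 - curve t1\<bar>"
    and small: "\<And>t. \<bar>t - q\<bar> \<le> \<rho> \<Longrightarrow> \<bar>v t - curve t\<bar> < \<rho> / 4"
  shows "ennreal (weight (r / 8) * c k * (r / 8)) \<le> penalty c v g"
proof -
  define u where "u t = v t - curve t" for t
  have \<rho>: "0 < \<rho>" "0 \<le> q - \<rho>" "q + \<rho> \<le> 1" using steep by (auto simp: steep_near_def)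
  have gain: "real (Suc k) * (b - a) + \<Delta> \<le> v b - v a"
    if "q - \<rho> \<le> a" "a \<le> b" "b \<le> q + \<rho>" "\<Delta> \<le> (b - a) + (u b - u a)" for a b \<Delta>
  proof -
    have "real (k + 2) * (b - a) \<le> curve b - curve a" using steep that unfolding steep_near_def by auto
    then have "real (Suc k) * (b - a) + (b - a) \<le> curve b - curve a" by (simp add: algebra_simps)
    then show ?thesis using that(4) unfolding u_def by linarith
  qed
  have pen: "ennreal (weight (r / 8) * c k * (r / 8)) \<le> penalty c v g"
    if "q - \<rho> \<le> a" "a \<le> b" "b \<le> q + \<rho>" "r / 8 \<le> (b - a) + (u b - u a)"
      "\<And>t. t \<in> {a..b} \<Longrightarrow> r / 8 \<le> \<bar>u t\<bar>" for a b
    by (rule penalty_ge_steep[OF comp c _ _ _ _ gain[OF that(1-4)]]) (use that \<rho> in \<open>auto simp: u_def\<close>)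
  have uc: "continuous_on {0..1} u" unfolding u_def
    using comp by (intro continuous_intros continuous_curve) (simp add: competitor_def)
  have t1': "q - \<rho> \<le> t1" "t1 \<le> q + \<rho>" using t1(1) r by (auto simp: abs_le_iff)
  have u1: "r / 4 \<le> u t1 \<or> u t1 \<le> - (r / 4)" using t1(2) by (auto simp: u_def abs_if split: if_splits)
  then show ?thesis
  proof
    assume pos: "r / 4 \<le> u t1"
    show ?thesis
    proof (cases "\<forall>t\<in>{q - \<rho>..t1}. r / 8 \<le> u t")
      case True
      have "\<bar>v (q - \<rho>) - curve (q - \<rho>)\<bar> < \<rho> / 4" by (rule small) (use \<rho> in simp)
      then have "u (q - \<rho>) < \<rho> / 4" unfolding u_def by linarith
      moreover have "\<rho> / 2 \<le> t1 - (q - \<rho>)" using t1(1) r by (auto simp: abs_le_iff)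
      ultimately show ?thesis using t1' pos r True by (intro pen[of "q - \<rho>" t1]) force+
    next
      case False
      then obtain x where x: "x \<in> {q - \<rho>..t1}" "u x < r / 8" by force
      have "continuous_on {x..t1} u" using \<rho> t1' x by (auto intro: continuous_on_subset[OF uc])
      then obtain a where "a \<in> {x..t1}" "u a = r / 8" "\<And>t. t \<in> {a..t1} \<Longrightarrow> r / 8 \<le> u t"
        by (rule last_exit[of _ _ _ "r / 8"]) (use x t1' pos r in auto)
      then show ?thesis using t1' pos r x by (intro pen[of a t1]) force+
    qed
  next
    assume neg: "u t1 \<le> - (r / 4)"
    show ?thesis
    proof (cases "\<forall>t\<in>{t1..q + \<rho>}. r / 8 \<le> - u t")
      case True
      have "\<bar>v (q + \<rho>) - curve (q + \<rho>)\<bar> < \<rho> / 4" by (rule small) (use \<rho> in simp)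
      then have "- u (q + \<rho>) < \<rho> / 4" unfolding u_def by linarith
      moreover have "\<rho> / 2 \<le> (q + \<rho>) - t1" using t1(1) r by (auto simp: abs_le_iff)
      ultimately show ?thesis using t1' neg r True by (intro pen[of t1 "q + \<rho>"]) force+
    next
      case False
      then obtain y where y: "y \<in> {t1..q + \<rho>}" "- u y < r / 8" by force
      have "continuous_on {t1..y} (\<lambda>t. - u t)"
        using \<rho> t1' y by (auto intro!: continuous_intros continuous_on_subset[OF uc])
      then obtain b where "b \<in> {t1..y}" "- u b = r / 8" "\<And>t. t \<in> {t1..b} \<Longrightarrow> r / 8 \<le> - u t"
        by (rule reflected_last_exit[of _ _ _ "r / 8"]) (use y t1' neg r in auto)
      then show ?thesis using t1' neg r y by (intro pen[of t1 b]) force+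
    qed
  qed
qed

text \<open>At a scale at which \<open>curve\<close> is steeper than the Lipschitz constant allows \<open>v\<close> to be, \<open>v\<close> has to deviate.
By \<open>deviation_spreads\<close> the deviation spreads to all coarser scales down to \<open>m = 2\<close>, unless the
penalty is at least \<open>1\<close>.\<close>

lemma lipschitz_deviation:
  assumes comp: "competitor v g" and c: "\<And>m. 0 \<le> c m" and lip: "C-lipschitz_on {0..1} v"
    and steep: "\<And>m. steep_near q (\<rho> m) (real m)" and half: "\<And>m. \<rho> (Suc m) \<le> \<rho> m / 2"
    and big: "\<And>k. 1 \<le> weight (\<rho> (k + 3) / 8) * c k * (\<rho> (k + 3) / 8)"
  shows "1 \<le> penalty c v g \<or> (\<exists>t\<in>{0..1}. \<rho> 2 / 4 \<le> \<bar>v t - curve t\<bar>)"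
proof (rule ccontr)
  assume neg: "\<not> ?thesis"
  have \<rho>: "0 < \<rho> m" "0 \<le> q - \<rho> m" "q + \<rho> m \<le> 1" for m using steep[of m] by (auto simp: steep_near_def)
  define Q where "Q m \<longleftrightarrow> (\<exists>t. \<bar>t - q\<bar> \<le> \<rho> m \<and> \<rho> m / 4 \<le> \<bar>v t - curve t\<bar>)" for m
  have step: "Q (k + 2)" if Q3: "Q (k + 3)" for k
  proof (rule ccontr)
    assume nQ: "\<not> Q (k + 2)"
    obtain t1 where t1: "\<bar>t1 - q\<bar> \<le> \<rho> (k + 3)" "\<rho> (k + 3) / 4 \<le> \<bar>v t1 - curve t1\<bar>"
      using Q3 unfolding Q_def by blast
    have "ennreal 1 \<le> ennreal (weight (\<rho> (k + 3) / 8) * c k * (\<rho> (k + 3) / 8))"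
      by (intro ennreal_leI big)
    also have "\<dots> \<le> penalty c v g"
    proof (rule deviation_spreads[OF comp c steep _ _ t1])
      show "\<rho> (k + 3) \<le> \<rho> (k + 2) / 2" using half[of "k + 2"] by (simp add: eval_nat_numeral)
      show "\<And>t. \<bar>t - q\<bar> \<le> \<rho> (k + 2) \<Longrightarrow> \<bar>v t - curve t\<bar> < \<rho> (k + 2) / 4"
        using nQ unfolding Q_def by (meson not_le)
    qed (rule \<rho>)
    finally show False using neg by simp
  qed
  \<comment> \<open>the slope \<open>m\<close> exceeds \<open>C\<close> by at least \<open>1\<close>\<close>
  define m where "m = nat \<lceil>C\<rceil> + 1 + 2"
  have "Q m"
  proof (rule ccontr)
    assume "\<not> Q m"
    then have small: "\<bar>v t - curve t\<bar> < \<rho> m / 4" if "\<bar>t - q\<bar> \<le> \<rho> m" for t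
      using that unfolding Q_def by (meson not_le)
    let ?a = "q - \<rho> m" and ?b = "q + \<rho> m"
    have "real m * (?b - ?a) \<le> curve ?b - curve ?a"
      by (rule steep_nearD[OF steep])
    moreover have "v ?b - v ?a \<le> C * (?b - ?a)"
      using lipschitz_onD[OF lip, of ?b ?a] \<rho>[of m] by (simp add: dist_real_def abs_le_iff)
    moreover have "(C + 1) * \<rho> m \<le> real m * \<rho> m"
      using \<rho>(1)[of m] of_nat_ceiling[of C] unfolding m_def by (intro mult_right_mono) auto
    moreover have "\<bar>v ?a - curve ?a\<bar> < \<rho> m / 4" "\<bar>v ?b - curve ?b\<bar> < \<rho> m / 4"
      by (rule small, use \<rho>(1)[of m] in simp)+
    ultimately show False using \<rho>(1)[of m] by (simp add: algebra_simps abs_less_iff)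
  qed
  then have "Q (nat \<lceil>C\<rceil> + 1 + 2)" by (simp only: m_def)
  moreover have "Q (n + 2) \<Longrightarrow> Q 2" for n
    by (induction n) (use step in \<open>auto simp: eval_nat_numeral\<close>)
  ultimately have "Q 2" by blast
  then obtain t where "\<bar>t - q\<bar> \<le> \<rho> 2" "\<rho> 2 / 4 \<le> \<bar>v t - curve t\<bar>" unfolding Q_def by blast
  then show False using neg \<rho>[of 2] by (auto simp: abs_le_iff)
qed

lemma competitor_of_admissible:
  "v \<in> admissible 1 A B \<Longrightarrow> competitor v (weak_deriv 1 v)"
  unfolding admissible_def Sobolev_space_def competitor_def
  using weak_derivI continuous_on_of_abs_continuous by blast

text \<open>\<open>weak_deriv\<close> has to be known to be a weak derivative before any energy of a perturbation can be
estimated. The existence of one comes from the density of the Lipschitz function.\<close>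

lemma competitor_of_perturbation:
  assumes "C-lipschitz_on {0..1} u"
  shows "competitor (\<lambda>t. curve t + u t) (weak_deriv 1 (\<lambda>t. curve t + u t))"
proof -
  obtain h where h: "h \<in> borel_measurable borel" "set_integrable lborel {0..1} h"
    "\<And>t. t \<in> {0..1} \<Longrightarrow> u t = u 0 + (LBINT s:{0..t}. h s)"
    using lipschitz_has_density[OF assms] by auto
  have uc: "continuous_on {0..1} u" using assms by (rule lipschitz_on_continuous_on)
  have hw: "has_weak_derivative 1 u h" by (rule has_weak_derivative_of_FTC[OF h(1,2) _ h(3)]) auto
  have hi: "integrable unit_measure h"
  proof -
    have "set_integrable lebesgue {0..1} h"
      using h(1,2) unfolding set_integrable_def by (subst integrable_completion) auto
    then show ?thesis by (rule absolutely_integrable_imp_integrable) simp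
  qed
  have hs: "integrable unit_measure (\<lambda>t. slope t + h t)" using hi integrable_slope by simp
  have "has_weak_derivative 1 (\<lambda>t. curve t + u t) (\<lambda>t. slope t + h t)"
    unfolding has_weak_derivative_def
  proof (intro allI impI)
    fix \<phi> :: "real \<Rightarrow> real"
    assume \<phi>: "\<phi> C1_differentiable_on UNIV \<and> closure {t. \<phi> t \<noteq> 0} \<subseteq> {0<..<1}"
    obtain D where D: "\<And>t. (\<phi> has_vector_derivative D t) (at t)" "continuous_on UNIV D"
      using \<phi> unfolding C1_differentiable_on_def by auto
    have d: "deriv \<phi> = D"
      using D(1) by (auto simp: has_real_derivative_iff_has_vector_derivative[symmetric] intro: DERIV_imp_deriv)
    have \<phi>c: "continuous_on {0..1} \<phi>"
      using D(1) by (meson continuous_at_imp_continuous_on has_vector_derivative_continuous)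
    have Dc: "continuous_on {0..1} D" using D(2) by (rule continuous_on_subset) simp
    have bnd: "integrable unit_measure (\<lambda>t. k t * \<phi> t)" if k: "integrable unit_measure k" for k :: "real \<Rightarrow> real"
    proof -
      obtain B where "\<forall>x\<in>\<phi> ` {0..1}. norm x \<le> B"
        using compact_imp_bounded[OF compact_continuous_image[OF \<phi>c compact_Icc]]
        unfolding bounded_iff by blast
      then have B: "\<bar>\<phi> t\<bar> \<le> B" if "t \<in> {0..1}" for t using that by force
      show ?thesis
      proof (rule Bochner_Integration.integrable_bound)
        show "integrable unit_measure (\<lambda>t. B * k t)" using k by simp
        show "(\<lambda>t. k t * \<phi> t) \<in> borel_measurable unit_measure"
          using k continuous_imp_integrable_real[OF \<phi>c] by (intro borel_measurable_times) auto
        show "AE t in unit_measure. norm (k t * \<phi> t) \<le> norm (B * k t)"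
        proof (rule AE_I2)
          fix t assume "t \<in> space unit_measure"
          then have "\<bar>\<phi> t\<bar> \<le> \<bar>B\<bar>" using B[of t] by simp
          then show "norm (k t * \<phi> t) \<le> norm (B * k t)"
            using mult_right_mono[of "\<bar>\<phi> t\<bar>" "\<bar>B\<bar>" "\<bar>k t\<bar>"] by (simp add: abs_mult mult.commute)
        qed
      qed
    qed
    have "(\<integral>t. (curve t + u t) * deriv \<phi> t \<partial>unit_measure)
        = (\<integral>t. curve t * deriv \<phi> t \<partial>unit_measure) + (\<integral>t. u t * deriv \<phi> t \<partial>unit_measure)"
      unfolding d distrib_right
      by (intro Bochner_Integration.integral_add continuous_imp_integrable_real continuous_intros continuous_curve uc Dc)
    also have "\<dots> = - ((\<integral>t. slope t * \<phi> t \<partial>unit_measure) + (\<integral>t. h t * \<phi> t \<partial>unit_measure))"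
      using curve_has_weak_derivative hw \<phi> unfolding has_weak_derivative_def by simp
    also have "(\<integral>t. slope t * \<phi> t \<partial>unit_measure) + (\<integral>t. h t * \<phi> t \<partial>unit_measure) = (\<integral>t. (slope t + h t) * \<phi> t \<partial>unit_measure)"
      unfolding distrib_right by (intro Bochner_Integration.integral_add[symmetric] bnd integrable_slope hi)
    finally show "(\<integral>t. (curve t + u t) * deriv \<phi> t \<partial>unit_measure) = - (\<integral>t. (slope t + h t) * \<phi> t \<partial>unit_measure)" .
  qed
  moreover have "(\<lambda>t. slope t + h t) \<in> Lebesgue_space 1 1"
    using hs by (auto simp: Lebesgue_space_def)
  ultimately show ?thesis
    using weak_derivI[of "\<lambda>t. slope t + h t" 1 "\<lambda>t. curve t + u t"] uc continuous_curve
    by (auto simp: competitor_def intro: continuous_on_add)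
qed

text \<open>The two requirements on the coefficients involve the radii, hence the function \<open>slope\<close>: the growth
function depends on the minimizer.\<close>

lemma coefficients_exist:
  fixes \<rho> :: "nat \<Rightarrow> nat \<Rightarrow> real"
  assumes \<rho>: "\<And>j m. 0 < \<rho> j m"
  obtains c :: "nat \<Rightarrow> real" where "\<And>m. 0 \<le> c m"
    "\<And>j k. j \<le> k \<Longrightarrow> real k \<le> c k * \<rho> j (2 * k)"
    "\<And>k. 1 \<le> weight (\<rho> 0 (k + 3) / 8) * c k * (\<rho> 0 (k + 3) / 8)"
proof -
  define X where "X k = weight (\<rho> 0 (k + 3) / 8) * (\<rho> 0 (k + 3) / 8)" for k
  define B where "B k = (\<Sum>j\<le>k. real k / \<rho> j (2 * k))" for k
  have X: "0 < X k" for k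
    unfolding X_def using \<rho>[of 0 "k + 3"] by (intro mult_pos_pos weight_pos) auto
  have B: "0 \<le> B k" for k unfolding B_def using \<rho> by (intro sum_nonneg divide_nonneg_pos) auto
  show thesis
  proof (rule that[of "\<lambda>k. 1 / X k + B k"])
    show "0 \<le> 1 / X m + B m" for m using X[of m] B[of m] by simp
    show "real k \<le> (1 / X k + B k) * \<rho> j (2 * k)" if "j \<le> k" for j k
    proof -
      have "real k / \<rho> j (2 * k) \<le> B k" unfolding B_def
        using that \<rho> by (intro member_le_sum[of j "{..k}" "\<lambda>j. real k / \<rho> j (2 * k)"]) (auto intro: divide_nonneg_pos)
      moreover have "0 \<le> 1 / X k" using X[of k] by simp
      ultimately have "real k / \<rho> j (2 * k) \<le> 1 / X k + B k" by linarith
      then show ?thesis using \<rho>[of j "2 * k"] by (simp add: divide_le_eq)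
    qed
    show "1 \<le> weight (\<rho> 0 (k + 3) / 8) * (1 / X k + B k) * (\<rho> 0 (k + 3) / 8)" for k
    proof -
      have "1 = 1 / X k * X k" using X[of k] by simp
      also have "\<dots> \<le> (1 / X k + B k) * X k" using X[of k] B[of k] by (intro mult_right_mono) auto
      also have "\<dots> = weight (\<rho> 0 (k + 3) / 8) * (1 / X k + B k) * (\<rho> 0 (k + 3) / 8)"
        by (simp only: X_def[of k] mult_ac)
      finally show ?thesis .
    qed
  qed
qed

theorem theorem20:
  shows "\<exists>(T::real) (w::real \<Rightarrow> real) (L::real \<Rightarrow> real \<Rightarrow> real \<Rightarrow> real).
     T > 0 \<and> w \<in> Sobolev_space T 2 \<and>
     continuous_lagrangian T L \<and> superlinear T L \<and> L_pp_ge T L 2 \<and>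
     is_minimizer L T (w 0) (w T) w \<and>
     0 \<le> functional L T w \<and> functional L T w < \<infinity> \<and>
     (\<forall>u \<in> Sobolev_inf_0 T. (\<exists>t\<in>{0..T}. u t \<noteq> 0) \<longrightarrow>
        functional L T (\<lambda>t. w t + u t) = \<infinity>) \<and>
     lavrentiev_phenomenon L T w"
proof -
  obtain \<rho> :: "nat \<Rightarrow> nat \<Rightarrow> real" where steep: "\<And>j m. steep_near (node j) (\<rho> j m) (real m)"
    and half: "\<And>j m. \<rho> j (Suc m) \<le> \<rho> j m / 2" using steep_radii by blast
  have \<rho>: "0 < \<rho> j m" for j m using steep[of j m] by (simp add: steep_near_def)
  obtain c :: "nat \<Rightarrow> real" where c: "\<And>m. 0 \<le> c m"
    and c_blowup: "\<And>j k. j \<le> k \<Longrightarrow> real k \<le> c k * \<rho> j (2 * k)"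
    and c_lavrentiev: "\<And>k. 1 \<le> weight (\<rho> 0 (k + 3) / 8) * c k * (\<rho> 0 (k + 3) / 8)"
    using coefficients_exist[of \<rho>] \<rho> by blast
  let ?L = "lagrangian c"
  have gap: "functional ?L 1 curve + penalty c v (weak_deriv 1 v) / 4 \<le> functional ?L 1 v"
    if "v \<in> admissible 1 (curve 0) (curve 1)" for v
    using functional_gap[where c=c, OF competitor_of_admissible[OF that] c] that by (simp add: admissible_def)
  have min: "is_minimizer ?L 1 (curve 0) (curve 1) curve"
    unfolding is_minimizer_def
  proof (intro conjI ballI)
    show "curve \<in> admissible 1 (curve 0) (curve 1)" using curve_Sobolev(1) by (simp add: admissible_def)
    fix v assume "v \<in> admissible 1 (curve 0) (curve 1)"
    from gap[OF this] show "functional ?L 1 curve \<le> functional ?L 1 v"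
      by (rule order_trans[rotated]) simp
  qed
  have fin: "functional ?L 1 curve < \<infinity>" by (simp add: functional_curve[of c, OF c])
  have blowup: "functional ?L 1 (\<lambda>t. curve t + u t) = \<infinity>"
    if u: "u \<in> Sobolev_inf_0 1" "\<exists>t\<in>{0..1}. u t \<noteq> 0" for u
  proof -
    obtain C where lip: "C-lipschitz_on {0..1} u" and u01: "u 0 = 0" "u 1 = 0"
      using u(1) by (auto simp: Sobolev_inf_0_def Sobolev_inf_def)
    obtain t0 where t0: "t0 \<in> {0..1}" "u t0 \<noteq> 0" using u(2) by blast
    then have t0': "0 < t0" "t0 < 1" using u01 by (auto simp: less_le)
    have uc: "continuous_on {0..1} u" using lip by (rule lipschitz_on_continuous_on)
    define s where "s = \<bar>u t0\<bar> / 2"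
    have s: "0 < s" using t0 by (simp add: s_def)
    obtain d where d: "0 < d" "\<And>t. t \<in> {0..1} \<Longrightarrow> dist t t0 < d \<Longrightarrow> dist (u t) (u t0) < s"
      using uc t0(1) s unfolding continuous_on_iff by blast
    define b where "b = min 1 (t0 + d / 2)"
    have "penalty c (\<lambda>t. curve t + u t) (weak_deriv 1 (\<lambda>t. curve t + u t)) = \<infinity>"
    proof (rule penalty_infinite[OF competitor_of_perturbation[OF lip] c _ _ _ _ s _ steep half c_blowup])
      show "C-lipschitz_on {0..1} (\<lambda>t. curve t + u t - curve t)" using lip by simp
      show "0 \<le> t0" "t0 < b" "b \<le> 1" using t0' d(1) by (auto simp: b_def)
      fix t assume t: "t \<in> {t0..b}"
      then have "dist (u t) (u t0) < s" using t0' d by (intro d(2)) (auto simp: b_def dist_real_def)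
      then show "s \<le> \<bar>curve t + u t - curve t\<bar>" unfolding s_def dist_real_def by (simp add: abs_if split: if_splits)
    qed
    then show ?thesis using functional_eq[where c=c, OF competitor_of_perturbation[OF lip] c] by simp
  qed
  have lav: "lavrentiev_phenomenon ?L 1 curve"
  proof -
    define \<eta> where "\<eta> = \<rho> 0 2 / 4"
    have \<eta>: "0 < \<eta>" using \<rho> by (simp add: \<eta>_def)
    obtain m where m: "(1/4 :: real) ^ m < \<eta> / 2" using real_arch_pow_inv[of "\<eta> / 2" "1/4"] \<eta> by auto
    define e where "e = min 1 (weight (\<eta> / 2) * (\<eta> / 2 - (1/4) ^ m / real (Suc m)) / real (Suc m))"
    have "(1/4 :: real) ^ m / real (Suc m) \<le> (1/4) ^ m / 1" by (intro divide_left_mono) auto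
    then have "0 < \<eta> / 2 - (1/4) ^ m / real (Suc m)" using m unfolding div_by_1 by linarith
    then have "0 < weight (\<eta> / 2) * (\<eta> / 2 - (1/4) ^ m / real (Suc m)) / real (Suc m)"
      using \<eta> by (intro divide_pos_pos mult_pos_pos weight_pos) simp_all
    then have e: "0 < e" unfolding e_def by (simp only: min_less_iff_conj zero_less_one simp_thms)
    have pen: "ennreal e \<le> penalty c v (weak_deriv 1 v)"
      if v: "v \<in> Sobolev_inf 1 \<inter> admissible 1 (curve 0) (curve 1)" for v
    proof -
      have comp: "competitor v (weak_deriv 1 v)" and v0: "v 0 = curve 0"
        using v competitor_of_admissible by (auto simp: admissible_def)
      obtain C where "C-lipschitz_on {0..1} v" using v by (auto simp: Sobolev_inf_def)
      from lipschitz_deviation[where c=c, OF comp c this steep half c_lavrentiev]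
      show ?thesis
      proof
        assume "1 \<le> penalty c v (weak_deriv 1 v)"
        moreover have "ennreal e \<le> ennreal 1" by (intro ennreal_leI) (simp add: e_def)
        ultimately show ?thesis by (metis ennreal_1 order_trans)
      next
        assume "\<exists>t\<in>{0..1}. \<rho> 0 2 / 4 \<le> \<bar>v t - curve t\<bar>"
        then obtain t where t: "t \<in> {0..1}" "\<eta> \<le> \<bar>v t - curve t\<bar>" by (auto simp: \<eta>_def)
        have "ennreal e \<le> ennreal (weight (\<eta> / 2) * (\<eta> / 2 - (1/4) ^ m / real (Suc m)) / real (Suc m))"
          by (intro ennreal_leI) (simp add: e_def)
        also have "\<dots> \<le> penalty c v (weak_deriv 1 v)"
          by (rule penalty_ge_of_deviation[OF comp c v0 t(1) \<eta> t(2)])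
        finally show ?thesis .
      qed
    qed
    have "functional ?L 1 curve < functional ?L 1 curve + ennreal e / 4"
      using fin e by (simp add: divide_ennreal[symmetric] ennreal_zero_less_divide less_top)
    also have "\<dots> \<le> (INF v \<in> Sobolev_inf 1 \<inter> admissible 1 (curve 0) (curve 1). functional ?L 1 v)"
    proof (rule INF_greatest)
      fix v assume v: "v \<in> Sobolev_inf 1 \<inter> admissible 1 (curve 0) (curve 1)"
      have "functional ?L 1 curve + ennreal e / 4 \<le> functional ?L 1 curve + penalty c v (weak_deriv 1 v) / 4"
        by (intro add_left_mono divide_right_mono_ennreal pen v)
      also have "\<dots> \<le> functional ?L 1 v" using v by (intro gap) simp
      finally show "functional ?L 1 curve + ennreal e / 4 \<le> functional ?L 1 v" .
    qed
    finally show ?thesis using lavrentiev_phenomenon_iff_INF[of ?L 1 curve] min fin by simp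
  qed
  show ?thesis
    by (intro exI[of _ 1] exI[of _ curve] exI[of _ ?L] conjI ballI impI curve_Sobolev
        continuous_lagrangian_lagrangian superlinear_lagrangian L_pp_lagrangian c min fin blowup lav) auto
qed

end
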